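(* Let $k>3$. For any proper synchronous $k$-player protocol $\pi$ computing $\mathsf{Disj}_k^n$ (with zero error), $\mathsf{PIC}_{\mu^n}(\pi)=\Omega(kn)$, where the implicit constant does not depend on $k$, $n$ or $\pi$.
   Context: Model (asynchronous number-in-hand peer-to-peer model). There are $k$ players. Player $i$ receives an input $x_i\in\{0,1\}^n$, has a private random string $R_i$, and all players share a public random string $R^p$. Every pair of players is joined by a bidirectional link with finite but unbounded delivery time and FIFO order in each direction. The view of player $i$ consists of $x_i$, $R_i$, $R^p$ and the messages read so far. A protocol specifies, for each player $i$ and each local round $\ell\ge1$, functions of the view of player $i$ at the end of local round $\ell-1$ giving: a set of recipients and, for each recipient $j$, a self-delimiting message in $\{0,1\}^*$ sent by $i$ to $j$; a value in $\{0,1\}^*\cup\{\bot\}$ — if not $\bot$, player $i$ stops and outputs it; otherwise a set of players from each of which player $i$ then waits to read one complete message, ending the local round. $\Pi_{i,j}^s$ is the sequence of messages sent by $i$ to $j$, $\Pi_{i,j}^r$ the sequence of messages read by $i$ from $j$, $\Pi_i=(\Pi_{i,j}^s,\Pi_{i,j}^r)_{j\ne i}$. A protocol is proper synchronous if there is an integer $t_f$ such that for every player $i$, input $x$ and randomness $r$: in every local round $t<t_f$ player $i$ sends messages to all other players and reads messages from all other players, and player $i$ stops at local round $t_f$. Computing with zero error means that on every input and randomness every player stops and outputs $\mathsf{Disj}_k^n(x)=\bigvee_{\ell=1}^n\bigwedge_{i=1}^kx_i^\ell$. Distribution $\mu$ of $(X,M,Z)$ with $X\in\{0,1\}^k$: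 draw $M$ with $\Pr[M=0]=\frac23$, $\Pr[M=1]=\frac13$, independently $Z$ uniform in $\{1,\dots,k\}$; set $X_Z=0$; if $M=0$ draw $X_{-Z}$ uniformly in $\{0,1\}^{k-1}$, if $M=1$ set $X_{-Z}=1^{k-1}$. $\mu^n$: $n$ independent copies, player $i$'s input being $X_i=(X_i^1,\dots,X_i^n)$, independent of the randomness. Public information cost: $$\mathsf{PIC}_{\mu^n}(\pi)=\sum_{i=1}^kI(X_{-i};\Pi_iR_{-i}\mid X_iR_iR^p).$$ *)

theory Defs
  imports "HOL-Probability.Probability" "HOL-Library.Sublist"
begin

text \<open>Players are \<open>0, \<dots>, k - 1\<close> and coordinates are \<open>0, \<dots>, n - 1\<close>.\<close>

type_synonym bits = "bool list"

text \<open>The view of a player: its input, its private random string, the public random string, and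
  for each player \<open>j\<close> the sequence of messages read from \<open>j\<close> so far.\<close>

type_synonym view = "bits \<times> (nat \<Rightarrow> bool) \<times> (nat \<Rightarrow> bool) \<times> (nat \<Rightarrow> bits list)"

text \<open>The arguments are a player, a local round \<open>\<ge> 1\<close>, and the view of that player at the end of
  the preceding local round. \<open>msgs\<close> maps each recipient to the message sent to it; \<open>reads\<close> is the
  set of players to wait for, relevant only if \<open>outp\<close> is \<open>None\<close>.\<close>

record protocol =
  msgs :: "nat \<Rightarrow> nat \<Rightarrow> view \<Rightarrow> nat \<Rightarrow> bits option"
  outp :: "nat \<Rightarrow> nat \<Rightarrow> view \<Rightarrow> bits option"
  reads :: "nat \<Rightarrow> nat \<Rightarrow> view \<Rightarrow> nat set"

definition is_protocol :: "nat \<Rightarrow> protocol \<Rightarrow> bool" where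
  "is_protocol k \<pi> \<longleftrightarrow> (\<forall>i<k. \<forall>l\<ge>1. \<forall>v.
     dom (msgs \<pi> i l v) \<subseteq> {..<k} - {i} \<and> reads \<pi> i l v \<subseteq> {..<k} - {i})"


subsection \<open>Asynchronous execution\<close>

text \<open>\<open>rcvd\<close> and \<open>sent\<close> are indexed by the other endpoint of the link. A player's local state is
  recorded just after it has sent the messages of its current local round \<open>rnd\<close> (so \<open>sent\<close> includes
  them) and before it has read any message of that round (so \<open>rcvd\<close> is still what it had read at
  the end of local round \<open>rnd - 1\<close>).\<close>

record lstate =
  rnd :: nat
  rcvd :: "nat \<Rightarrow> bits list"
  sent :: "nat \<Rightarrow> bits list"

type_synonym config = "nat \<Rightarrow> lstate"

locale run =
  fixes k :: nat and \<pi> :: protocol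
    and x :: "nat \<Rightarrow> bits" and r :: "nat \<Rightarrow> nat \<Rightarrow> bool" and p :: "nat \<Rightarrow> bool"
begin

definition enter :: "nat \<Rightarrow> nat \<Rightarrow> (nat \<Rightarrow> bits list) \<Rightarrow> (nat \<Rightarrow> bits list) \<Rightarrow> lstate" where
  "enter i l R S = \<lparr>rnd = l, rcvd = R,
     sent = (\<lambda>j. case msgs \<pi> i l (x i, r i, p, R) j of None \<Rightarrow> S j | Some m \<Rightarrow> S j @ [m])\<rparr>"

definition start :: config where
  "start i = enter i 1 (\<lambda>_. []) (\<lambda>_. [])"

definition view_of :: "config \<Rightarrow> nat \<Rightarrow> view" where
  "view_of c i = (x i, r i, p, rcvd (c i))"

definition result :: "config \<Rightarrow> nat \<Rightarrow> bits option" where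
  "result c i = outp \<pi> i (rnd (c i)) (view_of c i)"

definition waits_for :: "config \<Rightarrow> nat \<Rightarrow> nat set" where
  "waits_for c i = reads \<pi> i (rnd (c i)) (view_of c i)"

definition recipients :: "config \<Rightarrow> nat \<Rightarrow> nat set" where
  "recipients c i = dom (msgs \<pi> i (rnd (c i)) (view_of c i))"

definition available :: "config \<Rightarrow> nat \<Rightarrow> nat \<Rightarrow> bool" where
  "available c i j \<longleftrightarrow> length (rcvd (c i) j) < length (sent (c j) i)"

text \<open>By the FIFO property the next message on a link is the oldest one not yet read.\<close>

definition next_msg :: "config \<Rightarrow> nat \<Rightarrow> nat \<Rightarrow> bits" where
  "next_msg c i j = sent (c j) i ! length (rcvd (c i) j)"

text \<open>One step: some player ends its current local round and enters the next one. The order in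
  which the players take such steps is arbitrary; since a message is consumed only when the reading
  player takes its step, and that step may be delayed arbitrarily after the message was sent,
  this accounts for all delivery times.\<close>

inductive step :: "config \<Rightarrow> config \<Rightarrow> bool" where
  "i < k \<Longrightarrow> result c i = None \<Longrightarrow> \<forall>j\<in>waits_for c i. available c i j \<Longrightarrow>
   step c (c(i := enter i (Suc (rnd (c i)))
     (\<lambda>j. if j \<in> waits_for c i then rcvd (c i) j @ [next_msg c i j] else rcvd (c i) j)
     (sent (c i))))"

definition reachable :: "config \<Rightarrow> bool" where
  "reachable c \<longleftrightarrow> step\<^sup>*\<^sup>* start c"

definition all_stopped :: "config \<Rightarrow> bool" where
  "all_stopped c \<longleftrightarrow> (\<forall>i<k. result c i \<noteq> None)"

text \<open>Every player stops, whatever the delivery times: every maximal execution is finite and ends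
  with all players stopped.\<close>

definition halts :: bool where
  "halts \<longleftrightarrow> (\<nexists>f. f 0 = start \<and> (\<forall>t. step (f t) (f (Suc t)))) \<and>
     (\<forall>c. reachable c \<and> (\<nexists>c'. step c c') \<longrightarrow> all_stopped c)"

text \<open>\<open>\<Pi>\<^sub>i\<close>. As players choose whom to wait for as a function of their own view, steps of distinct
  players commute, and the final configuration does not depend on the schedule.\<close>

definition transcript :: "nat \<Rightarrow> nat \<Rightarrow> bits list \<times> bits list" where
  "transcript i = (THE \<tau>. \<exists>c. reachable c \<and> all_stopped c \<and>
     \<tau> = (\<lambda>j\<in>{..<k} - {i}. (sent (c i) j, rcvd (c i) j)))"

end


subsection \<open>Properties of protocols\<close>

definition inputs :: "nat \<Rightarrow> nat \<Rightarrow> (nat \<Rightarrow> bits) set" where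
  "inputs k n = {..<k} \<rightarrow>\<^sub>E {xs. length xs = n}"

definition disj :: "nat \<Rightarrow> nat \<Rightarrow> (nat \<Rightarrow> bits) \<Rightarrow> bool" where
  "disj k n x \<longleftrightarrow> (\<exists>l<n. \<forall>i<k. x i ! l)"

definition computes_disj :: "nat \<Rightarrow> nat \<Rightarrow> protocol \<Rightarrow> bool" where
  "computes_disj k n \<pi> \<longleftrightarrow> (\<forall>x\<in>inputs k n. \<forall>r p.
     run.halts k \<pi> x r p \<and>
     (\<forall>c i y. run.reachable k \<pi> x r p c \<and> i < k \<and> run.result \<pi> x r p c i = Some y
        \<longrightarrow> y = [disj k n x]))"

text \<open>As local rounds are numbered from 1, \<open>tf \<ge> 1\<close> is implied. All messages awaited in a local
  round \<open>t < tf\<close> are eventually read because every other player sends one in each of its local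
  rounds up to \<open>t\<close>.\<close>

definition proper_synchronous :: "nat \<Rightarrow> nat \<Rightarrow> protocol \<Rightarrow> bool" where
  "proper_synchronous k n \<pi> \<longleftrightarrow> (\<exists>tf. \<forall>x\<in>inputs k n. \<forall>r p c. \<forall>i<k.
     run.reachable k \<pi> x r p c \<longrightarrow>
       (rnd (c i) < tf \<and> run.result \<pi> x r p c i = None \<and>
          run.recipients \<pi> x r p c i = {..<k} - {i} \<and>
          run.waits_for \<pi> x r p c i = {..<k} - {i}) \<or>
       (rnd (c i) = tf \<and> run.result \<pi> x r p c i \<noteq> None))"

text \<open>A reader can tell from its view where each message it reads ends: among the messages that it
  may be about to read from \<open>j\<close> given its view, none is a proper prefix of another. This is implied
  by prefix-freeness of the set of all messages sent along a link.\<close>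

definition self_delimiting :: "nat \<Rightarrow> nat \<Rightarrow> protocol \<Rightarrow> bool" where
  "self_delimiting k n \<pi> \<longleftrightarrow> (\<forall>x\<in>inputs k n. \<forall>x'\<in>inputs k n. \<forall>r r' p p' c c'. \<forall>i<k.
     run.reachable k \<pi> x r p c \<and> run.reachable k \<pi> x' r' p' c' \<and>
     rnd (c i) = rnd (c' i) \<and> run.view_of x r p c i = run.view_of x' r' p' c' i \<and>
     run.result \<pi> x r p c i = None \<longrightarrow>
     (\<forall>j\<in>run.waits_for \<pi> x r p c i. run.available c i j \<and> run.available c' i j \<and>
        prefix (run.next_msg c i j) (run.next_msg c' i j)
        \<longrightarrow> run.next_msg c i j = run.next_msg c' i j))"

text \<open>A random string is an infinite sequence of independent fair bits.\<close>

definition coins :: "(nat \<Rightarrow> bool) measure" where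
  "coins = (\<Pi>\<^sub>M _\<in>UNIV. measure_pmf (bernoulli_pmf (1/2)))"

definition randomness :: "nat \<Rightarrow> ((nat \<Rightarrow> nat \<Rightarrow> bool) \<times> (nat \<Rightarrow> bool)) measure" where
  "randomness k = (\<Pi>\<^sub>M _\<in>{..<k}. coins) \<Otimes>\<^sub>M coins"

definition transcript_space :: "nat \<Rightarrow> nat \<Rightarrow> (nat \<Rightarrow> bits list \<times> bits list) measure" where
  "transcript_space k i = (\<Pi>\<^sub>M _\<in>{..<k} - {i}. count_space UNIV)"

text \<open>The random strings being infinite, the transcripts have to be required to be random
  variables; this holds if the functions specifying the protocol are measurable.\<close>

definition measurable_transcripts :: "nat \<Rightarrow> nat \<Rightarrow> protocol \<Rightarrow> bool" where
  "measurable_transcripts k n \<pi> \<longleftrightarrow> (\<forall>x\<in>inputs k n. \<forall>i<k.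
     (\<lambda>(r, p). run.transcript k \<pi> x r p i) \<in> randomness k \<rightarrow>\<^sub>M transcript_space k i)"


subsection \<open>Input distribution and information cost\<close>

text \<open>\<open>(X, M, Z)\<close>, where \<open>M = True\<close> stands for \<open>M = 1\<close>.\<close>

definition mu :: "nat \<Rightarrow> ((nat \<Rightarrow> bool) \<times> bool \<times> nat) pmf" where
  "mu k = do {
     M \<leftarrow> bernoulli_pmf (1/3);
     Z \<leftarrow> pmf_of_set {..<k};
     Y \<leftarrow> (if M then return_pmf (\<lambda>i\<in>{..<k} - {Z}. True)
           else pmf_of_set ({..<k} - {Z} \<rightarrow>\<^sub>E UNIV));
     return_pmf (Y(Z := False), M, Z)
   }"

definition mu_pow :: "nat \<Rightarrow> nat \<Rightarrow> (nat \<Rightarrow> (nat \<Rightarrow> bool) \<times> bool \<times> nat) pmf" where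
  "mu_pow k n = Pi_pmf {..<n} undefined (\<lambda>_. mu k)"

definition input_of ::
    "nat \<Rightarrow> nat \<Rightarrow> (nat \<Rightarrow> (nat \<Rightarrow> bool) \<times> bool \<times> nat) \<Rightarrow> nat \<Rightarrow> bits" where
  "input_of k n w = (\<lambda>i\<in>{..<k}. map (\<lambda>l. fst (w l) i) [0..<n])"

definition PIC :: "nat \<Rightarrow> nat \<Rightarrow> protocol \<Rightarrow> real" where
  "PIC k n \<pi> = (\<Sum>i<k.
     prob_space.conditional_mutual_information (measure_pmf (mu_pow k n) \<Otimes>\<^sub>M randomness k) 2
       (\<Pi>\<^sub>M _\<in>{..<k} - {i}. count_space UNIV)
       (transcript_space k i \<Otimes>\<^sub>M (\<Pi>\<^sub>M _\<in>{..<k} - {i}. coins))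
       (count_space UNIV \<Otimes>\<^sub>M coins \<Otimes>\<^sub>M coins)
       (\<lambda>(w, r, p). restrict (input_of k n w) ({..<k} - {i}))
       (\<lambda>(w, r, p). (run.transcript k \<pi> (input_of k n w) r p i, restrict r ({..<k} - {i})))
       (\<lambda>(w, r, p). (input_of k n w i, r i, p)))"

end

(*
  For fixed randomness the transcripts are functions of the input, and the information cost is the
  expectation over the randomness of the sum over i of H(T_i | X_i), where T_i is the history of
  player i. Two quantities are bounded by this sum. One is the sum of I(M; T_i | X_i, Z). The other
  is the sum of I(X_i; T_i | M, Z): in a synchronous protocol every message is read, so that
  revealing all histories costs, round by round, at most what the players receive.
  Both decompose over the coordinates. In coordinate l, given the rest, consider the law of T_i for
  (M, X_i) = (0,0), (0,1), (1,1): the two information terms bound the Hellinger distances between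
  neighbours, and by the rectangle property the distance between (0,0) and (1,1) equals the
  distance between (0,1) and the fictitious case (1,0), in which the players i and Z alone hold a
  zero. There the value is 0 and one of these two histories must certify a zero in coordinate l,
  which is impossible when that player holds a one. Summing over all pairs of players gives order k
  for every coordinate.
*)

theory Submission
  imports Defs
begin

subsection \<open>Discrete entropy\<close>

text \<open>The cost charges player i for what it learns about the others, but the Hellinger
  argument also needs what its history reveals about its own input. That quantity is not part of the
  cost, and bounding its sum over the players is where synchrony enters: once the traffic of the
  first t rounds is known, the own input of a player has no influence on what it reads in round t +
  1, so the entropy of these reads may be conditioned on that input for free. The odds 2 : 1 for M
  make M a fair bit given X_i = 1 and Z other than i, because 2/3 * 1/2 = 1/3; and X_i is a fair bit
  given M = 0 and Z other than i. Both information terms therefore compare two equally likely cases.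
  The fictitious case has probability 0 under mu, so no information bound mentions it. It is
  supplied by a second weight on the same sample space, which is why marginals and the exchange
  argument are developed for nonnegative weights of arbitrary total.\<close>

locale finite_weight =
  fixes S :: "'a set" and p :: "'a \<Rightarrow> real"
  assumes finite_S [simp, intro]: "finite S"
    and weight_nonneg: "w \<in> S \<Longrightarrow> 0 \<le> p w"
begin

definition marg :: "('a \<Rightarrow> 'b) \<Rightarrow> 'b \<Rightarrow> real" where
  "marg A a = (\<Sum>w | w \<in> S \<and> A w = a. p w)"

text \<open>Measured in nats; the passage to bits is a division by \<open>ln 2\<close> in the
  information cost.\<close>

definition ent :: "('a \<Rightarrow> 'b) \<Rightarrow> real" where
  "ent A = - (\<Sum>w\<in>S. p w * ln (marg A (A w)))"

definition cmi :: "('a \<Rightarrow> 'b) \<Rightarrow> ('a \<Rightarrow> 'c) \<Rightarrow> ('a \<Rightarrow> 'd) \<Rightarrow> real" where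
  "cmi A B C = ent (\<lambda>w. (A w, C w)) + ent (\<lambda>w. (B w, C w)) - ent (\<lambda>w. (A w, B w, C w)) - ent C"

lemma marg_nonneg: "0 \<le> marg A a"
  unfolding marg_def by (rule sum_nonneg) (auto intro: weight_nonneg)

lemma weight_le_marg: "w \<in> S \<Longrightarrow> p w \<le> marg A (A w)"
  unfolding marg_def by (rule member_le_sum) (auto intro: weight_nonneg)

lemma marg_pos: "w \<in> S \<Longrightarrow> p w \<noteq> 0 \<Longrightarrow> 0 < marg A (A w)"
  using weight_le_marg[of w A] weight_nonneg[of w] by linarith

lemma marg_le_marg:
  assumes "\<And>v. v \<in> S \<Longrightarrow> A v = a \<Longrightarrow> B v = b"
  shows "marg A a \<le> marg B b"
  unfolding marg_def by (rule sum_mono2) (use assms in \<open>auto intro: weight_nonneg\<close>)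

lemma marg_cong:
  assumes "\<And>v. v \<in> S \<Longrightarrow> A v = a \<longleftrightarrow> B v = b"
  shows "marg A a = marg B b"
  unfolding marg_def by (rule sum.cong) (use assms in auto)

text \<open>Fibres of \<open>B\<close> are unions of fibres of \<open>A\<close>, so every marginal
  grows. Used in both directions, this makes entropy a function of the induced partition, which is
  how tuples are regrouped throughout.\<close>

lemma ent_mono:
  assumes "\<And>v w. v \<in> S \<Longrightarrow> w \<in> S \<Longrightarrow> A v = A w \<Longrightarrow> B v = B w"
  shows "ent B \<le> ent A"
proof -
  have "p w * ln (marg A (A w)) \<le> p w * ln (marg B (B w))" if "w \<in> S" for w
  proof (cases "p w = 0")
    case False
    have "marg A (A w) \<le> marg B (B w)"
      by (rule marg_le_marg) (use assms that in blast)
    then show ?thesis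
      using marg_pos[OF that False, of A] weight_nonneg[OF that]
      by (intro mult_left_mono) auto
  qed simp
  then show ?thesis
    unfolding ent_def by (simp add: sum_mono)
qed

lemma ent_cong:
  assumes "\<And>v w. v \<in> S \<Longrightarrow> w \<in> S \<Longrightarrow> A v = A w \<longleftrightarrow> B v = B w"
  shows "ent A = ent B"
  by (intro antisym ent_mono) (use assms in auto)

lemma sum_weight_eq_sum_marg:
  assumes "finite I" "V ` S \<subseteq> I"
  shows "(\<Sum>w\<in>S. p w * g (V w)) = (\<Sum>v\<in>I. marg V v * g v)"
proof -
  have "(\<Sum>w\<in>S. p w * g (V w)) = (\<Sum>v\<in>I. \<Sum>w | w \<in> S \<and> V w = v. p w * g (V w))"
    by (rule sum.group[symmetric]) (use assms in auto)
  also have "\<dots> = (\<Sum>v\<in>I. marg V v * g v)"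
    unfolding marg_def by (intro sum.cong refl) (simp add: sum_distrib_right)
  finally show ?thesis .
qed

lemma sum_marg_pair:
  assumes "finite I" "A ` S \<subseteq> I"
  shows "(\<Sum>a\<in>I. marg (\<lambda>w. (A w, B w)) (a, b)) = marg B b"
proof -
  have "(\<Sum>a\<in>I. marg (\<lambda>w. (A w, B w)) (a, b))
      = (\<Sum>a\<in>I. \<Sum>w | w \<in> {w \<in> S. B w = b} \<and> A w = a. p w)"
    unfolding marg_def by (intro sum.cong refl) auto
  also have "\<dots> = (\<Sum>w\<in>{w \<in> S. B w = b}. p w)"
    by (rule sum.group) (use assms in auto)
  finally show ?thesis by (simp add: marg_def)
qed

section \<open>Information dominates squared Hellinger distance\<close>

lemma cmi_eq_sum_ln:
  "cmi A B C = (\<Sum>w\<in>S. p w * (ln (marg (\<lambda>w. (A w, B w, C w)) (A w, B w, C w)) + ln (marg C (C w))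
      - ln (marg (\<lambda>w. (A w, C w)) (A w, C w)) - ln (marg (\<lambda>w. (B w, C w)) (B w, C w))))"
  unfolding cmi_def ent_def by (simp add: algebra_simps sum.distrib sum_subtractf)

text \<open>\<open>cmi\<close> is the relative entropy of P against the conditionally independent Q.
  Apply ln t <= t - 1 to t = sqrt (Q / P); as P and Q have the same total weight, the resulting
  linear bound is the squared distance.\<close>

lemma cmi_ge_hellinger:
  assumes fin: "finite IA" "finite IB" "finite IC"
    and sub: "A ` S \<subseteq> IA" "B ` S \<subseteq> IB" "C ` S \<subseteq> IC"
  defines "P \<equiv> marg (\<lambda>w. (A w, B w, C w))"
    and "Q \<equiv> (\<lambda>(a, b, c). marg (\<lambda>w. (A w, C w)) (a, c) * marg (\<lambda>w. (B w, C w)) (b, c) / marg C c)"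
  shows "(\<Sum>v\<in>IA \<times> IB \<times> IC. (sqrt (P v) - sqrt (Q v))\<^sup>2) \<le> cmi A B C"
proof -
  let ?I = "IA \<times> IB \<times> IC"
  let ?V = "\<lambda>w. (A w, B w, C w)"
  have finI: "finite ?I" and subI: "?V ` S \<subseteq> ?I"
    using fin sub by auto
  have P0: "0 \<le> P v" for v unfolding P_def by (rule marg_nonneg)
  have Q0: "0 \<le> Q v" for v unfolding Q_def by (auto split: prod.split intro!: divide_nonneg_nonneg mult_nonneg_nonneg marg_nonneg)
  have sumP: "(\<Sum>v\<in>?I. P v) = (\<Sum>w\<in>S. p w)"
    using sum_weight_eq_sum_marg[OF finI subI, of "\<lambda>_. 1"] by (simp add: P_def)
  have "(\<Sum>v\<in>?I. Q v) = (\<Sum>a\<in>IA. \<Sum>b\<in>IB. \<Sum>c\<in>IC. Q (a, b, c))"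
    by (simp add: sum.cartesian_product)
  also have "\<dots> = (\<Sum>a\<in>IA. \<Sum>c\<in>IC. \<Sum>b\<in>IB. Q (a, b, c))"
    by (intro sum.cong refl sum.swap)
  also have "\<dots> = (\<Sum>c\<in>IC. \<Sum>a\<in>IA. \<Sum>b\<in>IB. Q (a, b, c))"
    by (rule sum.swap)
  also have "\<dots> = (\<Sum>c\<in>IC. (\<Sum>a\<in>IA. marg (\<lambda>w. (A w, C w)) (a, c))
      * (\<Sum>b\<in>IB. marg (\<lambda>w. (B w, C w)) (b, c)) / marg C c)"
    unfolding Q_def sum_product by (simp add: sum_divide_distrib)
  also have "\<dots> = (\<Sum>c\<in>IC. marg C c)"
    using fin sub by (intro sum.cong refl) (simp add: sum_marg_pair)
  also have "\<dots> = (\<Sum>w\<in>S. p w)"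
    using sum_weight_eq_sum_marg[OF fin(3) sub(3), of "\<lambda>_. 1"] by simp
  finally have sumQ: "(\<Sum>v\<in>?I. Q v) = (\<Sum>w\<in>S. p w)" .
  have pointwise: "2 * (p w * (1 - sqrt (Q (?V w)) / sqrt (P (?V w)))) \<le>
      p w * (ln (P (?V w)) + ln (marg C (C w))
      - ln (marg (\<lambda>w. (A w, C w)) (A w, C w)) - ln (marg (\<lambda>w. (B w, C w)) (B w, C w)))"
    if w: "w \<in> S" for w
  proof (cases "p w = 0")
    case False
    note pos = marg_pos[OF w False, of C] marg_pos[OF w False, of "\<lambda>w. (A w, C w)"]
      marg_pos[OF w False, of "\<lambda>w. (B w, C w)"]
    have Ppos: "0 < P (?V w)" using marg_pos[OF w False, of ?V] by (simp add: P_def)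
    have Qpos: "0 < Q (?V w)" using pos by (simp add: Q_def)
    define \<rho> where "\<rho> = sqrt (Q (?V w)) / sqrt (P (?V w))"
    have "ln \<rho> \<le> \<rho> - 1"
      using Ppos Qpos unfolding \<rho>_def by (intro ln_le_minus_one) simp
    moreover have "ln \<rho> = (ln (Q (?V w)) - ln (P (?V w))) / 2"
      using Ppos Qpos by (simp add: \<rho>_def ln_div ln_sqrt)
    moreover have "ln (Q (?V w)) = ln (marg (\<lambda>w. (A w, C w)) (A w, C w))
        + ln (marg (\<lambda>w. (B w, C w)) (B w, C w)) - ln (marg C (C w))"
      using pos by (simp add: Q_def ln_div ln_mult)
    ultimately have "2 * (1 - \<rho>) \<le> ln (P (?V w)) + ln (marg C (C w))
      - ln (marg (\<lambda>w. (A w, C w)) (A w, C w)) - ln (marg (\<lambda>w. (B w, C w)) (B w, C w))"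
      by argo
    from mult_left_mono[OF this weight_nonneg[OF w]] show ?thesis
      by (simp add: \<rho>_def[symmetric] algebra_simps)
  qed simp
  \<comment> \<open>For P v = 0 the quotient is 0 by convention, in agreement with the right-hand
    side.\<close>
  have PQ: "P v * (sqrt (Q v) / sqrt (P v)) = sqrt (P v) * sqrt (Q v)" for v
    using P0[of v] by (metis mult.commute real_div_sqrt times_divide_eq_left times_divide_eq_right)
  have "(\<Sum>v\<in>?I. (sqrt (P v) - sqrt (Q v))\<^sup>2)
      = (\<Sum>v\<in>?I. P v + Q v - 2 * (P v * (sqrt (Q v) / sqrt (P v))))"
    by (intro sum.cong refl, subst PQ) (simp add: power2_diff P0 Q0)
  also have "\<dots> = 2 * (\<Sum>w\<in>S. p w) - 2 * (\<Sum>v\<in>?I. P v * (sqrt (Q v) / sqrt (P v)))"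
    by (simp add: sum.distrib sum_subtractf sum_distrib_left sumP sumQ)
  also have "(\<Sum>v\<in>?I. P v * (sqrt (Q v) / sqrt (P v)))
      = (\<Sum>w\<in>S. p w * (sqrt (Q (?V w)) / sqrt (P (?V w))))"
    unfolding P_def by (rule sum_weight_eq_sum_marg[OF finI subI, symmetric])
  also have "2 * (\<Sum>w\<in>S. p w) - 2 * (\<Sum>w\<in>S. p w * (sqrt (Q (?V w)) / sqrt (P (?V w))))
      = (\<Sum>w\<in>S. 2 * (p w * (1 - sqrt (Q (?V w)) / sqrt (P (?V w)))))"
    unfolding sum_distrib_left sum_subtractf[symmetric] by (intro sum.cong refl) (simp add: algebra_simps)
  also have "\<dots> \<le> cmi A B C"
    unfolding cmi_eq_sum_ln P_def[symmetric] by (intro sum_mono pointwise)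
  finally show ?thesis .
qed

lemma cmi_nonneg: "0 \<le> cmi A B C"
  by (rule order_trans[OF sum_nonneg cmi_ge_hellinger[of "A ` S" "B ` S" "C ` S"]]) auto

text \<open>Since \<open>a0\<close> and \<open>a1\<close> have equal weight given c, Q takes one
  common value at both. The roots of P at \<open>a0\<close> and \<open>a1\<close> cannot both be
  close to the root of that value unless they are close to each other.\<close>

lemma cmi_ge_binary:
  assumes fin: "finite IB" "finite G" and B: "B ` S \<subseteq> IB" and "a0 \<noteq> a1"
    and half: "\<And>c. c \<in> G \<Longrightarrow> marg (\<lambda>w. (A w, C w)) (a0, c) = marg (\<lambda>w. (A w, C w)) (a1, c)"
  defines "P \<equiv> marg (\<lambda>w. (A w, B w, C w))"
  shows "(\<Sum>(b, c)\<in>IB \<times> G. (sqrt (P (a0, b, c)) - sqrt (P (a1, b, c)))\<^sup>2) / 2 \<le> cmi A B C"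
proof -
  define Q where "Q = (\<lambda>(a, b, c). marg (\<lambda>w. (A w, C w)) (a, c) * marg (\<lambda>w. (B w, C w)) (b, c) / marg C c)"
  let ?IA = "insert a0 (insert a1 (A ` S))" and ?IC = "G \<union> C ` S"
  let ?f = "\<lambda>v. (sqrt (P v) - sqrt (Q v))\<^sup>2"
  have *: "(u - v)\<^sup>2 / 2 \<le> (u - q)\<^sup>2 + (v - q)\<^sup>2" for u v q :: real
  proof -
    have "(u - q)\<^sup>2 + (v - q)\<^sup>2 - (u - v)\<^sup>2 / 2 = (u + v - 2 * q)\<^sup>2 / 2"
      by (simp add: power2_eq_square field_simps)
    then show ?thesis
      using zero_le_power2[of "u + v - 2 * q"] by linarith
  qed
  have "(\<Sum>(b, c)\<in>IB \<times> G. (sqrt (P (a0, b, c)) - sqrt (P (a1, b, c)))\<^sup>2) / 2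
      \<le> (\<Sum>(b, c)\<in>IB \<times> G. ?f (a0, b, c) + ?f (a1, b, c))"
    unfolding sum_divide_distrib
  proof (intro sum_mono, clarify)
    fix b c assume "c \<in> G"
    then have "Q (a1, b, c) = Q (a0, b, c)" by (simp add: Q_def half)
    then show "(sqrt (P (a0, b, c)) - sqrt (P (a1, b, c)))\<^sup>2 / 2 \<le> ?f (a0, b, c) + ?f (a1, b, c)"
      using * by simp
  qed
  also have "\<dots> = (\<Sum>v\<in>IB \<times> G. ?f (a0, v)) + (\<Sum>v\<in>IB \<times> G. ?f (a1, v))"
    by (simp add: sum.distrib case_prod_beta)
  also have "\<dots> = (\<Sum>a\<in>{a0, a1}. \<Sum>v\<in>IB \<times> G. ?f (a, v))"
    using \<open>a0 \<noteq> a1\<close> by simp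
  also have "\<dots> = (\<Sum>v\<in>{a0, a1} \<times> (IB \<times> G). ?f v)"
    by (simp add: sum.cartesian_product)
  also have "\<dots> \<le> (\<Sum>v\<in>?IA \<times> IB \<times> ?IC. ?f v)"
    by (rule sum_mono2) (use fin in auto)
  also have "\<dots> \<le> cmi A B C"
    unfolding P_def Q_def by (rule cmi_ge_hellinger) (use fin B in auto)
  finally show ?thesis .
qed

text \<open>Conditional independence is always obtained by letting \<open>mix\<close> exchange the \<open>B\<close>-parts of two sample
  points that agree on \<open>C\<close>.\<close>

lemma marg_swap:
  assumes mem: "\<And>u v. u \<in> S \<Longrightarrow> v \<in> S \<Longrightarrow> C u = C v \<Longrightarrow> mix u v \<in> S"
    and A: "\<And>u v. u \<in> S \<Longrightarrow> v \<in> S \<Longrightarrow> C u = C v \<Longrightarrow> A (mix u v) = A u"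
    and B: "\<And>u v. u \<in> S \<Longrightarrow> v \<in> S \<Longrightarrow> C u = C v \<Longrightarrow> B (mix u v) = B v"
    and C: "\<And>u v. u \<in> S \<Longrightarrow> v \<in> S \<Longrightarrow> C u = C v \<Longrightarrow> C (mix u v) = C u"
    and inv: "\<And>u v. u \<in> S \<Longrightarrow> v \<in> S \<Longrightarrow> C u = C v \<Longrightarrow> mix (mix u v) (mix v u) = u"
    and weight: "\<And>u v. u \<in> S \<Longrightarrow> v \<in> S \<Longrightarrow> C u = C v \<Longrightarrow> p (mix u v) * p (mix v u) = p u * p v"
  shows "marg (\<lambda>w. (A w, B w, C w)) (a, b, c) * marg (\<lambda>w. (A w, B w, C w)) (a', b', c)
       = marg (\<lambda>w. (A w, B w, C w)) (a, b', c) * marg (\<lambda>w. (A w, B w, C w)) (a', b, c)"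
proof -
  let ?V = "\<lambda>w. (A w, B w, C w)"
  let ?X = "{w \<in> S. ?V w = (a, b, c)} \<times> {w \<in> S. ?V w = (a', b', c)}"
  let ?Y = "{w \<in> S. ?V w = (a, b', c)} \<times> {w \<in> S. ?V w = (a', b, c)}"
  let ?\<phi> = "\<lambda>(u, v). (mix u v, mix v u)"
  have "(\<Sum>(u, v)\<in>?X. p u * p v) = (\<Sum>(u, v)\<in>?Y. p u * p v)"
    by (rule sum.reindex_bij_witness[of _ ?\<phi> ?\<phi>])
       (auto simp: mem A B C inv weight)
  then show ?thesis
    unfolding marg_def sum_product by (simp add: sum.cartesian_product)
qed

text \<open>Summing the exchange identity over all a' and b' gives P(a,b,c) P(c) = P(a,c) P(b,c), so
  every logarithm in the information vanishes.\<close>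

lemma cmi_swap_eq_0:
  assumes mem: "\<And>u v. u \<in> S \<Longrightarrow> v \<in> S \<Longrightarrow> C u = C v \<Longrightarrow> mix u v \<in> S"
    and A: "\<And>u v. u \<in> S \<Longrightarrow> v \<in> S \<Longrightarrow> C u = C v \<Longrightarrow> A (mix u v) = A u"
    and B: "\<And>u v. u \<in> S \<Longrightarrow> v \<in> S \<Longrightarrow> C u = C v \<Longrightarrow> B (mix u v) = B v"
    and C: "\<And>u v. u \<in> S \<Longrightarrow> v \<in> S \<Longrightarrow> C u = C v \<Longrightarrow> C (mix u v) = C u"
    and inv: "\<And>u v. u \<in> S \<Longrightarrow> v \<in> S \<Longrightarrow> C u = C v \<Longrightarrow> mix (mix u v) (mix v u) = u"
    and weight: "\<And>u v. u \<in> S \<Longrightarrow> v \<in> S \<Longrightarrow> C u = C v \<Longrightarrow> p (mix u v) * p (mix v u) = p u * p v"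
  shows "cmi A B C = 0"
proof -
  let ?V = "\<lambda>w. (A w, B w, C w)"
  have product: "marg ?V (a, b, c) * marg C c = marg (\<lambda>w. (A w, C w)) (a, c) * marg (\<lambda>w. (B w, C w)) (b, c)"
    for a b c
  proof -
    have AC: "marg (\<lambda>w. (A w, C w)) (a, c) = (\<Sum>b'\<in>B ` S. marg ?V (a, b', c))" for a
    proof -
      have "(\<Sum>b'\<in>B ` S. marg ?V (a, b', c)) = (\<Sum>b'\<in>B ` S. marg (\<lambda>w. (B w, (A w, C w))) (b', (a, c)))"
        by (intro sum.cong refl marg_cong) auto
      then show ?thesis by (simp add: sum_marg_pair)
    qed
    have BC: "marg (\<lambda>w. (B w, C w)) (b, c) = (\<Sum>a'\<in>A ` S. marg ?V (a', b, c))"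
      by (simp add: sum_marg_pair)
    have "marg C c = (\<Sum>a'\<in>A ` S. marg (\<lambda>w. (A w, C w)) (a', c))"
      by (simp add: sum_marg_pair)
    also have "\<dots> = (\<Sum>a'\<in>A ` S. \<Sum>b'\<in>B ` S. marg ?V (a', b', c))"
      by (simp add: AC)
    finally have Cc: "marg C c = (\<Sum>b'\<in>B ` S. \<Sum>a'\<in>A ` S. marg ?V (a', b', c))"
      by (subst sum.swap)
    have "marg ?V (a, b, c) * marg C c
        = (\<Sum>b'\<in>B ` S. \<Sum>a'\<in>A ` S. marg ?V (a, b', c) * marg ?V (a', b, c))"
      unfolding Cc sum_distrib_left
      by (intro sum.cong refl marg_swap[where mix = mix] assms)
    also have "\<dots> = marg (\<lambda>w. (A w, C w)) (a, c) * marg (\<lambda>w. (B w, C w)) (b, c)"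
      unfolding AC BC sum_product ..
    finally show ?thesis .
  qed
  have "ln (marg ?V (?V w)) + ln (marg C (C w)) - ln (marg (\<lambda>w. (A w, C w)) (A w, C w))
      - ln (marg (\<lambda>w. (B w, C w)) (B w, C w)) = 0" if w: "w \<in> S" "p w \<noteq> 0" for w
    using arg_cong[OF product[of "A w" "B w" "C w"], of ln] marg_pos[OF w, of ?V] marg_pos[OF w, of C]
      marg_pos[OF w, of "\<lambda>w. (A w, C w)"] marg_pos[OF w, of "\<lambda>w. (B w, C w)"]
    by (simp add: ln_mult)
  then show ?thesis
    unfolding cmi_eq_sum_ln by (intro sum.neutral) auto
qed

end

subsection \<open>The input distribution\<close>

type_synonym cell = "(nat \<Rightarrow> bool) \<times> bool \<times> nat"

text \<open>Naming the elementary variables gives all collections of them one type: entropies become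
  functions of a set of atoms, and regrouping variables becomes set algebra.\<close>

datatype atom = X_at nat nat | M_at nat | Z_at nat

fun atom_value :: "(nat \<Rightarrow> cell) \<Rightarrow> atom \<Rightarrow> bool + nat" where
  "atom_value w (X_at l i) = Inl (fst (w l) i)"
| "atom_value w (M_at l) = Inl (fst (snd (w l)))"
| "atom_value w (Z_at l) = Inr (snd (snd (w l)))"

definition observe :: "atom set \<Rightarrow> (nat \<Rightarrow> cell) \<Rightarrow> atom \<Rightarrow> bool + nat" where
  "observe D w = restrict (atom_value w) D"

definition samples :: "nat \<Rightarrow> nat \<Rightarrow> (nat \<Rightarrow> cell) set" where
  "samples k n = {..<n} \<rightarrow>\<^sub>E ({..<k} \<rightarrow>\<^sub>E UNIV) \<times> UNIV \<times> {..<k}"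

definition cell_prob :: "nat \<Rightarrow> bool \<Rightarrow> real" where
  "cell_prob k m = (if m then 1/3 else 2/3) / real k"

text \<open>Conditional law of X_i given (M, Z) = s. Given s the bits of the players are
  independent, so the weight of a sample is a product over coordinates and players.\<close>

definition bit_prob :: "nat \<Rightarrow> bool \<times> nat \<Rightarrow> bool \<Rightarrow> real" where
  "bit_prob i s b = (if i = snd s then of_bool (\<not> b) else if fst s then of_bool b else 1/2)"

text \<open>The bit factor \<open>q\<close> is a parameter so that mu and the relaxed weight share
  the exchange lemma.\<close>

definition sample_weight ::
    "nat \<Rightarrow> nat \<Rightarrow> (nat \<Rightarrow> nat \<Rightarrow> bool \<times> nat \<Rightarrow> bool \<Rightarrow> real) \<Rightarrow> (nat \<Rightarrow> cell) \<Rightarrow> real" where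
  "sample_weight k n q w =
     (\<Prod>l<n. cell_prob k (fst (snd (w l))) * (\<Prod>i<k. q l i (snd (w l)) (fst (w l) i)))"

definition exchange :: "nat \<Rightarrow> nat \<Rightarrow> atom set \<Rightarrow> (nat \<Rightarrow> cell) \<Rightarrow> (nat \<Rightarrow> cell) \<Rightarrow> nat \<Rightarrow> cell" where
  "exchange k n D u v = (\<lambda>l\<in>{..<n}.
     (\<lambda>i\<in>{..<k}. fst ((if X_at l i \<in> D then v else u) l) i,
      fst (snd ((if M_at l \<in> D then v else u) l)), snd (snd ((if Z_at l \<in> D then v else u) l))))"

lemma observe_eq_iff: "observe D u = observe D v \<longleftrightarrow> (\<forall>a\<in>D. atom_value u a = atom_value v a)"
  by (auto simp: observe_def restrict_def fun_eq_iff)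

lemma finite_samples [simp, intro]: "finite (samples k n)"
  unfolding samples_def by (intro finite_PiE finite_cartesian_product) auto

lemma sample_at:
  assumes "w \<in> samples k n" "l < n"
  shows "fst (w l) \<in> {..<k} \<rightarrow>\<^sub>E UNIV" "snd (snd (w l)) < k"
  using assms by (auto simp: samples_def PiE_def Pi_def mem_Times_iff)

lemma sample_outside: "w \<in> samples k n \<Longrightarrow> \<not> l < n \<Longrightarrow> w l = undefined"
  by (auto simp: samples_def PiE_def extensional_def)

lemma sample_eqI:
  assumes "u \<in> samples k n" "v \<in> samples k n"
    and "\<And>a. atom_value u a = atom_value v a"
  shows "u = v"
proof (intro ext prod_eqI)
  fix l i
  show "fst (u l) i = fst (v l) i" using assms(3)[of "X_at l i"] by simp
  show "fst (snd (u l)) = fst (snd (v l))" using assms(3)[of "M_at l"] by simp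
  show "snd (snd (u l)) = snd (snd (v l))" using assms(3)[of "Z_at l"] by simp
qed

lemma exchange_in_samples:
  assumes "u \<in> samples k n" "v \<in> samples k n"
  shows "exchange k n D u v \<in> samples k n"
proof -
  have "exchange k n D u v l \<in> ({..<k} \<rightarrow>\<^sub>E UNIV) \<times> UNIV \<times> {..<k}" if "l < n" for l
    using sample_at(2)[OF assms(1) that] sample_at(2)[OF assms(2) that] that
    by (auto simp: exchange_def)
  then show ?thesis
    unfolding samples_def by (intro PiE_I) (auto simp: exchange_def)
qed

lemma atom_value_exchange:
  assumes "u \<in> samples k n" "v \<in> samples k n"
  shows "atom_value (exchange k n D u v) a = atom_value (if a \<in> D then v else u) a"
proof (cases a)
  case (X_at l i)
  have "fst (w l) i = undefined" if "w \<in> samples k n" "l < n" "\<not> i < k" for w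
    using sample_at(1)[OF that(1,2)] that(3) by (auto simp: PiE_def extensional_def)
  then show ?thesis
    using X_at assms sample_outside[OF assms(1), of l] sample_outside[OF assms(2), of l]
    by (cases "l < n"; cases "i < k") (auto simp: exchange_def)
next
  case (M_at l)
  then show ?thesis
    using sample_outside[OF assms(1), of l] sample_outside[OF assms(2), of l]
    by (cases "l < n") (auto simp: exchange_def)
next
  case (Z_at l)
  then show ?thesis
    using sample_outside[OF assms(1), of l] sample_outside[OF assms(2), of l]
    by (cases "l < n") (auto simp: exchange_def)
qed

lemma exchange_exchange:
  assumes "u \<in> samples k n" "v \<in> samples k n"
  shows "exchange k n D (exchange k n D u v) (exchange k n D v u) = u"
  by (rule sample_eqI[of _ k n]) (simp_all add: exchange_in_samples atom_value_exchange assms)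

text \<open>In every cell the pair (M, Z) is the same in u and v or moves as a block. A bit either
  moves with its pair or has a factor that does not depend on it, so the factors of u and v are
  merely permuted. The second alternative is what the relaxed weight relies on.\<close>

lemma sample_weight_exchange:
  assumes "\<And>l. l < n \<Longrightarrow> snd (u l) = snd (v l) \<or> (M_at l \<in> D \<longleftrightarrow> Z_at l \<in> D) \<and>
    (\<forall>i<k. (X_at l i \<in> D \<longleftrightarrow> M_at l \<in> D) \<or> (\<forall>s. q l i s True = q l i s False))"
  shows "sample_weight k n q (exchange k n D u v) * sample_weight k n q (exchange k n D v u)
    = sample_weight k n q u * sample_weight k n q v"
  unfolding sample_weight_def prod.distrib[symmetric]
proof (rule prod.cong[OF refl])
  fix l assume "l \<in> {..<n}"
  then have l: "l < n" by simp
  let ?u = "exchange k n D u v" and ?v = "exchange k n D v u"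
  have swap: "snd (?u l) = snd (u l) \<and> snd (?v l) = snd (v l) \<or> snd (?u l) = snd (v l) \<and> snd (?v l) = snd (u l)"
    using assms[OF l] l by (auto simp: exchange_def prod_eq_iff)
  have "q l i (snd (?u l)) (fst (?u l) i) * q l i (snd (?v l)) (fst (?v l) i)
      = q l i (snd (u l)) (fst (u l) i) * q l i (snd (v l)) (fst (v l) i)" if i: "i < k" for i
  proof (cases "\<forall>s. q l i s True = q l i s False")
    case True
    then have "q l i s b = q l i s True" for s b
      by (metis (full_types))
    then show ?thesis using swap by (metis mult.commute)
  next
    case False
    then consider "snd (u l) = snd (v l)"
      | "M_at l \<in> D \<longleftrightarrow> Z_at l \<in> D" "X_at l i \<in> D \<longleftrightarrow> M_at l \<in> D"
      using assms[OF l] i by blast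
    then show ?thesis
      using swap l i by cases (auto simp: exchange_def)
  qed
  then have "(\<Prod>i<k. q l i (snd (?u l)) (fst (?u l) i)) * (\<Prod>i<k. q l i (snd (?v l)) (fst (?v l) i))
      = (\<Prod>i<k. q l i (snd (u l)) (fst (u l) i)) * (\<Prod>i<k. q l i (snd (v l)) (fst (v l) i))"
    unfolding prod.distrib[symmetric] by (intro prod.cong) auto
  moreover have "cell_prob k (fst (snd (?u l))) * cell_prob k (fst (snd (?v l)))
      = cell_prob k (fst (snd (u l))) * cell_prob k (fst (snd (v l)))"
    using swap by auto
  ultimately show "cell_prob k (fst (snd (?u l))) * (\<Prod>i<k. q l i (snd (?u l)) (fst (?u l) i)) *
      (cell_prob k (fst (snd (?v l))) * (\<Prod>i<k. q l i (snd (?v l)) (fst (?v l) i))) =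
      cell_prob k (fst (snd (u l))) * (\<Prod>i<k. q l i (snd (u l)) (fst (u l) i)) *
      (cell_prob k (fst (snd (v l))) * (\<Prod>i<k. q l i (snd (v l)) (fst (v l) i)))"
    by algebra
qed

lemma cell_prob_nonneg: "0 \<le> cell_prob k m"
  by (simp add: cell_prob_def)

lemma bit_prob_nonneg: "0 \<le> bit_prob i s b"
  by (simp add: bit_prob_def)

lemma sample_weight_nonneg:
  assumes "\<And>l i s b. 0 \<le> q l i s b"
  shows "0 \<le> sample_weight k n q w"
  unfolding sample_weight_def
  by (intro prod_nonneg mult_nonneg_nonneg ballI cell_prob_nonneg) (use assms in auto)

abbreviation mu_weight :: "nat \<Rightarrow> nat \<Rightarrow> (nat \<Rightarrow> cell) \<Rightarrow> real" where
  "mu_weight k n \<equiv> sample_weight k n (\<lambda>_. bit_prob)"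

section \<open>Product form of the input distribution\<close>

lemma pmf_mu:
  assumes "0 < k" "x \<in> {..<k} \<rightarrow>\<^sub>E UNIV" "z < k"
  shows "pmf (mu k) (x, m, z) = cell_prob k m * (\<Prod>i<k. bit_prob i (m, z) (x i))"
proof -
  let ?K = "{..<k} - {z}"
  let ?Y = "if m then return_pmf (\<lambda>i\<in>?K. True) else pmf_of_set (?K \<rightarrow>\<^sub>E UNIV)"
  have ind: "pmf (do {Y \<leftarrow> Q M Z; return_pmf (Y(Z := False), M, Z)}) (x, m, z)
      = (if M = m \<and> Z = z then pmf (do {Y \<leftarrow> Q m z; return_pmf (Y(z := False))}) x else 0)"
    for M Z and Q :: "bool \<Rightarrow> nat \<Rightarrow> (nat \<Rightarrow> bool) pmf"
  proof -
    have "pmf (do {Y \<leftarrow> Q M Z; return_pmf (Y(Z := False), M, Z)}) (x, m, z)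
      = measure_pmf.expectation (Q M Z) (\<lambda>Y. if M = m \<and> Z = z then indicator {x} (Y(z := False)) else 0)"
      unfolding pmf_bind by (intro Bochner_Integration.integral_cong) (auto simp: indicator_def)
    also have "\<dots> = (if M = m \<and> Z = z then pmf (do {Y \<leftarrow> Q m z; return_pmf (Y(z := False))}) x else 0)"
      unfolding pmf_bind by (auto intro!: Bochner_Integration.integral_cong simp: indicator_def)
    finally show ?thesis .
  qed
  let ?Q = "\<lambda>m z. if m then return_pmf (\<lambda>i\<in>{..<k} - {z}. True) else pmf_of_set ({..<k} - {z} \<rightarrow>\<^sub>E UNIV)"
  let ?c = "pmf (do {Y \<leftarrow> ?Q m z; return_pmf (Y(z := False))}) x"
  have average: "pmf (do {M \<leftarrow> bernoulli_pmf (1/3); Z \<leftarrow> pmf_of_set {..<k}; g M Z}) v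
      = (\<Sum>M\<in>UNIV. (\<Sum>Z<k. pmf (g M Z) v / real k) * (if M then 1/3 else 2/3))"
    for g :: "bool \<Rightarrow> nat \<Rightarrow> 'b pmf" and v
    using \<open>0 < k\<close>
    by (subst pmf_bind, subst integral_measure_pmf[of UNIV])
       (auto simp: UNIV_bool pmf_bind_pmf_of_set sum_divide_distrib lessThan_empty_iff)
  have "pmf (mu k) (x, m, z) = pmf (do {M \<leftarrow> bernoulli_pmf (1/3); Z \<leftarrow> pmf_of_set {..<k};
      Y \<leftarrow> ?Q M Z; return_pmf (Y(Z := False), M, Z)}) (x, m, z)"
    by (simp add: mu_def)
  also have "\<dots> = (\<Sum>M\<in>UNIV. (\<Sum>Z<k. (if M = m \<and> Z = z then ?c else 0) / real k) * (if M then 1/3 else 2/3))"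
    unfolding average ind[of ?Q] ..
  also have "\<dots> = cell_prob k m * ?c"
  proof -
    have "(\<Sum>Z<k. (if M = m \<and> Z = z then ?c else 0) / real k) = (if M = m then ?c / real k else 0)" for M
    proof (cases "M = m")
      case True
      then have "(\<Sum>Z<k. (if M = m \<and> Z = z then ?c else 0) / real k) = (\<Sum>Z<k. if Z = z then ?c / real k else 0)"
        by (intro sum.cong) auto
      with True \<open>z < k\<close> show ?thesis by simp
    qed simp
    then show ?thesis by (cases m) (simp_all add: UNIV_bool cell_prob_def)
  qed
  also have "?c = (\<Prod>i<k. bit_prob i (m, z) (x i))"
  proof -
    have split: "(\<Prod>i<k. bit_prob i (m, z) (x i)) = of_bool (\<not> x z) * (\<Prod>i\<in>?K. if m then of_bool (x i) else 1/2)"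
      using \<open>z < k\<close> by (subst prod.remove[of _ z]) (auto simp: bit_prob_def intro!: prod.cong)
    show ?thesis
    proof (cases m)
      case True
      have "((\<lambda>i\<in>?K. True)(z := False) = x) \<longleftrightarrow> \<not> x z \<and> (\<forall>i\<in>?K. x i)"
        using assms by (auto simp: fun_eq_iff restrict_def PiE_def extensional_def)
      moreover have "(\<Prod>i\<in>?K. of_bool (x i)) = (of_bool (\<forall>i\<in>?K. x i) :: real)"
        by (auto simp: prod_zero_iff)
      ultimately show ?thesis
        unfolding split using True by (simp add: bind_return_pmf indicator_def)
    next
      case False
      have fin: "finite (?K \<rightarrow>\<^sub>E (UNIV :: bool set))" "?K \<rightarrow>\<^sub>E (UNIV :: bool set) \<noteq> {}"
        by (auto simp: finite_PiE PiE_eq_empty_iff)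
      \<comment> \<open>There is at most one preimage: Y is extensional, so its value at z can only
        be \<open>undefined\<close>.\<close>
      have *: "(?K \<rightarrow>\<^sub>E (UNIV :: bool set)) \<inter> {Y. Y(z := False) = x} = (if x z then {} else {x(z := undefined)})"
        using assms by (auto simp: fun_eq_iff PiE_def extensional_def)
      have "?c = (\<Sum>Y\<in>?K \<rightarrow>\<^sub>E UNIV. of_bool (Y(z := False) = x)) / real (card (?K \<rightarrow>\<^sub>E (UNIV :: bool set)))"
        using False fin by (simp add: pmf_bind_pmf_of_set indicator_def of_bool_def)
      also have "(\<Sum>Y\<in>?K \<rightarrow>\<^sub>E UNIV. of_bool (Y(z := False) = x)) = (of_bool (\<not> x z) :: real)"
        using fin(1) unfolding of_bool_def by (subst sum.If_cases) (simp_all add: *)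
      also have "card (?K \<rightarrow>\<^sub>E (UNIV :: bool set)) = 2 ^ card ?K"
        by (simp add: card_PiE)
      finally have "?c = of_bool (\<not> x z) / real (2 ^ card ?K)" .
      then show ?thesis
        unfolding split by (rule trans) (use False in \<open>simp add: power_one_over\<close>)
    qed
  qed
  finally show ?thesis by simp
qed

lemma set_pmf_mu: "set_pmf (mu k) \<subseteq> ({..<k} \<rightarrow>\<^sub>E UNIV) \<times> UNIV \<times> {..<k}" if "0 < k"
proof -
  have "finite ({..<k} - {Z} \<rightarrow>\<^sub>E (UNIV :: bool set))" "{..<k} - {Z} \<rightarrow>\<^sub>E (UNIV :: bool set) \<noteq> {}" for Z :: nat
    by (auto simp: finite_PiE PiE_eq_empty_iff)
  then show ?thesis
    using that unfolding mu_def
    by (auto simp: set_bind_pmf lessThan_empty_iff PiE_def extensional_def split: if_splits)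
qed

lemma pmf_mu_pow:
  assumes "0 < k" "w \<in> samples k n"
  shows "pmf (mu_pow k n) w = mu_weight k n w"
proof -
  have "pmf (mu_pow k n) w = (\<Prod>l<n. pmf (mu k) (w l))"
    unfolding mu_pow_def using sample_outside[OF assms(2)] by (subst pmf_Pi') auto
  also have "\<dots> = mu_weight k n w"
    unfolding sample_weight_def
  proof (intro prod.cong refl)
    fix l assume "l \<in> {..<n}"
    then show "pmf (mu k) (w l) = cell_prob k (fst (snd (w l))) * (\<Prod>i<k. bit_prob i (snd (w l)) (fst (w l) i))"
      using pmf_mu[OF assms(1), of "fst (w l)" "snd (snd (w l))" "fst (snd (w l))"]
        sample_at[OF assms(2), of l] by simp
  qed
  finally show ?thesis .
qed

lemma set_pmf_mu_pow: "set_pmf (mu_pow k n) \<subseteq> samples k n" if "0 < k"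
proof
  fix w assume "w \<in> set_pmf (mu_pow k n)"
  then have "w \<in> PiE_dflt {..<n} undefined (\<lambda>_. set_pmf (mu k))"
    unfolding mu_pow_def by (simp add: set_Pi_pmf)
  then show "w \<in> samples k n"
    using set_pmf_mu[OF that] unfolding samples_def PiE_dflt_def
    by (intro PiE_I) (auto split: if_splits)
qed

subsection \<open>Synchronous message exchange\<close>

text \<open>Randomness is fixed and absorbed into \<open>m\<close>, so the traffic is a function of
  the inputs. In round t + 1 a player speaks on the basis of what it read in the first t rounds, and
  its messages are read in that same round.\<close>

primrec recv :: "nat \<Rightarrow> (nat \<Rightarrow> nat \<Rightarrow> bits \<Rightarrow> (nat \<Rightarrow> bits list) \<Rightarrow> nat \<Rightarrow> bits) \<Rightarrow> (nat \<Rightarrow> bits) \<Rightarrow>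
    nat \<Rightarrow> nat \<Rightarrow> nat \<Rightarrow> bits list" where
  "recv k m x 0 = (\<lambda>i j. [])"
| "recv k m x (Suc t) = (\<lambda>i j. if i < k \<and> j < k \<and> i \<noteq> j
     then recv k m x t i j @ [m j (Suc t) (x j) (recv k m x t j) i] else [])"

text \<open>In lockstep, what i has sent is what the others have read from i; the second component
  is the outgoing traffic.\<close>

definition history where
  "history k m x t i = (recv k m x t i, \<lambda>j. recv k m x t j i)"

lemma recv_outside: "\<not> (i < k \<and> j < k \<and> i \<noteq> j) \<Longrightarrow> recv k m x t i j = []"
  by (cases t) auto

lemma recv_Suc_eqD:
  assumes "recv k m x (Suc t) i j = recv k m y (Suc t) i j"
  shows "recv k m x t i j = recv k m y t i j"
  using assms by (cases "i < k \<and> j < k \<and> i \<noteq> j") (auto simp: recv_outside)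

lemma recv_Suc_rowD:
  "recv k m x (Suc t) i = recv k m y (Suc t) i \<Longrightarrow> recv k m x t i = recv k m y t i"
  by (metis recv_Suc_eqD ext)

lemma history_SucD:
  assumes "history k m x (Suc t) i = history k m y (Suc t) i"
  shows "history k m x t i = history k m y t i"
proof -
  have "recv k m x (Suc t) i = recv k m y (Suc t) i" "\<And>j. recv k m x (Suc t) j i = recv k m y (Suc t) j i"
    using assms unfolding history_def by (metis prod.inject)+
  then show ?thesis
    unfolding history_def using recv_Suc_rowD recv_Suc_eqD by (metis ext)
qed

text \<open>Rectangle property. Only the messages of i depend directly on its input, and as long as
  i has read the same, \<open>y i\<close> makes it send what it sends in the run on y, which is what
  it sends on x. So nobody notices the replacement.\<close>

lemma recv_update:
  assumes "history k m x t i = history k m y t i"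
  shows "recv k m (x(i := y i)) t = recv k m x t"
  using assms
proof (induction t)
  case (Suc t)
  have IH: "recv k m (x(i := y i)) t = recv k m x t"
    using Suc.IH history_SucD[OF Suc.prems] by blast
  have own: "recv k m y t i = recv k m x t i"
    using history_SucD[OF Suc.prems] by (simp add: history_def)
  have eq: "recv k m x (Suc t) a i = recv k m y (Suc t) a i" for a
    using Suc.prems unfolding history_def by (metis prod.inject)
  have msg: "m i (Suc t) (y i) (recv k m x t i) a = m i (Suc t) (x i) (recv k m x t i) a"
    if "a < k" "i < k" "a \<noteq> i" for a
    using eq[of a] that by (simp add: own)
  show ?case
  proof (intro ext)
    fix a b
    show "recv k m (x(i := y i)) (Suc t) a b = recv k m x (Suc t) a b"
      using msg[of a] by (cases "b = i") (simp_all add: IH)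
  qed
qed simp

text \<open>What i reads in round t + 1 was written by the others after t rounds, so agreement of
  the histories up to round t is enough for one more round of reading.\<close>

lemma recv_update_Suc_row:
  assumes "history k m x t i = history k m y t i"
  shows "recv k m (x(i := y i)) (Suc t) i = recv k m x (Suc t) i"
  by (intro ext) (simp add: recv_update[OF assms])

lemma input_of_eq_iff:
  assumes "i < k"
  shows "input_of k n u i = input_of k n v i \<longleftrightarrow> (\<forall>l<n. fst (u l) i = fst (v l) i)"
  using assms by (auto simp: input_of_def)

lemma input_of_nth: "i < k \<Longrightarrow> l < n \<Longrightarrow> input_of k n w i ! l = fst (w l) i"
  by (simp add: input_of_def)

lemma input_of_in_inputs: "input_of k n w \<in> inputs k n"
  by (auto simp: input_of_def inputs_def)

lemma input_of_exchange:
  assumes "i < k" and "\<And>l. l < n \<Longrightarrow> X_at l i \<notin> D \<Longrightarrow> fst (u l) i = fst (v l) i"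
    and "\<And>l j. X_at l j \<in> D \<Longrightarrow> j = i"
  shows "input_of k n (exchange k n D u v) = (input_of k n u)(i := input_of k n v i)"
proof
  fix j
  show "input_of k n (exchange k n D u v) j = ((input_of k n u)(i := input_of k n v i)) j"
  proof (cases "j = i")
    case True
    have "fst (exchange k n D u v l) i = fst (v l) i" if "l < n" for l
      using assms(1) assms(2)[OF that] that by (simp add: exchange_def)
    then show ?thesis
      using True assms(1) by (simp add: input_of_eq_iff)
  next
    case False
    then have "fst (exchange k n D u v l) j = fst (u l) j" if "l < n" "j < k" for l
      using assms(3)[of l j] that by (auto simp: exchange_def)
    then show ?thesis
      using False by (cases "j < k") (simp_all add: input_of_eq_iff, simp add: input_of_def)
  qed
qed

subsection \<open>Chain rules\<close>

locale information =
  fixes k n :: nat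
begin

sublocale finite_weight "samples k n" "mu_weight k n"
  by unfold_locales (auto intro: sample_weight_nonneg bit_prob_nonneg)

definition obs_ent :: "atom set \<Rightarrow> real" where
  "obs_ent D = ent (observe D)"

definition joint_ent :: "((nat \<Rightarrow> cell) \<Rightarrow> 'a) \<Rightarrow> atom set \<Rightarrow> real" where
  "joint_ent T D = ent (\<lambda>w. (T w, observe D w))"

definition inputs_of :: "nat \<Rightarrow> atom set" where
  "inputs_of i = {X_at l i |l. l < n}"

definition hidden :: "atom set" where
  "hidden = {M_at l |l. l < n} \<union> {Z_at l |l. l < n}"

lemma cmi_observe:
  "cmi (observe D) T (observe E) = obs_ent (D \<union> E) + joint_ent T E - joint_ent T (D \<union> E) - obs_ent E"
proof -
  have "ent (\<lambda>w. (observe D w, observe E w)) = obs_ent (D \<union> E)"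
    unfolding obs_ent_def by (rule ent_cong) (auto simp: observe_eq_iff)
  moreover have "ent (\<lambda>w. (observe D w, T w, observe E w)) = joint_ent T (D \<union> E)"
    unfolding joint_ent_def by (rule ent_cong) (auto simp: observe_eq_iff)
  ultimately show ?thesis
    by (simp add: cmi_def obs_ent_def joint_ent_def)
qed

lemma joint_ent_observe: "joint_ent (observe F) D = obs_ent (F \<union> D)"
  unfolding joint_ent_def obs_ent_def by (rule ent_cong) (auto simp: observe_eq_iff)

lemma obs_ent_le_joint_ent: "obs_ent D \<le> joint_ent T D"
  unfolding joint_ent_def obs_ent_def by (rule ent_mono) auto

lemma joint_ent_antimono:
  "D \<subseteq> E \<Longrightarrow> joint_ent T E - obs_ent E \<le> joint_ent T D - obs_ent D"
  using cmi_nonneg[of "observe E" T "observe D"] unfolding cmi_observe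
  by (simp add: Un_absorb2 Un_absorb1)

text \<open>If D and F are independent given E, the chain rule turns I(D; T | E, F) into I(D; T, F |
  E), and T alone carries no more than the pair.\<close>

lemma cmi_observe_drop:
  assumes "cmi (observe D) (observe F) (observe E) = 0"
  shows "cmi (observe D) T (observe E) \<le> cmi (observe D) T (observe (E \<union> F))"
proof -
  have "ent (\<lambda>w. (observe D w, T w, observe E w)) = joint_ent T (D \<union> E)"
    "ent (\<lambda>w. (observe F w, T w, observe E w)) = joint_ent T (E \<union> F)"
    "ent (\<lambda>w. (observe D w, observe F w, T w, observe E w)) = joint_ent T (D \<union> (E \<union> F))"
    "ent (\<lambda>w. (T w, observe E w)) = joint_ent T E"
    unfolding joint_ent_def by (rule ent_cong; auto simp: observe_eq_iff)+
  then have "joint_ent T (D \<union> E) + joint_ent T (E \<union> F) - joint_ent T (D \<union> (E \<union> F)) - joint_ent T E \<ge> 0"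
    using cmi_nonneg[of "observe D" "observe F" "\<lambda>w. (T w, observe E w)"] by (simp add: cmi_def)
  moreover have "obs_ent (D \<union> E) + obs_ent (F \<union> E) - obs_ent (F \<union> (D \<union> E)) - obs_ent E = 0"
    using assms by (simp add: cmi_observe joint_ent_observe)
  moreover have "F \<union> (D \<union> E) = D \<union> (E \<union> F)" "F \<union> E = E \<union> F" by auto
  ultimately show ?thesis
    unfolding cmi_observe by simp
qed

text \<open>D is the set of atoms to be exchanged and separates A from B. In each cell, either C
  fixes (M, Z) or the cell lies wholly inside or wholly outside D. Atoms of C may belong to D, since
  they agree anyway.\<close>

lemma cmi_exchange_eq_0:
  assumes "A \<inter> D = {}" "B \<subseteq> D"
    and "\<And>l. l < n \<Longrightarrow> M_at l \<in> C \<and> Z_at l \<in> C \<or>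
      (M_at l \<in> D \<longleftrightarrow> Z_at l \<in> D) \<and> (\<forall>i<k. X_at l i \<in> D \<longleftrightarrow> M_at l \<in> D)"
  shows "cmi (observe A) (observe B) (observe C) = 0"
proof (rule cmi_swap_eq_0[where mix = "exchange k n D"])
  fix u v assume uv: "u \<in> samples k n" "v \<in> samples k n" and eq: "observe C u = observe C v"
  then have C: "atom_value u a = atom_value v a" if "a \<in> C" for a
    using that by (simp add: observe_eq_iff)
  show "exchange k n D u v \<in> samples k n" "exchange k n D (exchange k n D u v) (exchange k n D v u) = u"
    using uv by (simp_all add: exchange_in_samples exchange_exchange)
  show "observe A (exchange k n D u v) = observe A u" "observe B (exchange k n D u v) = observe B v"
    "observe C (exchange k n D u v) = observe C u"
    using assms(1,2) C by (auto simp: observe_eq_iff atom_value_exchange uv)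
  show "mu_weight k n (exchange k n D u v) * mu_weight k n (exchange k n D v u)
      = mu_weight k n u * mu_weight k n v"
  proof (rule sample_weight_exchange)
    fix l assume "l < n"
    have "snd (u l) = snd (v l)" if "M_at l \<in> C" "Z_at l \<in> C"
      using C[OF that(1)] C[OF that(2)] by (simp add: prod_eq_iff)
    with assms(3)[OF \<open>l < n\<close>]
    show "snd (u l) = snd (v l) \<or> (M_at l \<in> D \<longleftrightarrow> Z_at l \<in> D) \<and>
      (\<forall>i<k. (X_at l i \<in> D \<longleftrightarrow> M_at l \<in> D) \<or> (\<forall>s. bit_prob i s True = bit_prob i s False))"
      by blast
  qed
qed

text \<open>Expanding the inputs upwards and \<open>M\<close> downwards makes both chain rules end in this same context.
  Given it and \<open>M\<^sup>l\<close>, the input of player \<open>i\<close> and the other inputs are independent.\<close>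

definition context_at :: "nat \<Rightarrow> nat \<Rightarrow> atom set" where
  "context_at i l = {X_at l' i |l'. l' < l} \<union> {Z_at l' |l'. l' < n} \<union> {M_at l' |l'. l < l' \<and> l' < n}"

lemma sum_input_information:
  "(\<Sum>l<n. cmi (observe {X_at l i}) T (observe (insert (M_at l) (context_at i l))))
    \<le> cmi (observe (inputs_of i)) T (observe hidden)"
proof -
  define W where "W l = {X_at l' i |l'. l' < l} \<union> hidden" for l
  define g where "g l = obs_ent (W l) - joint_ent T (W l)" for l
  have "cmi (observe {X_at l i}) T (observe (insert (M_at l) (context_at i l))) \<le> g (Suc l) - g l"
    if l: "l < n" for l
  proof -
    define C where "C = insert (M_at l) (context_at i l)"
    define F where "F = {M_at l' |l'. l' < l}"
    have "cmi (observe {X_at l i}) (observe F) (observe C) = 0"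
      by (rule cmi_exchange_eq_0[where D = "range M_at \<inter> F \<union> {Z_at l' |l'. l' < l} \<union> {X_at l' j |l' j. l' < l}"])
         (use l in \<open>auto simp: F_def C_def context_at_def\<close>)
    then have "cmi (observe {X_at l i}) T (observe C) \<le> cmi (observe {X_at l i}) T (observe (C \<union> F))"
      by (rule cmi_observe_drop)
    also have "C \<union> F = W l"
      using l by (auto simp: C_def F_def W_def context_at_def hidden_def)
    also have "cmi (observe {X_at l i}) T (observe (W l)) = g (Suc l) - g l"
    proof -
      have "{X_at l i} \<union> W l = W (Suc l)" by (auto simp: W_def less_Suc_eq)
      then show ?thesis by (simp add: cmi_observe g_def)
    qed
    finally show ?thesis by (simp add: C_def)
  qed
  then have "(\<Sum>l<n. cmi (observe {X_at l i}) T (observe (insert (M_at l) (context_at i l)))) \<le> g n - g 0"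
    by (subst sum_lessThan_telescope[symmetric]) (intro sum_mono, simp)
  also have "\<dots> = cmi (observe (inputs_of i)) T (observe hidden)"
  proof -
    have "W n = inputs_of i \<union> hidden" "W 0 = hidden" by (auto simp: W_def inputs_of_def)
    then show ?thesis by (simp add: cmi_observe g_def)
  qed
  finally show ?thesis .
qed

text \<open>Here \<open>g l\<close> is the entropy of T given \<open>V l\<close>, and M is revealed
  from the last coordinate downwards. The surplus conditioning is on X_i in the coordinates after l,
  removed by exchanging whole cells above l. What is left at the end is bounded by the entropy given
  X_i alone.\<close>

lemma sum_hidden_information:
  "(\<Sum>l<n. cmi (observe {M_at l}) T (observe (insert (X_at l i) (context_at i l))))
    \<le> joint_ent T (inputs_of i) - obs_ent (inputs_of i)"
proof -
  define V where "V l = inputs_of i \<union> {Z_at l' |l'. l' < n} \<union> {M_at l' |l'. l \<le> l' \<and> l' < n}" for l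
  define g where "g l = joint_ent T (V l) - obs_ent (V l)" for l
  have "cmi (observe {M_at l}) T (observe (insert (X_at l i) (context_at i l))) \<le> g (Suc l) - g l"
    if l: "l < n" for l
  proof -
    define C where "C = insert (X_at l i) (context_at i l)"
    define F where "F = {X_at l' i |l'. l < l' \<and> l' < n}"
    have "cmi (observe {M_at l}) (observe F) (observe C) = 0"
      by (rule cmi_exchange_eq_0[where D = "F \<union> {Z_at l' |l'. l < l'} \<union> {M_at l' |l'. l < l'} \<union> {X_at l' j |l' j. l < l'}"])
         (use l in \<open>auto simp: F_def C_def context_at_def\<close>)
    then have "cmi (observe {M_at l}) T (observe C) \<le> cmi (observe {M_at l}) T (observe (C \<union> F))"
      by (rule cmi_observe_drop)
    also have "C \<union> F = V (Suc l)"
      using l by (auto simp: C_def F_def V_def context_at_def inputs_of_def)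
    also have "cmi (observe {M_at l}) T (observe (V (Suc l))) = g (Suc l) - g l"
    proof -
      have "{M_at l} \<union> V (Suc l) = V l" using l by (auto simp: V_def)
      then show ?thesis by (simp add: cmi_observe g_def)
    qed
    finally show ?thesis by (simp add: C_def)
  qed
  then have "(\<Sum>l<n. cmi (observe {M_at l}) T (observe (insert (X_at l i) (context_at i l)))) \<le> g n - g 0"
    by (subst sum_lessThan_telescope[symmetric]) (intro sum_mono, simp)
  also have "\<dots> \<le> g n"
    using obs_ent_le_joint_ent[of "V 0" T] by (simp add: g_def)
  also have "\<dots> \<le> joint_ent T (inputs_of i) - obs_ent (inputs_of i)"
    unfolding g_def by (rule joint_ent_antimono) (auto simp: V_def)
  finally show ?thesis .
qed

text \<open>Given \<open>hidden\<close>, the inputs of different players are independent.\<close>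

lemma sum_player_information:
  "(\<Sum>i<j. cmi (observe (inputs_of i)) T (observe hidden))
    \<le> cmi (observe (\<Union>i<j. inputs_of i)) T (observe hidden)"
proof (induction j)
  case 0
  show ?case by (simp add: cmi_nonneg)
next
  case (Suc j)
  let ?A = "\<Union>i<j. inputs_of i" and ?B = "inputs_of j"
  have "cmi (observe ?A) (observe ?B) (observe hidden) = 0"
    by (rule cmi_exchange_eq_0[where D = ?B]) (auto simp: inputs_of_def hidden_def)
  moreover have "?B \<union> (?A \<union> hidden) = (\<Union>i<Suc j. inputs_of i) \<union> hidden"
    by (auto simp: less_Suc_eq)
  moreover have "0 \<le> cmi (observe ?A) (observe ?B) (\<lambda>w. (T w, observe hidden w))"
    by (rule cmi_nonneg)
  moreover have "ent (\<lambda>w. (observe ?A w, T w, observe hidden w)) = joint_ent T (?A \<union> hidden)"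
    "ent (\<lambda>w. (observe ?B w, T w, observe hidden w)) = joint_ent T (?B \<union> hidden)"
    "ent (\<lambda>w. (observe ?A w, observe ?B w, T w, observe hidden w)) = joint_ent T ((\<Union>i<Suc j. inputs_of i) \<union> hidden)"
    "ent (\<lambda>w. (T w, observe hidden w)) = joint_ent T hidden"
    unfolding joint_ent_def by (rule ent_cong; force simp: observe_eq_iff less_Suc_eq)+
  ultimately show ?case
    using Suc.IH by (simp add: cmi_observe joint_ent_observe) (simp add: cmi_def)
qed

lemma ent_subadditive:
  fixes R :: "nat \<Rightarrow> (nat \<Rightarrow> cell) \<Rightarrow> 'b"
  shows "ent (\<lambda>w. (\<lambda>i\<in>{..<j}. R i w, C w)) - ent C \<le> (\<Sum>i<j. ent (\<lambda>w. (R i w, C w)) - ent C)"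
proof (induction j)
  case 0
  have "ent (\<lambda>w. (\<lambda>i\<in>{..<0}. R i w, C w)) = ent C"
    by (rule ent_cong) auto
  then show ?case by (simp only: lessThan_0 sum.empty diff_self)
next
  case (Suc j)
  have "ent (\<lambda>w. (\<lambda>i\<in>{..<j}. R i w, R j w, C w)) = ent (\<lambda>w. (\<lambda>i\<in>{..<Suc j}. R i w, C w))"
    by (rule ent_cong) (auto simp: fun_eq_iff restrict_def less_Suc_eq)
  then have "ent (\<lambda>w. (\<lambda>i\<in>{..<Suc j}. R i w, C w)) \<le>
      ent (\<lambda>w. (\<lambda>i\<in>{..<j}. R i w, C w)) + ent (\<lambda>w. (R j w, C w)) - ent C"
    using cmi_nonneg[of "\<lambda>w. \<lambda>i\<in>{..<j}. R i w" "R j" C] by (simp add: cmi_def)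
  with Suc.IH show ?case unfolding sum.lessThan_Suc by linarith
qed

end

section \<open>Traffic and information in a synchronous protocol\<close>

locale synchronous = information k n for k n +
  fixes m :: "nat \<Rightarrow> nat \<Rightarrow> bits \<Rightarrow> (nat \<Rightarrow> bits list) \<Rightarrow> nat \<Rightarrow> bits"
begin

abbreviation received :: "nat \<Rightarrow> nat \<Rightarrow> (nat \<Rightarrow> cell) \<Rightarrow> nat \<Rightarrow> bits list" where
  "received t i w \<equiv> recv k m (input_of k n w) t i"

abbreviation all_received :: "nat \<Rightarrow> (nat \<Rightarrow> cell) \<Rightarrow> nat \<Rightarrow> nat \<Rightarrow> bits list" where
  "all_received t w \<equiv> recv k m (input_of k n w) t"

abbreviation player_history where
  "player_history t i w \<equiv> history k m (input_of k n w) t i"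

lemma observe_inputs_of_iff:
  "i < k \<Longrightarrow> observe (inputs_of i) u = observe (inputs_of i) v \<longleftrightarrow> input_of k n u i = input_of k n v i"
  by (auto simp: observe_eq_iff inputs_of_def input_of_eq_iff)

text \<open>Exchange the inputs of i between two samples with equal M, Z and equal traffic up to
  round t. By the rectangle property this traffic survives, and the new reads of i come from the
  others, whose inputs did not move.\<close>

lemma next_round_independent:
  assumes "i < k"
  shows "cmi (received (Suc t) i) (observe (inputs_of i)) (\<lambda>w. (all_received t w, observe hidden w)) = 0"
proof (rule cmi_swap_eq_0[where mix = "exchange k n (inputs_of i)"])
  fix u v assume uv: "u \<in> samples k n" "v \<in> samples k n"
    and eq: "(all_received t u, observe hidden u) = (all_received t v, observe hidden v)"
  show "exchange k n (inputs_of i) u v \<in> samples k n"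
    "exchange k n (inputs_of i) (exchange k n (inputs_of i) u v) (exchange k n (inputs_of i) v u) = u"
    using uv by (simp_all add: exchange_in_samples exchange_exchange)
  show "observe (inputs_of i) (exchange k n (inputs_of i) u v) = observe (inputs_of i) v"
    by (auto simp: observe_eq_iff atom_value_exchange uv)
  have hid: "observe hidden (exchange k n (inputs_of i) u v) = observe hidden u"
    using eq by (auto simp: observe_eq_iff atom_value_exchange uv)
  have input: "input_of k n (exchange k n (inputs_of i) u v) = (input_of k n u)(i := input_of k n v i)"
    by (rule input_of_exchange) (use assms in \<open>auto simp: inputs_of_def\<close>)
  have hist: "player_history t i u = player_history t i v"
    using eq by (simp add: history_def)
  show "received (Suc t) i (exchange k n (inputs_of i) u v) = received (Suc t) i u"
    unfolding input by (rule recv_update_Suc_row[OF hist])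
  show "(all_received t (exchange k n (inputs_of i) u v), observe hidden (exchange k n (inputs_of i) u v))
      = (all_received t u, observe hidden u)"
    unfolding hid input recv_update[OF hist] ..
  show "mu_weight k n (exchange k n (inputs_of i) u v) * mu_weight k n (exchange k n (inputs_of i) v u)
      = mu_weight k n u * mu_weight k n v"
  proof (rule sample_weight_exchange)
    fix l assume "l < n"
    then have "M_at l \<in> hidden" "Z_at l \<in> hidden" by (auto simp: hidden_def)
    moreover have "\<And>a. a \<in> hidden \<Longrightarrow> atom_value u a = atom_value v a"
      using eq by (simp add: observe_eq_iff)
    ultimately have "snd (u l) = snd (v l)"
      by (metis Inl_inject Inr_inject atom_value.simps(2,3) prod_eqI)
    then show "snd (u l) = snd (v l) \<or> (M_at l \<in> inputs_of i \<longleftrightarrow> Z_at l \<in> inputs_of i) \<and>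
      (\<forall>j<k. (X_at l j \<in> inputs_of i \<longleftrightarrow> M_at l \<in> inputs_of i) \<or> (\<forall>s. bit_prob j s True = bit_prob j s False))" ..
  qed
qed

text \<open>Conditioning on X_i on the right could lose entropy; round by round it does not.
  Subadditivity splits the new traffic among the readers, independence of the next round inserts X_i
  at no cost, and replacing the whole past traffic in the condition by the reads of i only increases
  the entropy. The right-hand side then telescopes.\<close>

lemma round_entropy:
  "joint_ent (all_received t) hidden - obs_ent hidden
    \<le> (\<Sum>i<k. joint_ent (received t i) (inputs_of i \<union> hidden) - obs_ent (inputs_of i \<union> hidden))"
proof (induction t)
  case 0
  have "joint_ent (all_received 0) hidden = obs_ent hidden"
    unfolding joint_ent_def obs_ent_def by (rule ent_cong) auto
  then have "joint_ent (all_received 0) hidden - obs_ent hidden = 0" by simp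
  also have "\<dots> \<le> (\<Sum>i<k. joint_ent (received 0 i) (inputs_of i \<union> hidden) - obs_ent (inputs_of i \<union> hidden))"
    by (intro sum_nonneg) (simp only: diff_ge_0_iff_ge obs_ent_le_joint_ent)
  finally show ?case .
next
  case (Suc t)
  let ?C = "\<lambda>w. (all_received t w, observe hidden w)"
  have "ent (\<lambda>w. (received (Suc t) i w, ?C w)) - ent ?C
      \<le> joint_ent (received (Suc t) i) (inputs_of i \<union> hidden) - joint_ent (received t i) (inputs_of i \<union> hidden)"
    if i: "i < k" for i
  proof -
    let ?X = "observe (inputs_of i)"
    let ?D = "\<lambda>w. (received t i w, observe (inputs_of i \<union> hidden) w)"
    have "ent (\<lambda>w. (received (Suc t) i w, ?D w)) = joint_ent (received (Suc t) i) (inputs_of i \<union> hidden)"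
      unfolding joint_ent_def by (rule ent_cong) (auto simp del: recv.simps dest: recv_Suc_rowD)
    moreover have "ent (\<lambda>w. (all_received t w, ?D w)) = ent (\<lambda>w. (?X w, ?C w))"
      by (rule ent_cong) (auto simp: observe_eq_iff)
    moreover have "ent (\<lambda>w. (received (Suc t) i w, all_received t w, ?D w)) = ent (\<lambda>w. (received (Suc t) i w, ?X w, ?C w))"
      by (rule ent_cong) (auto simp: observe_eq_iff simp del: recv.simps)
    moreover have "ent ?D = joint_ent (received t i) (inputs_of i \<union> hidden)"
      by (simp add: joint_ent_def)
    ultimately show ?thesis
      using cmi_nonneg[of "received (Suc t) i" "all_received t" ?D] next_round_independent[OF i, of t]
      by (simp add: cmi_def del: recv.simps)
  qed
  then have step: "(\<Sum>i<k. ent (\<lambda>w. (received (Suc t) i w, ?C w)) - ent ?C)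
      \<le> (\<Sum>i<k. joint_ent (received (Suc t) i) (inputs_of i \<union> hidden) - joint_ent (received t i) (inputs_of i \<union> hidden))"
    by (intro sum_mono) (simp del: recv.simps)
  have "joint_ent (all_received (Suc t)) hidden = ent (\<lambda>w. (\<lambda>i\<in>{..<k}. received (Suc t) i w, ?C w))"
    unfolding joint_ent_def
  proof (rule ent_cong, safe)
    fix u v
    assume eq: "restrict (\<lambda>i. received (Suc t) i u) {..<k} = restrict (\<lambda>i. received (Suc t) i v) {..<k}"
    show "all_received (Suc t) u = all_received (Suc t) v"
    proof
      fix i show "received (Suc t) i u = received (Suc t) i v"
        using fun_cong[OF eq, of i] by (cases "i < k") (auto simp: fun_eq_iff)
    qed
  next
    fix u v assume "all_received (Suc t) u = all_received (Suc t) v"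
    then show "all_received t u = all_received t v" by (metis recv_Suc_rowD ext)
  qed (simp del: recv.simps)
  also have "\<dots> \<le> ent ?C + (\<Sum>i<k. ent (\<lambda>w. (received (Suc t) i w, ?C w)) - ent ?C)"
    using ent_subadditive[where R = "\<lambda>i w. received (Suc t) i w" and C = ?C and j = k] by (simp del: recv.simps)
  also have "\<dots> \<le> joint_ent (all_received t) hidden
      + (\<Sum>i<k. joint_ent (received (Suc t) i) (inputs_of i \<union> hidden) - joint_ent (received t i) (inputs_of i \<union> hidden))"
    using step by (simp add: joint_ent_def del: recv.simps)
  finally show ?case
    using Suc.IH by (simp add: sum_subtractf del: recv.simps)
qed

text \<open>Converts what the histories reveal about their owners into the quantity that the cost
  measures. Independence of the inputs given M and Z merges the terms into one information about all
  inputs, which is at most the entropy of the whole traffic; \<open>round_entropy\<close>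
  distributes it over the readers.\<close>

lemma sum_history_information_le:
  "(\<Sum>i<k. cmi (observe (inputs_of i)) (player_history t i) (observe hidden))
    \<le> (\<Sum>i<k. joint_ent (player_history t i) (inputs_of i) - obs_ent (inputs_of i))"
proof -
  have "(\<Sum>i<k. cmi (observe (inputs_of i)) (player_history t i) (observe hidden))
    \<le> (\<Sum>i<k. cmi (observe (inputs_of i)) (all_received t) (observe hidden))"
  proof (rule sum_mono)
    fix i
    let ?X = "observe (inputs_of i)"
    have "ent (\<lambda>w. (?X w, player_history t i w, observe hidden w)) = joint_ent (player_history t i) (inputs_of i \<union> hidden)"
      "ent (\<lambda>w. (all_received t w, player_history t i w, observe hidden w)) = joint_ent (all_received t) hidden"
      "ent (\<lambda>w. (?X w, all_received t w, player_history t i w, observe hidden w)) = joint_ent (all_received t) (inputs_of i \<union> hidden)"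
      "ent (\<lambda>w. (player_history t i w, observe hidden w)) = joint_ent (player_history t i) hidden"
      unfolding joint_ent_def by (rule ent_cong; auto simp: observe_eq_iff history_def)+
    then show "cmi ?X (player_history t i) (observe hidden) \<le> cmi ?X (all_received t) (observe hidden)"
      using cmi_nonneg[of ?X "all_received t" "\<lambda>w. (player_history t i w, observe hidden w)"]
      unfolding cmi_observe by (simp add: cmi_def)
  qed
  also have "\<dots> \<le> cmi (observe (\<Union>i<k. inputs_of i)) (all_received t) (observe hidden)"
    by (rule sum_player_information)
  also have "\<dots> \<le> joint_ent (all_received t) hidden - obs_ent hidden"
    unfolding cmi_observe
    using obs_ent_le_joint_ent[of "(\<Union>i<k. inputs_of i) \<union> hidden" "all_received t"] by simp
  also have "\<dots> \<le> (\<Sum>i<k. joint_ent (received t i) (inputs_of i \<union> hidden) - obs_ent (inputs_of i \<union> hidden))"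
    by (rule round_entropy)
  also have "\<dots> \<le> (\<Sum>i<k. joint_ent (received t i) (inputs_of i) - obs_ent (inputs_of i))"
    by (intro sum_mono joint_ent_antimono) auto
  also have "\<dots> \<le> (\<Sum>i<k. joint_ent (player_history t i) (inputs_of i) - obs_ent (inputs_of i))"
  proof (intro sum_mono diff_right_mono)
    fix i show "joint_ent (received t i) (inputs_of i) \<le> joint_ent (player_history t i) (inputs_of i)"
      unfolding joint_ent_def by (rule ent_mono) (auto simp: history_def)
  qed
  finally show ?thesis .
qed

end

subsection \<open>Single coordinates\<close>

lemma (in finite_weight) cmi_cong:
  assumes "\<And>v w. v \<in> S \<Longrightarrow> w \<in> S \<Longrightarrow> A v = A w \<longleftrightarrow> A' v = A' w"
    and "\<And>v w. v \<in> S \<Longrightarrow> w \<in> S \<Longrightarrow> B v = B w \<longleftrightarrow> B' v = B' w"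
    and "\<And>v w. v \<in> S \<Longrightarrow> w \<in> S \<Longrightarrow> C v = C w \<longleftrightarrow> C' v = C' w"
  shows "cmi A B C = cmi A' B' C'"
  unfolding cmi_def
  by (intro arg_cong2[where f = "(-)"] arg_cong2[where f = "(+)"] ent_cong) (use assms in auto)

section \<open>Law of a single coordinate\<close>

lemma sum_prod_bits:
  fixes r :: "nat \<Rightarrow> bool \<Rightarrow> real"
  shows "(\<Sum>x\<in>{..<k} \<rightarrow>\<^sub>E UNIV. \<Prod>j<k. r j (x j)) = (\<Prod>j<k. r j True + r j False)"
proof -
  have "(\<Prod>j<k. \<Sum>b\<in>UNIV. r j b) = (\<Sum>x\<in>{..<k} \<rightarrow>\<^sub>E UNIV. \<Prod>j<k. r j (x j))"
    by (rule prod_sum_PiE) auto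
  then show ?thesis by (simp add: UNIV_bool add.commute)
qed

lemma sum_cells:
  fixes r :: "nat \<Rightarrow> bool \<times> nat \<Rightarrow> bool \<Rightarrow> real"
  shows "(\<Sum>c\<in>({..<k} \<rightarrow>\<^sub>E UNIV) \<times> UNIV \<times> {..<k}. g (snd c) * (\<Prod>j<k. r j (snd c) (fst c j)))
    = (\<Sum>s\<in>UNIV \<times> {..<k}. g s * (\<Prod>j<k. r j s True + r j s False))"
proof -
  have "(\<Sum>c\<in>({..<k} \<rightarrow>\<^sub>E UNIV) \<times> UNIV \<times> {..<k}. g (snd c) * (\<Prod>j<k. r j (snd c) (fst c j)))
      = (\<Sum>x\<in>{..<k} \<rightarrow>\<^sub>E UNIV. \<Sum>s\<in>UNIV \<times> {..<k}. g s * (\<Prod>j<k. r j s (x j)))"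
    by (simp add: sum.cartesian_product case_prod_beta)
  also have "\<dots> = (\<Sum>s\<in>UNIV \<times> {..<k}. \<Sum>x\<in>{..<k} \<rightarrow>\<^sub>E UNIV. g s * (\<Prod>j<k. r j s (x j)))"
    by (rule sum.swap)
  also have "\<dots> = (\<Sum>s\<in>UNIV \<times> {..<k}. g s * (\<Prod>j<k. r j s True + r j s False))"
    by (intro sum.cong refl) (simp only: sum_distrib_left[symmetric] sum_prod_bits[of "\<lambda>j. r j _"])
  finally show ?thesis .
qed

text \<open>The event is a product of indicators of single cells and bits. Merged into the factors
  as \<open>h\<close> and \<open>r\<close>, it lets the sum over all samples factorise; the cells
  other than l sum to 1.\<close>

lemma (in information) marg_one_cell:
  assumes l: "l < n" and i: "i < k" and z: "z < k"
  shows "marg (\<lambda>w. (fst (w l) i, snd (w l))) (b, (m, z)) = cell_prob k m * bit_prob i (m, z) b"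
proof -
  let ?cells = "({..<k} \<rightarrow>\<^sub>E (UNIV :: bool set)) \<times> (UNIV :: bool set) \<times> {..<k}"
  define h where "h l' s = (if l' = l then of_bool (s = (m, z)) else 1 :: real)" for l' and s :: "bool \<times> nat"
  define r where "r l' j s a = bit_prob j s a * (if l' = l \<and> j = i then of_bool (a = b) else 1)" for l' j :: nat and s a
  have "marg (\<lambda>w. (fst (w l) i, snd (w l))) (b, (m, z))
      = (\<Sum>w\<in>samples k n. if (fst (w l) i, snd (w l)) = (b, (m, z)) then mu_weight k n w else 0)"
    unfolding marg_def by (rule sum.inter_filter) auto
  also have "\<dots> = (\<Sum>w\<in>samples k n. \<Prod>l'<n. (cell_prob k (fst (snd (w l'))) * h l' (snd (w l')))
      * (\<Prod>j<k. r l' j (snd (w l')) (fst (w l') j)))"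
  proof (rule sum.cong[OF refl])
    fix w
    have r: "(\<Prod>j<k. r l' j (snd (w l')) (fst (w l') j))
        = (\<Prod>j<k. bit_prob j (snd (w l')) (fst (w l') j)) * (if l' = l then of_bool (fst (w l) i = b) else 1)" for l'
      unfolding r_def prod.distrib using i by (cases "l' = l") simp_all
    have "(\<Prod>l'<n. (cell_prob k (fst (snd (w l'))) * h l' (snd (w l'))) * (\<Prod>j<k. r l' j (snd (w l')) (fst (w l') j)))
      = mu_weight k n w * (\<Prod>l'<n. h l' (snd (w l')) * (if l' = l then of_bool (fst (w l) i = b) else 1))"
      unfolding sample_weight_def prod.distrib[symmetric] r by (simp add: ac_simps)
    also have "(\<Prod>l'<n. h l' (snd (w l')) * (if l' = l then of_bool (fst (w l) i = b) else 1))
        = (\<Prod>l'<n. if l' = l then of_bool (snd (w l) = (m, z)) * of_bool (fst (w l) i = b) else 1)"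
      by (rule prod.cong) (auto simp: h_def)
    also have "\<dots> = of_bool (snd (w l) = (m, z)) * of_bool (fst (w l) i = b)"
      using l by simp
    finally show "(if (fst (w l) i, snd (w l)) = (b, (m, z)) then mu_weight k n w else 0)
      = (\<Prod>l'<n. (cell_prob k (fst (snd (w l'))) * h l' (snd (w l'))) * (\<Prod>j<k. r l' j (snd (w l')) (fst (w l') j)))"
      by simp
  qed
  also have "\<dots> = (\<Prod>l'<n. \<Sum>c\<in>?cells. (cell_prob k (fst (snd c)) * h l' (snd c)) * (\<Prod>j<k. r l' j (snd c) (fst c j)))"
    unfolding samples_def
    by (rule prod_sum_PiE[symmetric]) (auto intro!: finite_cartesian_product finite_PiE)
  also have "\<dots> = (\<Prod>l'<n. \<Sum>s\<in>UNIV \<times> {..<k}. cell_prob k (fst s) * h l' s * (\<Prod>j<k. r l' j s True + r l' j s False))"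
    by (intro prod.cong refl sum_cells)
  also have "\<dots> = (\<Prod>l'<n. if l' = l then cell_prob k m * bit_prob i (m, z) b else 1)"
  proof (intro prod.cong refl)
    fix l'
    have one: "bit_prob j s True + bit_prob j s False = 1" for j s
      by (simp add: bit_prob_def)
    show "(\<Sum>s\<in>UNIV \<times> {..<k}. cell_prob k (fst s) * h l' s * (\<Prod>j<k. r l' j s True + r l' j s False))
        = (if l' = l then cell_prob k m * bit_prob i (m, z) b else 1)"
    proof (cases "l' = l")
      case True
      have "r l' j s True + r l' j s False = (if j = i then bit_prob i s b else 1)" for j s
        using True one[of j s] by (cases b) (auto simp: r_def)
      then have "(\<Sum>s\<in>UNIV \<times> {..<k}. cell_prob k (fst s) * h l' s * (\<Prod>j<k. r l' j s True + r l' j s False))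
          = (\<Sum>s\<in>UNIV \<times> {..<k}. if s = (m, z) then cell_prob k m * bit_prob i (m, z) b else 0)"
        using i True by (intro sum.cong refl) (auto simp: h_def)
      then show ?thesis using z True by simp
    next
      case False
      then have "(\<Sum>s\<in>UNIV \<times> {..<k}. cell_prob k (fst s) * h l' s * (\<Prod>j<k. r l' j s True + r l' j s False))
          = (\<Sum>s\<in>UNIV \<times> {..<k}. cell_prob k (fst s))"
        by (simp add: r_def h_def one)
      also have "\<dots> = (\<Sum>a\<in>UNIV. \<Sum>z<k. cell_prob k a)"
        by (subst sum.cartesian_product) (simp add: case_prod_beta)
      also have "\<dots> = 1"
        using z by (simp add: UNIV_bool cell_prob_def)
      finally show ?thesis using False by simp
    qed
  qed
  also have "\<dots> = cell_prob k m * bit_prob i (m, z) b"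
    using l by simp
  finally show ?thesis .
qed

text \<open>\<open>relaxed_prob l i\<close> also gives weight to \<open>M\<^sup>l = 1, X\<^sub>i\<^sup>l = 0, Z\<^sup>l \<noteq> i\<close>, where two players hold a zero.\<close>

definition relaxed_prob :: "nat \<Rightarrow> nat \<Rightarrow> nat \<Rightarrow> nat \<Rightarrow> bool \<times> nat \<Rightarrow> bool \<Rightarrow> real" where
  "relaxed_prob l i l' j s b = (if l' = l \<and> j = i then if fst s then 1 else 1/2 else bit_prob j s b)"

definition flip :: "nat \<Rightarrow> nat \<Rightarrow> (nat \<Rightarrow> cell) \<Rightarrow> nat \<Rightarrow> cell" where
  "flip l i w = w(l := ((fst (w l))(i := \<not> fst (w l) i), snd (w l)))"

lemma relaxed_prob_nonneg: "0 \<le> relaxed_prob l i l' j s b"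
  by (simp add: relaxed_prob_def bit_prob_nonneg)

text \<open>The values 1 and 1/2 in \<open>relaxed_prob\<close> are those of \<open>bit_prob\<close>
  for M = 1, X_i = 1 and for M = 0, with Z other than i. So three of the four cases keep their
  weight under mu.\<close>

lemma relaxed_weight_eq:
  assumes "snd (snd (w l)) \<noteq> i" "fst (snd (w l)) \<Longrightarrow> fst (w l) i"
  shows "sample_weight k n (relaxed_prob l i) w = mu_weight k n w"
  using assms unfolding sample_weight_def
  by (intro prod.cong refl arg_cong2[where f = "(*)"]) (auto simp: relaxed_prob_def bit_prob_def)

lemma flip_flip: "flip l i (flip l i w) = w"
  by (simp add: flip_def)

lemma flip_in_samples:
  assumes "w \<in> samples k n" "l < n" "i < k"
  shows "flip l i w \<in> samples k n"
  using assms by (auto simp: samples_def flip_def PiE_def Pi_def extensional_def mem_Times_iff)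

lemma relaxed_weight_flip:
  "sample_weight k n (relaxed_prob l i) (flip l i w) = sample_weight k n (relaxed_prob l i) w"
  unfolding sample_weight_def
  by (intro prod.cong refl arg_cong2[where f = "(*)"]) (auto simp: relaxed_prob_def flip_def)

lemma atom_value_flip: "a \<noteq> X_at l i \<Longrightarrow> atom_value (flip l i w) a = atom_value w a"
  by (cases a) (auto simp: flip_def)

section \<open>Certificates of a zero\<close>

locale disj_protocol = synchronous k n m for k n m +
  fixes N :: nat and out :: "nat \<Rightarrow> bits \<Rightarrow> (nat \<Rightarrow> bits list) \<Rightarrow> bool"
  assumes two_players: "1 < k"
    and correct: "\<And>x i. x \<in> inputs k n \<Longrightarrow> i < k \<Longrightarrow> out i (x i) (recv k m x N i) = disj k n x"
begin

definition certifies :: "nat \<Rightarrow> nat \<Rightarrow> (nat \<Rightarrow> bits list) \<times> (nat \<Rightarrow> bits list) \<Rightarrow> bool" where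
  "certifies i l t \<longleftrightarrow> (\<forall>y\<in>inputs k n. history k m y N i = t \<longrightarrow> \<not> y i ! l)"

text \<open>If no history certified a zero in coordinate \<open>l\<close>, one could switch the players one after the
  other to inputs with a one there without changing any message.\<close>

lemma ex_certifies:
  assumes x: "x \<in> inputs k n" "\<not> disj k n x" and l: "l < n"
  shows "\<exists>i<k. certifies i l (history k m x N i)"
proof (rule ccontr)
  assume "\<not> ?thesis"
  then have "\<forall>i. \<exists>y. i < k \<longrightarrow> y \<in> inputs k n \<and> history k m y N i = history k m x N i \<and> y i ! l"
    by (auto simp: certifies_def)
  then obtain y where y: "y i \<in> inputs k n" "history k m (y i) N i = history k m x N i" "y i i ! l"
    if "i < k" for i by metis
  define h where "h j = (\<lambda>i. if i < j then y i i else x i)" for j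
  have same: "recv k m (h j) N = recv k m x N" if "j \<le> k" for j
    using that
  proof (induction j)
    case 0
    show ?case by (simp add: h_def)
  next
    case (Suc j)
    then have IH: "recv k m (h j) N = recv k m x N" by simp
    have "h (Suc j) = (h j)(j := y j j)"
      by (auto simp: h_def fun_eq_iff less_Suc_eq)
    moreover have "history k m (h j) N j = history k m (y j) N j"
      using y(2)[of j] Suc.prems IH by (simp add: history_def)
    ultimately show ?case
      using recv_update[of k m "h j" N j "y j"] IH by (simp only:)
  qed
  have h: "h j \<in> inputs k n" if "j \<le> k" for j
  proof (unfold inputs_def, rule PiE_I)
    fix i assume "i \<in> {..<k}"
    then show "h j i \<in> {xs. length xs = n}"
      using x(1) y(1)[of i] by (auto simp: h_def inputs_def PiE_def Pi_def)
  next
    fix i assume "i \<notin> {..<k}"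
    then show "h j i = undefined"
      using x(1) that by (auto simp: h_def inputs_def PiE_def extensional_def)
  qed
  have "disj k n (h k)"
    unfolding disj_def using l y(3) by (auto simp: h_def)
  \<comment> \<open>An output depends on the own input and the messages read. Player 0 has the same
    input in \<open>h 1\<close> and \<open>h k\<close>, player 1 the same in x and
    \<open>h 1\<close>; this is where two distinct players are required.\<close>
  moreover have "disj k n (h k) = disj k n (h 1)"
    using correct[OF h[of k], of 0] correct[OF h[of 1], of 0] same[of k] same[of 1] two_players
    by (simp add: h_def)
  moreover have "disj k n (h 1) = disj k n x"
    using correct[OF h[of 1], of 1] correct[OF x(1), of 1] same[of 1] two_players
    by (simp add: h_def)
  ultimately show False using x(2) by simp
qed

section \<open>Cut-and-paste at one player and one coordinate\<close>

context
  fixes i l :: nat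
  assumes i: "i < k" and l: "l < n"
begin

interpretation relaxed: finite_weight "samples k n" "sample_weight k n (relaxed_prob l i)"
  by unfold_locales (auto intro: sample_weight_nonneg relaxed_prob_nonneg)

abbreviation own_bit :: "(nat \<Rightarrow> cell) \<Rightarrow> bool" where "own_bit w \<equiv> fst (w l) i"
abbreviation mode :: "(nat \<Rightarrow> cell) \<Rightarrow> bool" where "mode w \<equiv> fst (snd (w l))"
abbreviation rest where "rest \<equiv> observe (context_at i l)"

definition quad :: "(nat \<Rightarrow> cell) \<Rightarrow> bool \<times> bool \<times> ((nat \<Rightarrow> bits list) \<times> (nat \<Rightarrow> bits list)) \<times> (atom \<Rightarrow> bool + nat)" where
  "quad w = (mode w, own_bit w, player_history N i w, rest w)"

lemma rest_Z: "rest w (Z_at l) = Inr (snd (snd (w l)))"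
  using l by (auto simp: observe_def context_at_def)

text \<open>Exchange the bits of i from coordinate l on; the earlier ones are fixed by the context,
  so the whole input of i is replaced, as the rectangle property demands. The weights survive
  because M and Z agree above l, while at l the relaxed factor does not depend on the bit.\<close>

lemma relaxed_swap:
  "relaxed.marg quad (a, b, v) * relaxed.marg quad (a', b', v)
    = relaxed.marg quad (a, b', v) * relaxed.marg quad (a', b, v)"
  unfolding quad_def
proof (rule relaxed.marg_swap[where C = "\<lambda>w. (player_history N i w, rest w)"
      and mix = "exchange k n {X_at l' i |l'. l \<le> l'}"])
  fix u v assume uv: "u \<in> samples k n" "v \<in> samples k n"
    and eq: "(player_history N i u, rest u) = (player_history N i v, rest v)"
  let ?D = "{X_at l' i |l'. l \<le> l'}"
  let ?w = "exchange k n ?D u v"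
  have atoms: "atom_value u a = atom_value v a" if "a \<in> context_at i l" for a
    using eq that by (simp add: observe_eq_iff)
  show "?w \<in> samples k n" "exchange k n ?D ?w (exchange k n ?D v u) = u"
    using uv by (simp_all add: exchange_in_samples exchange_exchange)
  show "mode ?w = mode u" "own_bit ?w = own_bit v"
    using i l by (auto simp: exchange_def)
  have "input_of k n ?w = (input_of k n u)(i := input_of k n v i)"
  proof (rule input_of_exchange[OF i])
    fix l' assume "X_at l' i \<notin> ?D"
    then have "X_at l' i \<in> context_at i l" by (auto simp: context_at_def)
    from atoms[OF this] show "fst (u l') i = fst (v l') i" by simp
  qed auto
  then have "player_history N i ?w = player_history N i u"
    using eq by (simp add: history_def recv_update)
  moreover have "rest ?w = rest u"
    using atoms by (auto simp: observe_eq_iff atom_value_exchange uv)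
  ultimately show "(player_history N i ?w, rest ?w) = (player_history N i u, rest u)" by simp
  show "sample_weight k n (relaxed_prob l i) ?w * sample_weight k n (relaxed_prob l i) (exchange k n ?D v u)
      = sample_weight k n (relaxed_prob l i) u * sample_weight k n (relaxed_prob l i) v"
  proof (rule sample_weight_exchange)
    fix l' assume l': "l' < n"
    have "snd (u l') = snd (v l')" if "l < l'"
    proof -
      have "M_at l' \<in> context_at i l" "Z_at l' \<in> context_at i l"
        using that l' by (auto simp: context_at_def)
      from atoms[OF this(1)] atoms[OF this(2)] show ?thesis by (simp add: prod_eq_iff)
    qed
    moreover have "relaxed_prob l i l i s True = relaxed_prob l i l i s False" for s
      by (simp add: relaxed_prob_def)
    ultimately show "snd (u l') = snd (v l') \<or> (M_at l' \<in> ?D \<longleftrightarrow> Z_at l' \<in> ?D) \<and>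
      (\<forall>j<k. (X_at l' j \<in> ?D \<longleftrightarrow> M_at l' \<in> ?D) \<or>
        (\<forall>s. relaxed_prob l i l' j s True = relaxed_prob l i l' j s False))"
      by (cases l l' rule: linorder_cases) auto
  qed
qed

lemma relaxed_marg_eq:
  assumes "\<And>w. V w = v \<Longrightarrow> snd (snd (w l)) \<noteq> i \<and> (mode w \<longrightarrow> own_bit w)"
  shows "relaxed.marg V v = marg V v"
  unfolding marg_def relaxed.marg_def
  by (intro sum.cong refl relaxed_weight_eq) (use assms in auto)

abbreviation cell_rest where "cell_rest \<equiv> \<lambda>w. (mode w, own_bit w, rest w)"

lemma relaxed_marg_flip: "relaxed.marg cell_rest (a, b, c) = relaxed.marg cell_rest (a, \<not> b, c)"
proof -
  have "flip l i w \<in> {w \<in> samples k n. cell_rest w = (a, \<not> b, c)}"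
    if "w \<in> {w \<in> samples k n. cell_rest w = (a, b, c)}" for w a b c
  proof -
    have "rest (flip l i w) = rest w"
      by (subst observe_eq_iff) (auto intro!: atom_value_flip simp: context_at_def)
    then show ?thesis
      using that flip_in_samples[OF _ l i, of w] by (auto simp: flip_def)
  qed
  from this[of _ a b c] this[of _ a "\<not> b" c] show ?thesis
    unfolding relaxed.marg_def
    by (intro sum.reindex_bij_witness[where i = "flip l i" and j = "flip l i"])
       (simp_all only: flip_flip relaxed_weight_flip not_not)
qed

text \<open>This is where the odds of M matter: 2/3 * 1/2 = 1/3 * 1. Given Z at l, the rest of the
  context is independent of cell l, so only that cell has to be compared.\<close>

lemma marg_mode:
  assumes c: "c (Z_at l) \<noteq> Inr i" "c \<in> rest ` samples k n"
  shows "marg cell_rest (False, True, c) = marg cell_rest (True, True, c)"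
proof -
  obtain w0 where w0: "w0 \<in> samples k n" "c = rest w0" using c(2) by auto
  define z where "z = snd (snd (w0 l))"
  have z: "z < k" "z \<noteq> i" "c (Z_at l) = Inr z"
    using w0 c(1) sample_at(2)[OF w0(1) l] by (auto simp: z_def rest_Z)
  let ?B = "\<lambda>w. (mode w, own_bit w)" and ?Z = "\<lambda>w. snd (snd (w l))"
  let ?D = "{X_at l j |j. True} \<union> {M_at l}"
  let ?R = "\<lambda>w. observe (context_at i l - {Z_at l}) w"
  let ?c = "restrict c (context_at i l - {Z_at l})"
  let ?P = "\<lambda>r a. marg (\<lambda>w. (?R w, ?B w, ?Z w)) (r, (a, True), z)"
  have swap: "?P r a * ?P r' a' = ?P r a' * ?P r' a" for r r' a a'
  proof (rule marg_swap[where mix = "exchange k n ?D"])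
    fix u v assume uv: "u \<in> samples k n" "v \<in> samples k n" and eq: "?Z u = ?Z v"
    show "exchange k n ?D u v \<in> samples k n" "exchange k n ?D (exchange k n ?D u v) (exchange k n ?D v u) = u"
      using uv by (simp_all add: exchange_in_samples exchange_exchange)
    show "?R (exchange k n ?D u v) = ?R u"
      by (subst observe_eq_iff) (auto simp: atom_value_exchange uv context_at_def)
    show "?B (exchange k n ?D u v) = ?B v" "?Z (exchange k n ?D u v) = ?Z u"
      using i l by (auto simp: exchange_def)
    \<comment> \<open>Z at l is the condition and thus stays outside the exchanged set. As it
      agrees, moving it too changes nothing and makes this an exchange of a whole cell.\<close>
    have "exchange k n ?D a b = exchange k n (insert (Z_at l) ?D) a b" if "?Z a = ?Z b" for a b
      using that by (intro ext) (auto simp: exchange_def restrict_def fun_eq_iff)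
    then have "mu_weight k n (exchange k n ?D u v) * mu_weight k n (exchange k n ?D v u)
        = mu_weight k n (exchange k n (insert (Z_at l) ?D) u v) * mu_weight k n (exchange k n (insert (Z_at l) ?D) v u)"
      using eq by simp
    also have "\<dots> = mu_weight k n u * mu_weight k n v"
      by (rule sample_weight_exchange) auto
    finally show "mu_weight k n (exchange k n ?D u v) * mu_weight k n (exchange k n ?D v u)
        = mu_weight k n u * mu_weight k n v" .
  qed
  have total: "(\<Sum>r\<in>?R ` samples k n. ?P r a) = 1 / (3 * real k)" for a
  proof -
    have "(\<Sum>r\<in>?R ` samples k n. ?P r a) = marg (\<lambda>w. (?B w, ?Z w)) ((a, True), z)"
      by (rule sum_marg_pair) auto
    also have "\<dots> = marg (\<lambda>w. (fst (w l) i, snd (w l))) (True, (a, z))"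
      by (rule marg_cong) (auto simp: prod_eq_iff)
    also have "\<dots> = 1 / (3 * real k)"
      using z by (simp add: marg_one_cell[OF l i z(1)] cell_prob_def bit_prob_def)
    finally show ?thesis .
  qed
  \<comment> \<open>Summing the swap identity over all contexts leaves the totals for M = 0 and M =
    1, which are equal and nonzero.\<close>
  have "?P ?c False * (\<Sum>r\<in>?R ` samples k n. ?P r True) = ?P ?c True * (\<Sum>r\<in>?R ` samples k n. ?P r False)"
    unfolding sum_distrib_left by (intro sum.cong refl swap)
  then have "?P ?c False = ?P ?c True"
    using two_players by (simp add: total)
  moreover have "?P ?c a = marg cell_rest (a, True, c)" for a
  proof (rule marg_cong)
    fix w
    have "(?R w = ?c \<and> ?Z w = z) \<longleftrightarrow> rest w = c"
    proof -
      have "?R w = ?c \<longleftrightarrow> (\<forall>a\<in>context_at i l - {Z_at l}. atom_value w a = atom_value w0 a)"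
        unfolding w0(2) by (auto simp: observe_def restrict_def fun_eq_iff)
      moreover have "Z_at l \<in> context_at i l" using l by (auto simp: context_at_def)
      ultimately show ?thesis
        unfolding w0(2) observe_eq_iff z_def by auto
    qed
    then show "(?R w, ?B w, ?Z w) = (?c, (a, True), z) \<longleftrightarrow> cell_rest w = (a, True, c)"
      by auto
  qed
  ultimately show ?thesis by simp
qed

text \<open>\<open>fooled\<close> measures how often two players hold a zero in coordinate \<open>l\<close> and the history of \<open>i\<close> reveals
  that \<open>i\<close> is one of them. Such histories have weight 0 once \<open>i\<close> holds a one, so \<open>fooled\<close> is at most a
  squared Hellinger distance, which \<open>relaxed_swap\<close> moves to distributions that do occur.\<close>

definition fooled :: real where
  "fooled = (\<Sum>w | w \<in> samples k n \<and> mode w \<and> \<not> own_bit w \<and> snd (snd (w l)) \<noteq> i \<and>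
     certifies i l (player_history N i w). sample_weight k n (relaxed_prob l i) w)"

text \<open>The factor 4 is a 2 from (a - c)^2 <= 2 (a - b)^2 + 2 (b - c)^2 times a 2 from
  \<open>cmi_ge_binary\<close>.\<close>

lemma fooled_le:
  "fooled \<le> 4 * (cmi (observe {X_at l i}) (player_history N i) (observe (insert (M_at l) (context_at i l)))
    + cmi (observe {M_at l}) (player_history N i) (observe (insert (X_at l i) (context_at i l))))"
proof -
  let ?T = "player_history N i"
  define G where "G = {c \<in> rest ` samples k n. c (Z_at l) \<noteq> Inr i}"
  define J where "J = ?T ` samples k n \<times> G"
  \<comment> \<open>The arguments a and b are M and X_i. On contexts in \<open>G\<close>, where Z is
    not i, all of these except \<open>P True False\<close> are marginals of mu itself.\<close>
  define P where "P a b v = relaxed.marg quad (a, b, v)" for a b v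
  have fin: "finite G" "finite J" by (auto simp: G_def J_def)
  have P0: "0 \<le> P a b v" for a b v unfolding P_def by (rule relaxed.marg_nonneg)
  have Z_ne: "snd (snd (w l)) \<noteq> i" if "rest w \<in> G" for w
    using that rest_Z[of w] unfolding G_def by auto
  have P_eq: "P a b (t, c) = marg quad (a, b, t, c)" if "c \<in> G" "a \<Longrightarrow> b" for a b t c
    unfolding P_def
  proof (rule relaxed_marg_eq)
    fix w assume "quad w = (a, b, t, c)"
    then have "rest w = c" "mode w = a" "own_bit w = b" by (simp_all add: quad_def)
    then show "snd (snd (w l)) \<noteq> i \<and> (mode w \<longrightarrow> own_bit w)"
      using Z_ne[of w] that by blast
  qed
  have cell_eq: "relaxed.marg cell_rest (a, b, c) = marg cell_rest (a, b, c)" if "c \<in> G" "a \<Longrightarrow> b" for a b c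
  proof (rule relaxed_marg_eq)
    fix w assume "cell_rest w = (a, b, c)"
    then have "rest w = c" "mode w = a" "own_bit w = b" by simp_all
    then show "snd (snd (w l)) \<noteq> i \<and> (mode w \<longrightarrow> own_bit w)"
      using Z_ne[of w] that by blast
  qed
  have mode_eq: "marg cell_rest (False, True, c) = marg cell_rest (True, True, c)" if "c \<in> G" for c
    using that by (intro marg_mode) (auto simp: G_def)
  have bit_eq: "marg cell_rest (False, False, c) = marg cell_rest (False, True, c)" if "c \<in> G" for c
    using relaxed_marg_flip[of False False c] that by (simp add: cell_eq)
  have input: "(\<Sum>v\<in>J. (sqrt (P False False v) - sqrt (P False True v))\<^sup>2) / 2
    \<le> cmi (observe {X_at l i}) ?T (observe (insert (M_at l) (context_at i l)))"
  proof -
    let ?C = "\<lambda>w. (mode w, rest w)"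
    have half: "marg (\<lambda>w. (own_bit w, ?C w)) (False, c) = marg (\<lambda>w. (own_bit w, ?C w)) (True, c)"
      if "c \<in> {False} \<times> G" for c
    proof -
      have "marg (\<lambda>w. (own_bit w, ?C w)) (b, (False, c')) = marg cell_rest (False, b, c')" for b c'
        by (rule marg_cong) auto
      then show ?thesis using that bit_eq by auto
    qed
    have "(\<Sum>v\<in>J. (sqrt (P False False v) - sqrt (P False True v))\<^sup>2) / 2
      = (\<Sum>(t, c)\<in>?T ` samples k n \<times> ({False} \<times> G). (sqrt (marg (\<lambda>w. (own_bit w, ?T w, ?C w)) (False, t, c))
          - sqrt (marg (\<lambda>w. (own_bit w, ?T w, ?C w)) (True, t, c)))\<^sup>2) / 2"
    proof (intro arg_cong2[where f = "(/)"] refl, rule sum.reindex_bij_witness[where i = "\<lambda>(t, m, c). (t, c)" and j = "\<lambda>(t, c). (t, False, c)"])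
      fix v assume v: "v \<in> J"
      obtain t c where tc: "v = (t, c)" "c \<in> G" using v by (auto simp: J_def)
      have "marg (\<lambda>w. (own_bit w, ?T w, ?C w)) (b, t, False, c) = P False b (t, c)" for b
        unfolding P_eq[OF tc(2), of False b t, simplified] by (rule marg_cong) (auto simp: quad_def)
      then show "(case (case v of (t, c) \<Rightarrow> (t, False, c)) of (t, c) \<Rightarrow>
        (sqrt (marg (\<lambda>w. (own_bit w, ?T w, ?C w)) (False, t, c)) - sqrt (marg (\<lambda>w. (own_bit w, ?T w, ?C w)) (True, t, c)))\<^sup>2)
        = (sqrt (P False False v) - sqrt (P False True v))\<^sup>2"
        by (simp add: tc)
    qed (auto simp: J_def)
    also have "\<dots> \<le> cmi own_bit ?T ?C"
      by (intro cmi_ge_binary half) (use fin in auto)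
    also have "\<dots> = cmi (observe {X_at l i}) ?T (observe (insert (M_at l) (context_at i l)))"
      by (rule cmi_cong) (auto simp: observe_eq_iff)
    finally show ?thesis .
  qed
  have hid: "(\<Sum>v\<in>J. (sqrt (P False True v) - sqrt (P True True v))\<^sup>2) / 2
    \<le> cmi (observe {M_at l}) ?T (observe (insert (X_at l i) (context_at i l)))"
  proof -
    let ?C = "\<lambda>w. (own_bit w, rest w)"
    have half: "marg (\<lambda>w. (mode w, ?C w)) (False, c) = marg (\<lambda>w. (mode w, ?C w)) (True, c)"
      if "c \<in> {True} \<times> G" for c
      using that mode_eq by auto
    have "(\<Sum>v\<in>J. (sqrt (P False True v) - sqrt (P True True v))\<^sup>2) / 2
      = (\<Sum>(t, c)\<in>?T ` samples k n \<times> ({True} \<times> G). (sqrt (marg (\<lambda>w. (mode w, ?T w, ?C w)) (False, t, c))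
          - sqrt (marg (\<lambda>w. (mode w, ?T w, ?C w)) (True, t, c)))\<^sup>2) / 2"
    proof (intro arg_cong2[where f = "(/)"] refl, rule sum.reindex_bij_witness[where i = "\<lambda>(t, m, c). (t, c)" and j = "\<lambda>(t, c). (t, True, c)"])
      fix v assume v: "v \<in> J"
      obtain t c where tc: "v = (t, c)" "c \<in> G" using v by (auto simp: J_def)
      have "marg (\<lambda>w. (mode w, ?T w, ?C w)) (a, t, True, c) = P a True (t, c)" for a
        unfolding P_eq[OF tc(2), of a True t, simplified] by (rule marg_cong) (auto simp: quad_def)
      then show "(case (case v of (t, c) \<Rightarrow> (t, True, c)) of (t, c) \<Rightarrow>
        (sqrt (marg (\<lambda>w. (mode w, ?T w, ?C w)) (False, t, c)) - sqrt (marg (\<lambda>w. (mode w, ?T w, ?C w)) (True, t, c)))\<^sup>2)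
        = (sqrt (P False True v) - sqrt (P True True v))\<^sup>2"
        by (simp add: tc)
    qed (auto simp: J_def)
    also have "\<dots> \<le> cmi mode ?T ?C"
      by (intro cmi_ge_binary half) (use fin in auto)
    also have "\<dots> = cmi (observe {M_at l}) ?T (observe (insert (X_at l i) (context_at i l)))"
      by (rule cmi_cong) (auto simp: observe_eq_iff)
    finally show ?thesis .
  qed
  have mass: "(\<Sum>v\<in>J. P a b v) = (\<Sum>c\<in>G. relaxed.marg cell_rest (a, b, c))" for a b
  proof -
    have "(\<Sum>v\<in>J. P a b v) = (\<Sum>c\<in>G. \<Sum>t\<in>?T ` samples k n. P a b (t, c))"
      unfolding J_def by (subst sum.swap) (simp add: sum.cartesian_product)
    also have "\<dots> = (\<Sum>c\<in>G. relaxed.marg cell_rest (a, b, c))"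
    proof (rule sum.cong[OF refl])
      fix c
      have "(\<Sum>t\<in>?T ` samples k n. P a b (t, c))
          = (\<Sum>t\<in>?T ` samples k n. relaxed.marg (\<lambda>w. (?T w, cell_rest w)) (t, (a, b, c)))"
        unfolding P_def by (intro sum.cong refl relaxed.marg_cong) (auto simp: quad_def)
      then show "(\<Sum>t\<in>?T ` samples k n. P a b (t, c)) = relaxed.marg cell_rest (a, b, c)"
        by (simp add: relaxed.sum_marg_pair)
    qed
    finally show ?thesis .
  qed
  have masses: "(\<Sum>v\<in>J. P True False v) = (\<Sum>v\<in>J. P True True v)"
    "(\<Sum>v\<in>J. P False False v) = (\<Sum>v\<in>J. P False True v)"
    unfolding mass using relaxed_marg_flip[of True False] relaxed_marg_flip[of False False] by simp_all
  have expand: "(\<Sum>v\<in>J. (sqrt (f v) - sqrt (g v))\<^sup>2)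
      = (\<Sum>v\<in>J. f v) + (\<Sum>v\<in>J. g v) - 2 * (\<Sum>v\<in>J. sqrt (f v * g v))"
    if "\<And>v. 0 \<le> f v" "\<And>v. 0 \<le> g v" for f g
    by (simp add: power2_diff that real_sqrt_mult sum.distrib sum_subtractf sum_distrib_left mult.assoc)
  \<comment> \<open>Equal cross products give equal sums of their roots; as the masses agree in
    pairs as well, the two squared distances coincide.\<close>
  have "P True False v * P False True v = P False False v * P True True v" for v
    using relaxed_swap[of False False v True True] by (simp add: P_def mult.commute)
  then have cut_paste: "(\<Sum>v\<in>J. (sqrt (P True False v) - sqrt (P False True v))\<^sup>2)
      = (\<Sum>v\<in>J. (sqrt (P False False v) - sqrt (P True True v))\<^sup>2)"
    using masses by (simp add: expand P0)
  have square: "(a - c)\<^sup>2 \<le> 2 * (a - b)\<^sup>2 + 2 * (b - c)\<^sup>2" for a b c :: real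
  proof -
    have "2 * (a - b)\<^sup>2 + 2 * (b - c)\<^sup>2 - (a - c)\<^sup>2 = (a - 2 * b + c)\<^sup>2"
      by (simp add: power2_eq_square algebra_simps)
    then show ?thesis using zero_le_power2[of "a - 2 * b + c"] by linarith
  qed
  have "fooled = (\<Sum>v | v \<in> J \<and> certifies i l (fst v). P True False v)"
  proof -
    let ?W = "{w \<in> samples k n. mode w \<and> \<not> own_bit w \<and> snd (snd (w l)) \<noteq> i \<and> certifies i l (?T w)}"
    have "(\<Sum>v | v \<in> J \<and> certifies i l (fst v). P True False v)
      = (\<Sum>v | v \<in> J \<and> certifies i l (fst v). \<Sum>w | w \<in> ?W \<and> (?T w, rest w) = v. sample_weight k n (relaxed_prob l i) w)"
      unfolding P_def relaxed.marg_def
    proof (intro sum.cong refl)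
      fix v assume v: "v \<in> {v \<in> J. certifies i l (fst v)}"
      then have "snd v \<in> G" "certifies i l (fst v)" by (auto simp: J_def)
      then show "{w \<in> samples k n. quad w = (True, False, v)} = {w \<in> ?W. (?T w, rest w) = v}"
      proof (intro Collect_cong)
        fix w
        have "quad w = (True, False, v) \<longleftrightarrow> mode w \<and> \<not> own_bit w \<and> ?T w = fst v \<and> rest w = snd v"
          by (cases v) (auto simp: quad_def)
        moreover have "(?T w, rest w) = v \<longleftrightarrow> ?T w = fst v \<and> rest w = snd v"
          by (cases v) auto
        ultimately show "w \<in> samples k n \<and> quad w = (True, False, v) \<longleftrightarrow> w \<in> ?W \<and> (?T w, rest w) = v"
          using Z_ne[of w] \<open>snd v \<in> G\<close> \<open>certifies i l (fst v)\<close> unfolding mem_Collect_eq by metis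
      qed
    qed
    also have "\<dots> = fooled"
      unfolding fooled_def using fin by (intro sum.group) (auto simp: J_def G_def rest_Z)
    finally show ?thesis ..
  qed
  also have "\<dots> \<le> (\<Sum>v | v \<in> J \<and> certifies i l (fst v). (sqrt (P True False v) - sqrt (P False True v))\<^sup>2)"
  proof (rule sum_mono, clarify)
    fix t and c :: "atom \<Rightarrow> bool + nat" assume cert: "certifies i l (fst (t, c))"
    have "\<not> own_bit w" if "?T w = t" for w
      using cert that input_of_in_inputs[of k n w] by (auto simp: certifies_def input_of_nth[OF i l])
    then have "P False True (t, c) = 0"
      unfolding P_def relaxed.marg_def by (intro sum.neutral) (auto simp: quad_def)
    then show "P True False (t, c) \<le> (sqrt (P True False (t, c)) - sqrt (P False True (t, c)))\<^sup>2"
      using P0 by simp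
  qed
  also have "\<dots> \<le> (\<Sum>v\<in>J. (sqrt (P True False v) - sqrt (P False True v))\<^sup>2)"
    using fin by (intro sum_mono2) auto
  also have "\<dots> \<le> (\<Sum>v\<in>J. 2 * (sqrt (P False False v) - sqrt (P False True v))\<^sup>2
      + 2 * (sqrt (P False True v) - sqrt (P True True v))\<^sup>2)"
    unfolding cut_paste by (intro sum_mono square)
  also have "\<dots> = 2 * (\<Sum>v\<in>J. (sqrt (P False False v) - sqrt (P False True v))\<^sup>2)
      + 2 * (\<Sum>v\<in>J. (sqrt (P False True v) - sqrt (P True True v))\<^sup>2)"
    by (simp add: sum.distrib sum_distrib_left)
  finally show ?thesis using input hid by argo
qed

end

section \<open>Pairs of players sharing the zeros of a coordinate\<close>

definition fooled_at :: "nat \<Rightarrow> nat \<Rightarrow> nat \<Rightarrow> real" where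
  "fooled_at l i z = (\<Sum>w | w \<in> samples k n \<and> snd (w l) = (True, z) \<and> \<not> fst (w l) i \<and>
     certifies i l (player_history N i w). sample_weight k n (relaxed_prob l i) w)"

lemma fooled_eq_sum:
  assumes "i < k" "l < n"
  shows "fooled i l = (\<Sum>z\<in>{..<k} - {i}. fooled_at l i z)"
proof -
  let ?W = "{w \<in> samples k n. fst (snd (w l)) \<and> \<not> fst (w l) i \<and> snd (snd (w l)) \<noteq> i \<and>
     certifies i l (player_history N i w)}"
  have "(\<Sum>z\<in>{..<k} - {i}. \<Sum>w | w \<in> ?W \<and> snd (snd (w l)) = z. sample_weight k n (relaxed_prob l i) w)
      = fooled i l"
    unfolding fooled_def[OF assms] by (rule sum.group) (use sample_at(2)[OF _ assms(2)] in auto)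
  also have "(\<Sum>z\<in>{..<k} - {i}. \<Sum>w | w \<in> ?W \<and> snd (snd (w l)) = z. sample_weight k n (relaxed_prob l i) w)
      = (\<Sum>z\<in>{..<k} - {i}. fooled_at l i z)"
    unfolding fooled_at_def
    by (intro sum.cong refl) (auto simp: prod_eq_iff)
  finally show ?thesis ..
qed

text \<open>Flipping the bit of i preserves the relaxed weight and leads to a genuine event of mu,
  namely M = 1 and Z = z, of probability 1/3 * 1/k.\<close>

lemma relaxed_mass:
  assumes "l < n" "i < k" "z < k" "i \<noteq> z"
  shows "(\<Sum>w | w \<in> samples k n \<and> snd (w l) = (True, z) \<and> \<not> fst (w l) i.
    sample_weight k n (relaxed_prob l i) w) = 1 / (3 * real k)"
proof -
  have "(\<Sum>w | w \<in> samples k n \<and> snd (w l) = (True, z) \<and> \<not> fst (w l) i. sample_weight k n (relaxed_prob l i) w)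
    = (\<Sum>w | w \<in> samples k n \<and> snd (w l) = (True, z) \<and> fst (w l) i. sample_weight k n (relaxed_prob l i) w)"
    by (rule sum.reindex_bij_witness[where i = "flip l i" and j = "flip l i"])
       (use assms(1,2) flip_in_samples in \<open>auto simp: flip_flip relaxed_weight_flip, auto simp: flip_def\<close>)
  also have "\<dots> = marg (\<lambda>w. (fst (w l) i, snd (w l))) (True, (True, z))"
    unfolding marg_def
    by (rule sum.cong) (use assms(4) in \<open>auto intro!: relaxed_weight_eq\<close>)
  also have "\<dots> = 1 / (3 * real k)"
    using assms by (simp add: marg_one_cell cell_prob_def bit_prob_def)
  finally show ?thesis .
qed

text \<open>In every coordinate other than l the player named by Z still holds a zero, and in l both
  i and z do. So the answer is 0 even though mu does not produce these inputs with M = 1.\<close>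

lemma relaxed_support:
  assumes w: "w \<in> samples k n" "sample_weight k n (relaxed_prob l i) w \<noteq> 0"
    and l: "l < n" "i < k" "snd (w l) = (True, z)" "\<not> fst (w l) i" "i \<noteq> z"
  shows "\<not> disj k n (input_of k n w)" and "\<And>j. j < k \<Longrightarrow> fst (w l) j \<longleftrightarrow> j \<noteq> i \<and> j \<noteq> z"
proof -
  have nz: "relaxed_prob l i l' j (snd (w l')) (fst (w l') j) \<noteq> 0" if "l' < n" "j < k" for l' j
    using w(2) that by (auto simp: sample_weight_def prod_zero_iff)
  show "fst (w l) j \<longleftrightarrow> j \<noteq> i \<and> j \<noteq> z" if "j < k" for j
    using nz[OF l(1) that] l by (auto simp: relaxed_prob_def bit_prob_def split: if_splits)
  have "\<exists>j<k. \<not> fst (w l') j" if l': "l' < n" for l'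
  proof (cases "l' = l")
    case True
    then show ?thesis using l by auto
  next
    case False
    then show ?thesis
      using nz[OF l' sample_at(2)[OF w(1) l']] sample_at(2)[OF w(1) l'] by (auto simp: relaxed_prob_def bit_prob_def)
  qed
  then show "\<not> disj k n (input_of k n w)"
    unfolding disj_def using input_of_nth by metis
qed

text \<open>The same inputs arise from relaxing i with Z = z and from relaxing z with Z = i, with
  equal weights. Some player certifies a zero in l, and a certifying player holds one, so it is i or
  z; all of the mass is covered by the two terms.\<close>

lemma fooled_pair:
  assumes l: "l < n" and i: "i < k" and z: "z < k" and ne: "i \<noteq> z"
  shows "1 / (3 * real k) \<le> fooled_at l i z + fooled_at l z i"
proof -
  let ?p = "\<lambda>i. sample_weight k n (relaxed_prob l i)"
  \<comment> \<open>Only the label Z changes, so inputs and histories are untouched.\<close>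
  define \<tau> where "\<tau> j w = w(l := (fst (w l), True, j))" for j and w :: "nat \<Rightarrow> cell"
  let ?A = "{w \<in> samples k n. snd (w l) = (True, z) \<and> \<not> fst (w l) i}"
  let ?B = "{w \<in> ?A. certifies i l (player_history N i w)}"
  let ?C = "{w \<in> ?A. \<not> fst (w l) z \<and> certifies z l (player_history N z w)}"
  have p0: "0 \<le> ?p j w" for j w
    by (intro sample_weight_nonneg relaxed_prob_nonneg)
  have "?p i w = 0" if "w \<in> ?A - (?B \<union> ?C)" for w
  proof (rule ccontr)
    assume nz: "?p i w \<noteq> 0"
    have w: "w \<in> samples k n" "snd (w l) = (True, z)" "\<not> fst (w l) i" using that by auto
    note supp = relaxed_support[OF w(1) nz l i w(2,3) ne]
    obtain j where j: "j < k" "certifies j l (player_history N j w)"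
      using ex_certifies[OF input_of_in_inputs supp(1) l] by blast
    have "\<not> fst (w l) j"
      using j input_of_in_inputs[of k n w] by (auto simp: certifies_def input_of_nth[OF _ l])
    then have "j = i \<or> j = z" using supp(2)[OF j(1)] by simp
    then show False using that j supp(2)[OF z] by auto
  qed
  then have "(\<Sum>w\<in>?A. ?p i w) = (\<Sum>w\<in>?B \<union> ?C. ?p i w)"
    by (intro sum.mono_neutral_right) auto
  also have "\<dots> \<le> (\<Sum>w\<in>?B. ?p i w) + (\<Sum>w\<in>?C. ?p i w)"
    by (subst sum.union_inter[symmetric]) (auto intro!: sum_nonneg p0)
  also have "(\<Sum>w\<in>?B. ?p i w) = fooled_at l i z"
    unfolding fooled_at_def by (rule sum.cong) auto
  also have "(\<Sum>w\<in>?C. ?p i w) \<le> fooled_at l z i"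
  proof -
    let ?C' = "{w \<in> samples k n. snd (w l) = (True, i) \<and> \<not> fst (w l) i \<and> \<not> fst (w l) z \<and> certifies z l (player_history N z w)}"
    have input: "input_of k n (\<tau> j w) = input_of k n w" for j w
      by (intro ext) (auto simp: input_of_def \<tau>_def)
    have mem: "\<tau> j w \<in> samples k n" if "w \<in> samples k n" "j < k" for j w
      using that l by (auto simp: samples_def \<tau>_def PiE_def Pi_def extensional_def mem_Times_iff)
    have inv: "\<tau> j (\<tau> j' w) = w" if "snd (w l) = (True, j)" for j j' w
      using that by (auto simp: \<tau>_def prod_eq_iff)
    \<comment> \<open>At l the bits of i and z are both 0, where their factors are 1 in either
      description.\<close>
    have weight: "?p z (\<tau> i w) = ?p i w" if "w \<in> ?C" for w
      using that ne unfolding sample_weight_def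
      by (intro prod.cong refl arg_cong2[where f = "(*)"])
         (auto simp: \<tau>_def relaxed_prob_def bit_prob_def)
    have "(\<Sum>w\<in>?C. ?p i w) = (\<Sum>w\<in>?C'. ?p z w)"
    proof (rule sum.reindex_bij_witness[where i = "\<tau> z" and j = "\<tau> i"])
      fix w assume w: "w \<in> ?C"
      show "\<tau> z (\<tau> i w) = w" "\<tau> i w \<in> ?C'" "?p z (\<tau> i w) = ?p i w"
        using w weight[OF w] by (auto simp: inv mem i input) (auto simp: \<tau>_def)
    next
      fix w assume w: "w \<in> ?C'"
      show "\<tau> i (\<tau> z w) = w" "\<tau> z w \<in> ?C"
        using w by (auto simp: inv mem z input) (auto simp: \<tau>_def)
    qed
    also have "\<dots> \<le> fooled_at l z i"
      unfolding fooled_at_def by (rule sum_mono2) (auto simp: p0)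
    finally show ?thesis .
  qed
  finally show ?thesis
    unfolding relaxed_mass[OF l i z ne] by simp
qed

text \<open>There are k (k - 1) ordered pairs of mass 1 / (3 k), and the symmetric sum counts every
  \<open>fooled_at\<close> term twice.\<close>

lemma sum_fooled_ge:
  assumes "l < n"
  shows "(real k - 1) / 6 \<le> (\<Sum>i<k. fooled i l)"
proof -
  have swap: "(\<Sum>i<k. \<Sum>z\<in>{..<k} - {i}. fooled_at l z i) = (\<Sum>i<k. \<Sum>z\<in>{..<k} - {i}. fooled_at l i z)"
  proof -
    have "(\<Sum>i<k. \<Sum>z\<in>{..<k} - {i}. g i z) = (\<Sum>i<k. \<Sum>z<k. if z = i then 0 else g i z)" for g :: "nat \<Rightarrow> nat \<Rightarrow> real"
    proof (rule sum.cong[OF refl])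
      fix i show "sum (g i) ({..<k} - {i}) = (\<Sum>z<k. if z = i then 0 else g i z)"
        by (rule sum.mono_neutral_cong_left) auto
    qed
    then show ?thesis
      by (simp only:) (subst sum.swap, intro sum.cong refl, auto)
  qed
  have "(real k - 1) / 3 = (\<Sum>i<k. \<Sum>z\<in>{..<k} - {i}. 1 / (3 * real k))"
    using two_players by (simp add: of_nat_diff)
  also have "\<dots> \<le> (\<Sum>i<k. \<Sum>z\<in>{..<k} - {i}. fooled_at l i z + fooled_at l z i)"
    by (intro sum_mono fooled_pair[OF assms]) auto
  also have "\<dots> = 2 * (\<Sum>i<k. fooled i l)"
    using assms by (simp add: sum.distrib swap fooled_eq_sum)
  finally show ?thesis by simp
qed

text \<open>Here 48 = 6 * 4 * 2: the mass per coordinate, the Hellinger factor of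
  \<open>fooled_le\<close>, and the two information sums, each of which is at most the sum of the
  entropies.\<close>

lemma history_information_ge:
  "real n * (real k - 1) / 48 \<le> (\<Sum>i<k. joint_ent (player_history N i) (inputs_of i) - obs_ent (inputs_of i))"
proof -
  let ?I = "\<lambda>i l. cmi (observe {X_at l i}) (player_history N i) (observe (insert (M_at l) (context_at i l)))"
  let ?J = "\<lambda>i l. cmi (observe {M_at l}) (player_history N i) (observe (insert (X_at l i) (context_at i l)))"
  let ?h = "\<lambda>i. joint_ent (player_history N i) (inputs_of i) - obs_ent (inputs_of i)"
  have "real n * ((real k - 1) / 6) = (\<Sum>l<n. (real k - 1) / 6)" by simp
  also have "\<dots> \<le> (\<Sum>l<n. \<Sum>i<k. fooled i l)"
    by (intro sum_mono sum_fooled_ge) auto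
  also have "\<dots> \<le> (\<Sum>l<n. \<Sum>i<k. 4 * (?I i l + ?J i l))"
    by (intro sum_mono fooled_le) auto
  also have "\<dots> = (\<Sum>i<k. \<Sum>l<n. 4 * (?I i l + ?J i l))"
    by (rule sum.swap)
  also have "\<dots> = 4 * ((\<Sum>i<k. \<Sum>l<n. ?I i l) + (\<Sum>i<k. \<Sum>l<n. ?J i l))"
    by (simp add: sum.distrib sum_distrib_left)
  also have "\<dots> \<le> 4 * ((\<Sum>i<k. ?h i) + (\<Sum>i<k. ?h i))"
  proof -
    have "(\<Sum>i<k. \<Sum>l<n. ?I i l) \<le> (\<Sum>i<k. cmi (observe (inputs_of i)) (player_history N i) (observe hidden))"
      by (intro sum_mono sum_input_information)
    also have "\<dots> \<le> (\<Sum>i<k. ?h i)"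
      by (rule sum_history_information_le)
    finally have "(\<Sum>i<k. \<Sum>l<n. ?I i l) \<le> (\<Sum>i<k. ?h i)" .
    moreover have "(\<Sum>i<k. \<Sum>l<n. ?J i l) \<le> (\<Sum>i<k. ?h i)"
      by (intro sum_mono sum_hidden_information)
    ultimately show ?thesis by (intro mult_left_mono add_mono) simp_all
  qed
  finally show ?thesis by simp
qed

end

subsection \<open>Mutual information with a finite variable\<close>

text \<open>\<open>K x y\<close> plays the role of the probability of X = x given Y = y. Divided by
  the probability of X = x it is a density of the joint law with respect to the product law, so the
  divergence that defines mutual information becomes an expected logarithm.\<close>

lemma (in prob_space) mutual_information_finite_kernel:
  fixes K :: "'b \<Rightarrow> 'c \<Rightarrow> real"
  assumes b: "1 < b" and X [measurable]: "X \<in> M \<rightarrow>\<^sub>M S" and Y [measurable]: "Y \<in> M \<rightarrow>\<^sub>M T"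
    and F: "finite F" "\<And>\<omega>. \<omega> \<in> space M \<Longrightarrow> X \<omega> \<in> F" "\<And>x. x \<in> F \<Longrightarrow> {x} \<in> sets S"
    and K: "\<And>x. x \<in> F \<Longrightarrow> K x \<in> borel_measurable T" "\<And>x y. 0 \<le> K x y"
    and kernel: "\<And>x B. x \<in> F \<Longrightarrow> B \<in> sets T \<Longrightarrow>
      emeasure M {\<omega> \<in> space M. X \<omega> = x \<and> Y \<omega> \<in> B} = (\<integral>\<^sup>+\<omega>. ennreal (K x (Y \<omega>)) * indicator B (Y \<omega>) \<partial>M)"
  shows "mutual_information b S T X Y
    = (\<integral>\<omega>. log b (K (X \<omega>) (Y \<omega>) / prob {\<omega>' \<in> space M. X \<omega>' = X \<omega>}) \<partial>M)"
proof -
  let ?P = "distr M S X" and ?Q = "distr M T Y" and ?N = "distr M (S \<Otimes>\<^sub>M T) (\<lambda>\<omega>. (X \<omega>, Y \<omega>))"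
  interpret P: prob_space ?P by (rule prob_space_distr) simp
  interpret Q: prob_space ?Q by (rule prob_space_distr) simp
  interpret PQ: pair_prob_space ?P ?Q ..
  define p where "p x = prob {\<omega> \<in> space M. X \<omega> = x}" for x
  define f where "f v = (\<Sum>x\<in>F. indicator {x} (fst v) * (K x (snd v) / p x))" for v
  have level [measurable]: "{\<omega> \<in> space M. X \<omega> = x} \<in> sets M" if "x \<in> F" for x
  proof -
    have "{\<omega> \<in> space M. X \<omega> = x} = X -` {x} \<inter> space M" by auto
    then show ?thesis using measurable_sets[OF X F(3)[OF that]] by simp
  qed
  have f_at: "f (x, y) = K x y / p x" if "x \<in> F" for x y
  proof -
    have "f (x, y) = (\<Sum>x'\<in>F. if x' = x then K x y / p x else 0)"
      unfolding f_def by (intro sum.cong refl) auto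
    then show ?thesis using that F(1) by simp
  qed
  have f0: "0 \<le> f v" for v
    unfolding f_def by (intro sum_nonneg mult_nonneg_nonneg divide_nonneg_nonneg K) (auto simp: p_def)
  have f [measurable]: "f \<in> borel_measurable (S \<Otimes>\<^sub>M T)"
  proof -
    have "(\<lambda>v. indicator {x} (fst v) * (K x (snd v) / p x)) \<in> borel_measurable (S \<Otimes>\<^sub>M T)" if "x \<in> F" for x
      using measurable_compose[OF measurable_fst borel_measurable_indicator[OF F(3)[OF that]]]
        measurable_compose[OF measurable_snd K(1)[OF that]]
      by (intro borel_measurable_times borel_measurable_divide) auto
    then show ?thesis unfolding f_def[abs_def] by (rule borel_measurable_sum)
  qed
  have "?N = density (?P \<Otimes>\<^sub>M ?Q) f"
  proof (rule measure_eqI)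
    fix A assume "A \<in> sets ?N"
    then have A [measurable]: "A \<in> sets (S \<Otimes>\<^sub>M T)" by simp
    have slice [measurable]: "Pair x -` A \<in> sets T" for x by (rule sets_Pair1[OF A])
    have slice_eq: "emeasure M {\<omega> \<in> space M. X \<omega> = x \<and> Y \<omega> \<in> Pair x -` A}
        = (\<integral>\<^sup>+y. ennreal (K x y) * indicator (Pair x -` A) y \<partial>?Q)" if "x \<in> F" for x
      unfolding kernel[OF that slice] using K(1)[OF that] by (subst nn_integral_distr) auto
    have meas: "{\<omega> \<in> space M. X \<omega> = x \<and> Y \<omega> \<in> Pair x -` A} \<in> sets M" if "x \<in> F" for x
    proof -
      have "{\<omega> \<in> space M. X \<omega> = x \<and> Y \<omega> \<in> Pair x -` A} = {\<omega> \<in> space M. X \<omega> = x} \<inter> (Y -` (Pair x -` A) \<inter> space M)"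
        by auto
      then show ?thesis using level[OF that] by simp
    qed
    have "emeasure ?N A = emeasure M (\<Union>x\<in>F. {\<omega> \<in> space M. X \<omega> = x \<and> Y \<omega> \<in> Pair x -` A})"
      by (subst emeasure_distr) (auto intro!: arg_cong[where f = "emeasure M"] dest: F(2))
    also have "\<dots> = (\<Sum>x\<in>F. emeasure M {\<omega> \<in> space M. X \<omega> = x \<and> Y \<omega> \<in> Pair x -` A})"
      by (rule sum_emeasure[symmetric]) (use F(1) meas in \<open>auto simp: disjoint_family_on_def\<close>)
    finally have left: "emeasure ?N A = (\<Sum>x\<in>F. emeasure M {\<omega> \<in> space M. X \<omega> = x \<and> Y \<omega> \<in> Pair x -` A})" .
    define g where "g x = (\<integral>\<^sup>+y. ennreal (f (x, y)) * indicator A (x, y) \<partial>?Q)" for x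
    have g [measurable]: "g \<in> borel_measurable S"
    proof -
      have "(\<lambda>x. \<integral>\<^sup>+y. (\<lambda>v. ennreal (f v) * indicator A v) (x, y) \<partial>?Q) \<in> borel_measurable S"
        by (rule Q.borel_measurable_nn_integral_fst) simp
      then show ?thesis by (simp add: g_def[abs_def])
    qed
    have "emeasure (density (?P \<Otimes>\<^sub>M ?Q) f) A = (\<integral>\<^sup>+v. ennreal (f v) * indicator A v \<partial>(?P \<Otimes>\<^sub>M ?Q))"
      by (subst emeasure_density) auto
    also have "\<dots> = (\<integral>\<^sup>+x. g x \<partial>?P)"
      unfolding g_def by (rule Q.nn_integral_fst[symmetric]) simp
    also have "\<dots> = (\<integral>\<^sup>+\<omega>. g (X \<omega>) \<partial>M)"
      by (subst nn_integral_distr) auto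
    also have "\<dots> = (\<integral>\<^sup>+\<omega>. (\<Sum>x\<in>F. g x * indicator {\<omega> \<in> space M. X \<omega> = x} \<omega>) \<partial>M)"
    proof (rule nn_integral_cong)
      fix \<omega> assume \<omega>: "\<omega> \<in> space M"
      have "(\<Sum>x\<in>F. g x * indicator {\<omega> \<in> space M. X \<omega> = x} \<omega>) = (\<Sum>x\<in>F. if x = X \<omega> then g (X \<omega>) else 0)"
        using \<omega> by (intro sum.cong refl) auto
      then show "g (X \<omega>) = (\<Sum>x\<in>F. g x * indicator {\<omega> \<in> space M. X \<omega> = x} \<omega>)"
        using F(1) F(2)[OF \<omega>] by simp
    qed
    also have "\<dots> = (\<Sum>x\<in>F. g x * emeasure M {\<omega> \<in> space M. X \<omega> = x})"
      by (subst nn_integral_sum) (auto simp: nn_integral_cmult_indicator)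
    also have "\<dots> = (\<Sum>x\<in>F. emeasure M {\<omega> \<in> space M. X \<omega> = x \<and> Y \<omega> \<in> Pair x -` A})"
    proof (rule sum.cong[OF refl])
      fix x assume x: "x \<in> F"
      have g_eq: "g x = (\<integral>\<^sup>+y. ennreal (K x y / p x) * indicator (Pair x -` A) y \<partial>?Q)"
        unfolding g_def using x by (intro nn_integral_cong) (auto simp: f_at indicator_def)
      show "g x * emeasure M {\<omega> \<in> space M. X \<omega> = x} = emeasure M {\<omega> \<in> space M. X \<omega> = x \<and> Y \<omega> \<in> Pair x -` A}"
      \<comment> \<open>If X = x is a null event, both sides vanish whatever the quotient by 0
        stands for.\<close>
      proof (cases "p x = 0")
        case True
        then have "emeasure M {\<omega> \<in> space M. X \<omega> = x} = 0"
          by (simp add: p_def emeasure_eq_measure)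
        moreover from this have "emeasure M {\<omega> \<in> space M. X \<omega> = x \<and> Y \<omega> \<in> Pair x -` A} = 0"
          by (rule emeasure_eq_0[OF level[OF x]]) auto
        ultimately show ?thesis by simp
      next
        case False
        then have p: "0 < p x" by (simp add: p_def zero_less_measure_iff)
        have "g x * ennreal (p x) = (\<integral>\<^sup>+y. ennreal (K x y / p x) * indicator (Pair x -` A) y * ennreal (p x) \<partial>?Q)"
          unfolding g_eq using K(1)[OF x] by (subst nn_integral_multc) auto
        also have "\<dots> = (\<integral>\<^sup>+y. ennreal (K x y) * indicator (Pair x -` A) y \<partial>?Q)"
          using p K(2) by (intro nn_integral_cong) (auto simp: indicator_def ennreal_mult'[symmetric])
        finally show ?thesis
          using slice_eq[OF x] by (simp add: p_def emeasure_eq_measure)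
      qed
    qed
    finally show "emeasure ?N A = emeasure (density (?P \<Otimes>\<^sub>M ?Q) f) A" using left by simp
  qed simp
  then have "mutual_information b S T X Y = KL_divergence b (?P \<Otimes>\<^sub>M ?Q) (density (?P \<Otimes>\<^sub>M ?Q) f)"
    by (simp add: mutual_information_def)
  also have "\<dots> = (\<integral>v. f v * log b (f v) \<partial>(?P \<Otimes>\<^sub>M ?Q))"
    by (rule PQ.KL_density) (use b f0 in auto)
  also have "\<dots> = (\<integral>v. log b (f v) \<partial>density (?P \<Otimes>\<^sub>M ?Q) f)"
    by (subst integral_density) (use f0 in auto)
  also have "\<dots> = (\<integral>v. log b (f v) \<partial>?N)"
    by (simp only: \<open>?N = density (?P \<Otimes>\<^sub>M ?Q) f\<close>)
  also have "\<dots> = (\<integral>\<omega>. log b (f (X \<omega>, Y \<omega>)) \<partial>M)"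
    by (subst integral_distr) auto
  also have "\<dots> = (\<integral>\<omega>. log b (K (X \<omega>) (Y \<omega>) / prob {\<omega>' \<in> space M. X \<omega>' = X \<omega>}) \<partial>M)"
    by (intro Bochner_Integration.integral_cong refl) (simp add: f_at F(2) p_def)
  finally show ?thesis .
qed

abbreviation pmf_ent :: "'a set \<Rightarrow> 'a pmf \<Rightarrow> ('a \<Rightarrow> 'b) \<Rightarrow> real" where
  "pmf_ent S pm \<equiv> finite_weight.ent S (pmf pm)"

text \<open>For uncountable randomness, \<open>E\<close> says that an observation alone tells which
  sample points yield it under the randomness behind it. The posterior of X is then a ratio of
  finite sums, and the information is the mean over the randomness of its discrete
  counterpart.\<close>

lemma mutual_information_pmf_pair:
  fixes pm :: "'a pmf" and \<Omega> :: "'r measure" and X :: "'a \<Rightarrow> 'x" and Y :: "'a \<Rightarrow> 'r \<Rightarrow> 'y"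
    and E :: "'a \<Rightarrow> 'y \<Rightarrow> bool"
  assumes b: "1 < b" and S: "finite S" "set_pmf pm \<subseteq> S" and \<Omega>: "prob_space \<Omega>"
    and X: "finite (range X)" "\<And>w. {X w} \<in> sets MX"
    and Y [measurable]: "(\<lambda>(w, \<rho>). Y w \<rho>) \<in> measure_pmf pm \<Otimes>\<^sub>M \<Omega> \<rightarrow>\<^sub>M MY"
    and E: "\<And>w w' \<rho>. w \<in> S \<Longrightarrow> w' \<in> S \<Longrightarrow> \<rho> \<in> space \<Omega> \<Longrightarrow> E w (Y w' \<rho>) \<longleftrightarrow> Y w \<rho> = Y w' \<rho>"
    and E_meas: "\<And>w. w \<in> S \<Longrightarrow> Measurable.pred MY (E w)"
  shows "prob_space.mutual_information (measure_pmf pm \<Otimes>\<^sub>M \<Omega>) b MX MY (\<lambda>(w, \<rho>). X w) (\<lambda>(w, \<rho>). Y w \<rho>)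
      = (\<integral>\<rho>. (pmf_ent S pm (\<lambda>w. Y w \<rho>) + pmf_ent S pm X - pmf_ent S pm (\<lambda>w. (X w, Y w \<rho>))) / ln b \<partial>\<Omega>)"
    and "integrable \<Omega> (\<lambda>\<rho>. (pmf_ent S pm (\<lambda>w. Y w \<rho>) + pmf_ent S pm X - pmf_ent S pm (\<lambda>w. (X w, Y w \<rho>))) / ln b)"
proof -
  interpret \<Omega>: prob_space \<Omega> by (rule \<Omega>)
  interpret W: finite_weight S "pmf pm" by unfold_locales (use S in auto)
  interpret M: pair_prob_space "measure_pmf pm" \<Omega> ..
  let ?M = "measure_pmf pm \<Otimes>\<^sub>M \<Omega>"
  \<comment> \<open>Bayes' rule: w is independent of the randomness, so given y only the sample
    points compatible with y remain, in proportion to their prior weights.\<close>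
  define K where "K x y = (\<Sum>w | w \<in> S \<and> X w = x \<and> E w y. pmf pm w) / (\<Sum>w | w \<in> S \<and> E w y. pmf pm w)" for x y
  define V where "V \<rho> w = Y w \<rho>" for \<rho> w
  define XV where "XV \<rho> w = (X w, Y w \<rho>)" for \<rho> w
  have total: "(\<Sum>w\<in>S. pmf pm w) = 1"
    using S by (rule sum_pmf_eq_1)
  have K_at: "K x (Y w \<rho>) = W.marg (XV \<rho>) (x, Y w \<rho>) / W.marg (V \<rho>) (Y w \<rho>)" if "w \<in> S" "\<rho> \<in> space \<Omega>" for x w \<rho>
    unfolding K_def W.marg_def
    by (intro arg_cong2[where f = "(/)"] sum.cong refl) (use that in \<open>auto simp: E V_def XV_def\<close>)
  have K_meas [measurable]: "K x \<in> borel_measurable MY" for x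
  proof -
    have sum_meas: "(\<lambda>y. \<Sum>w | w \<in> S \<and> P w \<and> E w y. pmf pm w) \<in> borel_measurable MY" for P
    proof -
      have "(\<lambda>y. \<Sum>w | w \<in> S \<and> P w \<and> E w y. pmf pm w) = (\<lambda>y. \<Sum>w\<in>S. if P w \<and> E w y then pmf pm w else 0)"
        using S(1) by (intro ext sum.mono_neutral_cong_left) auto
      also have "\<dots> \<in> borel_measurable MY"
      proof (rule borel_measurable_sum)
        fix w assume "w \<in> S"
        from E_meas[OF this] have [measurable]: "Measurable.pred MY (E w)" .
        show "(\<lambda>y. if P w \<and> E w y then pmf pm w else 0) \<in> borel_measurable MY"
          by measurable
      qed
      finally show ?thesis .
    qed
    have "(\<lambda>y. (\<Sum>w | w \<in> S \<and> X w = x \<and> E w y. pmf pm w) / (\<Sum>w | w \<in> S \<and> True \<and> E w y. pmf pm w)) \<in> borel_measurable MY"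
      by (intro borel_measurable_divide sum_meas)
    then show ?thesis by (simp add: K_def[abs_def])
  qed
  have K0: "0 \<le> K x y" for x y
    unfolding K_def by (intro divide_nonneg_nonneg sum_nonneg) auto
  have X_M [measurable]: "(\<lambda>(w, \<rho>). X w) \<in> ?M \<rightarrow>\<^sub>M MX"
  proof -
    have "X w \<in> space MX" for w using sets.sets_into_space[OF X(2)[of w]] by auto
    then have "X \<in> measure_pmf pm \<rightarrow>\<^sub>M MX" by simp
    from measurable_compose[OF measurable_fst this] show ?thesis by (simp add: case_prod_beta')
  qed
  have Y_sec [measurable]: "Y w \<in> \<Omega> \<rightarrow>\<^sub>M MY" for w
    using measurable_Pair2[OF Y, of w] by simp
  have kernel: "emeasure ?M {\<omega> \<in> space ?M. (\<lambda>(w, \<rho>). X w) \<omega> = x \<and> (\<lambda>(w, \<rho>). Y w \<rho>) \<omega> \<in> B}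
      = (\<integral>\<^sup>+\<omega>. ennreal (K x ((\<lambda>(w, \<rho>). Y w \<rho>) \<omega>)) * indicator B ((\<lambda>(w, \<rho>). Y w \<rho>) \<omega>) \<partial>?M)"
    if x: "x \<in> range X" and B [measurable]: "B \<in> sets MY" for x B
  proof -
    have [measurable]: "{x} \<in> sets MX" using x X(2) by auto
    define A where "A = (\<lambda>(w, \<rho>). X w) -` {x} \<inter> space ?M \<inter> ((\<lambda>(w, \<rho>). Y w \<rho>) -` B \<inter> space ?M)"
    have A [measurable]: "A \<in> sets ?M"
      unfolding A_def by (intro sets.Int measurable_sets[OF X_M] measurable_sets[OF Y]) auto
    have "emeasure ?M {\<omega> \<in> space ?M. (\<lambda>(w, \<rho>). X w) \<omega> = x \<and> (\<lambda>(w, \<rho>). Y w \<rho>) \<omega> \<in> B} = emeasure ?M A"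
      by (rule arg_cong[where f = "emeasure ?M"]) (auto simp: A_def)
    also have "\<dots> = (\<integral>\<^sup>+\<omega>. indicator A \<omega> \<partial>?M)" by simp
    also have "\<dots> = (\<integral>\<^sup>+\<rho>. \<integral>\<^sup>+w. indicator A (w, \<rho>) \<partial>measure_pmf pm \<partial>\<Omega>)"
      by (rule M.nn_integral_snd[symmetric]) simp
    also have "\<dots> = (\<integral>\<^sup>+\<rho>. \<integral>\<^sup>+w. ennreal (K x (Y w \<rho>)) * indicator B (Y w \<rho>) \<partial>measure_pmf pm \<partial>\<Omega>)"
    proof (rule nn_integral_cong)
      fix \<rho> assume \<rho>: "\<rho> \<in> space \<Omega>"
      have pmf_sum: "(\<integral>\<^sup>+w. ennreal (h w) \<partial>measure_pmf pm) = ennreal (\<Sum>w\<in>S. pmf pm w * h w)" if "\<And>w. 0 \<le> h w" for h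
        using S that by (subst nn_integral_measure_pmf_support[of S])
          (auto simp: ennreal_mult'[symmetric] mult.commute sum_ennreal intro!: arg_cong[where f = ennreal])
      have "(\<Sum>w\<in>S. pmf pm w * (of_bool (X w = x) * indicator B (Y w \<rho>)))
          = (\<Sum>v\<in>range X \<times> V \<rho> ` S. W.marg (XV \<rho>) v * (of_bool (fst v = x) * indicator B (snd v)))"
        using W.sum_weight_eq_sum_marg[of "range X \<times> V \<rho> ` S" "XV \<rho>" "\<lambda>v. of_bool (fst v = x) * indicator B (snd v)"] X(1) S(1)
        by (auto simp: XV_def V_def)
      also have "\<dots> = (\<Sum>a\<in>range X. \<Sum>v\<in>V \<rho> ` S. W.marg (XV \<rho>) (a, v) * (of_bool (a = x) * indicator B v))"
        by (simp add: sum.cartesian_product case_prod_beta)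
      also have "\<dots> = (\<Sum>a\<in>range X. if a = x then \<Sum>v\<in>V \<rho> ` S. W.marg (XV \<rho>) (x, v) * indicator B v else 0)"
        by (intro sum.cong refl) auto
      also have "\<dots> = (\<Sum>v\<in>V \<rho> ` S. W.marg (XV \<rho>) (x, v) * indicator B v)"
        using X(1) x by simp
      also have "\<dots> = (\<Sum>v\<in>V \<rho> ` S. W.marg (V \<rho>) v * (W.marg (XV \<rho>) (x, v) / W.marg (V \<rho>) v * indicator B v))"
      proof (rule sum.cong[OF refl])
        fix v
        \<comment> \<open>By this bound the numerator vanishes together with the
          denominator.\<close>
        have "W.marg (XV \<rho>) (x, v) \<le> W.marg (V \<rho>) v"
          by (rule W.marg_le_marg) (auto simp: XV_def V_def)
        then show "W.marg (XV \<rho>) (x, v) * indicator B v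
          = W.marg (V \<rho>) v * (W.marg (XV \<rho>) (x, v) / W.marg (V \<rho>) v * indicator B v)"
          using W.marg_nonneg[of "XV \<rho>" "(x, v)"] by (cases "W.marg (V \<rho>) v = 0") auto
      qed
      also have "\<dots> = (\<Sum>w\<in>S. pmf pm w * (W.marg (XV \<rho>) (x, V \<rho> w) / W.marg (V \<rho>) (V \<rho> w) * indicator B (V \<rho> w)))"
        using S(1) by (intro W.sum_weight_eq_sum_marg[symmetric]) auto
      also have "\<dots> = (\<Sum>w\<in>S. pmf pm w * (K x (Y w \<rho>) * indicator B (Y w \<rho>)))"
        by (intro sum.cong refl) (simp add: K_at \<rho> V_def)
      finally have "(\<integral>\<^sup>+w. ennreal (of_bool (X w = x) * indicator B (Y w \<rho>)) \<partial>measure_pmf pm)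
          = (\<integral>\<^sup>+w. ennreal (K x (Y w \<rho>) * indicator B (Y w \<rho>)) \<partial>measure_pmf pm)"
        by (simp add: pmf_sum K0)
      also have "(\<integral>\<^sup>+w. ennreal (of_bool (X w = x) * indicator B (Y w \<rho>)) \<partial>measure_pmf pm)
          = (\<integral>\<^sup>+w. indicator A (w, \<rho>) \<partial>measure_pmf pm)"
        using \<rho> by (intro nn_integral_cong) (auto simp: A_def space_pair_measure indicator_def)
      also have "(\<integral>\<^sup>+w. ennreal (K x (Y w \<rho>) * indicator B (Y w \<rho>)) \<partial>measure_pmf pm)
          = (\<integral>\<^sup>+w. ennreal (K x (Y w \<rho>)) * indicator B (Y w \<rho>) \<partial>measure_pmf pm)"
        by (intro nn_integral_cong) (auto simp: indicator_def)
      finally show "(\<integral>\<^sup>+w. indicator A (w, \<rho>) \<partial>measure_pmf pm)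
          = (\<integral>\<^sup>+w. ennreal (K x (Y w \<rho>)) * indicator B (Y w \<rho>) \<partial>measure_pmf pm)" .
    qed
    also have "\<dots> = (\<integral>\<^sup>+\<rho>. \<integral>\<^sup>+w. (\<lambda>\<omega>. ennreal (K x ((\<lambda>(w, \<rho>). Y w \<rho>) \<omega>)) * indicator B ((\<lambda>(w, \<rho>). Y w \<rho>) \<omega>)) (w, \<rho>)
        \<partial>measure_pmf pm \<partial>\<Omega>)" by simp
    also have "\<dots> = (\<integral>\<^sup>+\<omega>. ennreal (K x ((\<lambda>(w, \<rho>). Y w \<rho>) \<omega>)) * indicator B ((\<lambda>(w, \<rho>). Y w \<rho>) \<omega>) \<partial>?M)"
    proof (rule M.nn_integral_snd)
      have 1: "(\<lambda>\<omega>. K x ((\<lambda>(w, \<rho>). Y w \<rho>) \<omega>)) \<in> borel_measurable ?M"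
        by (rule measurable_compose[OF Y K_meas])
      have 2: "(\<lambda>\<omega>. indicator B ((\<lambda>(w, \<rho>). Y w \<rho>) \<omega>) :: ennreal) \<in> borel_measurable ?M"
        by (rule measurable_compose[OF Y borel_measurable_indicator[OF B]])
      show "(\<lambda>\<omega>. ennreal (K x ((\<lambda>(w, \<rho>). Y w \<rho>) \<omega>)) * indicator B ((\<lambda>(w, \<rho>). Y w \<rho>) \<omega>)) \<in> borel_measurable ?M"
        using 1 2 by measurable
    qed
    finally show ?thesis .
  qed
  define F where "F w \<rho> = log b (K (X w) (Y w \<rho>) / M.prob {\<omega> \<in> space ?M. (\<lambda>(w, \<rho>). X w) \<omega> = X w})" for w \<rho>
  have range_X: "(\<lambda>(w, \<rho>). X w) \<omega> \<in> range X" for \<omega> :: "'a \<times> 'r" by (auto split: prod.split)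
  have singletons: "{x} \<in> sets MX" if "x \<in> range X" for x using that X(2) by auto
  have MI: "M.mutual_information b MX MY (\<lambda>(w, \<rho>). X w) (\<lambda>(w, \<rho>). Y w \<rho>) = (\<integral>\<omega>. (\<lambda>(w, \<rho>). F w \<rho>) \<omega> \<partial>?M)"
    by (rule trans[OF M.mutual_information_finite_kernel[OF b X_M Y X(1) range_X singletons K_meas K0 kernel]],
        assumption+, intro Bochner_Integration.integral_cong refl) (auto simp: F_def)
  have prob_X: "M.prob {\<omega> \<in> space ?M. (\<lambda>(w, \<rho>). X w) \<omega> = x} = W.marg X x" for x
  proof -
    have "M.prob {\<omega> \<in> space ?M. (\<lambda>(w, \<rho>). X w) \<omega> = x} = M.prob ({w. X w = x} \<times> space \<Omega>)"
      by (rule arg_cong[where f = M.prob]) (auto simp: space_pair_measure)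
    also have "\<dots> = measure_pmf.prob pm {w. X w = x}"
      unfolding measure_def by (subst \<Omega>.emeasure_pair_measure_Times) (auto simp: \<Omega>.emeasure_space_1)
    also have "\<dots> = measure_pmf.prob pm {w \<in> S. X w = x}"
      by (rule measure_prob_cong_0) (use S(2) in \<open>auto simp: set_pmf_iff\<close>)
    also have "\<dots> = W.marg X x"
      using S(1) by (simp add: W.marg_def measure_measure_pmf_finite)
    finally show ?thesis .
  qed
  have bounds: "pmf pm w \<le> W.marg A (A w)" "W.marg A (A w) \<le> 1" if "w \<in> S" for w and A :: "'a \<Rightarrow> 'z"
  proof -
    show "pmf pm w \<le> W.marg A (A w)" by (rule W.weight_le_marg[OF that])
    show "W.marg A (A w) \<le> 1"
      unfolding W.marg_def total[symmetric] using S(1) by (intro sum_mono2) auto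
  qed
  have log_bound: "\<bar>log b t\<bar> \<le> - log b q" if "0 < q" "q \<le> t" "t \<le> 1" for t q
    using that b by (simp add: abs_if)
  have F_eq: "F w \<rho> = log b (W.marg (XV \<rho>) (XV \<rho> w)) - log b (W.marg (V \<rho>) (V \<rho> w)) - log b (W.marg X (X w))"
    if "w \<in> S" "pmf pm w \<noteq> 0" "\<rho> \<in> space \<Omega>" for w \<rho>
  proof -
    note pos = W.marg_pos[OF that(1,2), of X] W.marg_pos[OF that(1,2), of "V \<rho>"] W.marg_pos[OF that(1,2), of "XV \<rho>"]
    have "F w \<rho> = log b (W.marg (XV \<rho>) (XV \<rho> w) / W.marg (V \<rho>) (V \<rho> w) / W.marg X (X w))"
      unfolding F_def prob_X K_at[OF that(1,3)] by (simp add: V_def XV_def)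
    then show ?thesis using pos by (simp add: log_divide log_mult)
  qed
  have F_meas: "(\<lambda>(w, \<rho>). F w \<rho>) \<in> borel_measurable ?M"
  proof -
    have F_sum: "F w \<rho> = log b ((\<Sum>x\<in>range X. (if X w = x then 1 else 0) * K x (Y w \<rho>)) / W.marg X (X w))" for w \<rho>
    proof -
      have "(\<Sum>x\<in>range X. (if X w = x then 1 else 0) * K x (Y w \<rho>)) = (\<Sum>x\<in>range X. if x = X w then K (X w) (Y w \<rho>) else 0)"
        by (intro sum.cong refl) auto
      also have "\<dots> = K (X w) (Y w \<rho>)" using X(1) by simp
      finally show ?thesis unfolding F_def prob_X by simp
    qed
    have eq: "(\<lambda>(w, \<rho>). F w \<rho>) = (\<lambda>\<omega>. log b ((\<Sum>x\<in>range X. (if X (fst \<omega>) = x then 1 else 0) * K x ((\<lambda>(w, \<rho>). Y w \<rho>) \<omega>)) / W.marg X (X (fst \<omega>))))"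
      by (rule ext) (simp only: F_sum case_prod_beta)
    have fst_meas: "(\<lambda>\<omega>. h (fst \<omega>)) \<in> borel_measurable ?M" for h :: "'a \<Rightarrow> real"
      by (rule measurable_compose[OF measurable_fst]) simp
    show ?thesis
      unfolding eq
      by (intro borel_measurable_log borel_measurable_const borel_measurable_divide borel_measurable_sum
        borel_measurable_times fst_meas measurable_compose[OF Y K_meas])
  qed
  have integrable_F: "integrable ?M (\<lambda>(w, \<rho>). F w \<rho>)"
  proof (rule M.Fubini_integrable[OF F_meas])
    have fin: "finite (set_pmf pm)" using S finite_subset by blast
    then show "integrable (measure_pmf pm) (\<lambda>w. \<integral>\<rho>. norm ((\<lambda>(w, \<rho>). F w \<rho>) (w, \<rho>)) \<partial>\<Omega>)"
      by (rule integrable_measure_pmf_finite)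
    show "AE w in measure_pmf pm. integrable \<Omega> (\<lambda>\<rho>. (\<lambda>(w, \<rho>). F w \<rho>) (w, \<rho>))"
    proof (rule AE_pmfI)
      fix w assume "w \<in> set_pmf pm"
      then have w: "w \<in> S" "pmf pm w \<noteq> 0" using S(2) by (auto simp: set_pmf_iff)
      show "integrable \<Omega> (\<lambda>\<rho>. (\<lambda>(w, \<rho>). F w \<rho>) (w, \<rho>))"
      proof (rule \<Omega>.integrable_const_bound)
        \<comment> \<open>Each of the three marginals in \<open>F_eq\<close> lies between
          \<open>pmf pm w\<close> and 1, whence the factor 3.\<close>
        show "AE \<rho> in \<Omega>. norm ((\<lambda>(w, \<rho>). F w \<rho>) (w, \<rho>)) \<le> 3 * (- log b (pmf pm w))"
        proof (rule AE_I2)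
          fix \<rho> assume \<rho>: "\<rho> \<in> space \<Omega>"
          have p: "0 < pmf pm w" using w(2) by (simp add: pmf_pos)
          show "norm ((\<lambda>(w, \<rho>). F w \<rho>) (w, \<rho>)) \<le> 3 * (- log b (pmf pm w))"
            using log_bound[OF p bounds[OF w(1), of "XV \<rho>"]] log_bound[OF p bounds[OF w(1), of "V \<rho>"]]
              log_bound[OF p bounds[OF w(1), of X]]
            by (simp add: F_eq[OF w \<rho>])
        qed
        show "(\<lambda>\<rho>. (\<lambda>(w, \<rho>). F w \<rho>) (w, \<rho>)) \<in> borel_measurable \<Omega>"
          using measurable_Pair2[OF F_meas, of w] by simp
      qed
    qed
  qed
  have inner: "(\<integral>w. F w \<rho> \<partial>measure_pmf pm) = (W.ent (\<lambda>w. Y w \<rho>) + W.ent X - W.ent (\<lambda>w. (X w, Y w \<rho>))) / ln b"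
    if \<rho>: "\<rho> \<in> space \<Omega>" for \<rho>
  proof -
    have "(\<integral>w. F w \<rho> \<partial>measure_pmf pm) = (\<Sum>w\<in>S. F w \<rho> * pmf pm w)"
      using S by (intro integral_measure_pmf_real) auto
    also have "\<dots> = (\<Sum>w\<in>S. pmf pm w * (ln (W.marg (XV \<rho>) (XV \<rho> w)) - ln (W.marg (V \<rho>) (V \<rho> w)) - ln (W.marg X (X w))) / ln b)"
    proof (rule sum.cong[OF refl])
      fix w assume w: "w \<in> S"
      show "F w \<rho> * pmf pm w = pmf pm w * (ln (W.marg (XV \<rho>) (XV \<rho> w)) - ln (W.marg (V \<rho>) (V \<rho> w)) - ln (W.marg X (X w))) / ln b"
        by (cases "pmf pm w = 0") (use b in \<open>simp_all add: F_eq[OF w _ \<rho>] log_def field_simps\<close>)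
    qed
    also have "\<dots> = (W.ent (V \<rho>) + W.ent X - W.ent (XV \<rho>)) / ln b"
      unfolding W.ent_def by (simp add: sum_divide_distrib[symmetric] sum_subtractf sum.distrib algebra_simps)
    finally show ?thesis
      by (simp add: V_def[abs_def] XV_def[abs_def])
  qed
  show "integrable \<Omega> (\<lambda>\<rho>. (W.ent (\<lambda>w. Y w \<rho>) + W.ent X - W.ent (\<lambda>w. (X w, Y w \<rho>))) / ln b)"
    using M.integrable_snd[OF integrable_F] by (subst Bochner_Integration.integrable_cong[OF refl inner[symmetric]])
  have "M.mutual_information b MX MY (\<lambda>(w, \<rho>). X w) (\<lambda>(w, \<rho>). Y w \<rho>) = (\<integral>\<rho>. \<integral>w. F w \<rho> \<partial>measure_pmf pm \<partial>\<Omega>)"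
    unfolding MI by (rule M.integral_snd[OF integrable_F, symmetric])
  also have "\<dots> = (\<integral>\<rho>. (W.ent (\<lambda>w. Y w \<rho>) + W.ent X - W.ent (\<lambda>w. (X w, Y w \<rho>))) / ln b \<partial>\<Omega>)"
    by (intro Bochner_Integration.integral_cong refl inner)
  finally show "M.mutual_information b MX MY (\<lambda>(w, \<rho>). X w) (\<lambda>(w, \<rho>). Y w \<rho>)
      = (\<integral>\<rho>. (W.ent (\<lambda>w. Y w \<rho>) + W.ent X - W.ent (\<lambda>w. (X w, Y w \<rho>))) / ln b \<partial>\<Omega>)" .
qed

subsection \<open>The information cost of a protocol\<close>

lemma finite_inputs [simp, intro]: "finite (inputs k n)"
  unfolding inputs_def
  using finite_lists_length_eq[of "UNIV :: bool set" n] by (intro finite_PiE) auto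

lemma prob_space_coins: "prob_space coins"
  unfolding coins_def by (intro prob_space_PiM prob_space_measure_pmf)

lemma space_coins: "space coins = UNIV"
  by (simp add: coins_def space_PiM)

lemma prob_space_randomness: "prob_space (randomness k)"
  unfolding randomness_def by (intro prob_space_pair prob_space_PiM prob_space_coins)

lemma space_randomness: "\<rho> \<in> space (randomness k) \<longleftrightarrow> fst \<rho> \<in> {..<k} \<rightarrow>\<^sub>E UNIV"
  by (auto simp: randomness_def space_pair_measure space_PiM space_coins mem_Times_iff)

text \<open>Used to test measurably whether a sample point reproduces an observed transcript.
  Countability makes the diagonal of a product of discrete spaces measurable.\<close>

lemma pred_eq_count_space_PiM:
  fixes f g :: "'a \<Rightarrow> 'i \<Rightarrow> 'b :: countable"
  assumes I: "finite I"
    and f [measurable]: "f \<in> M \<rightarrow>\<^sub>M (\<Pi>\<^sub>M _\<in>I. count_space UNIV)"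
    and g [measurable]: "g \<in> M \<rightarrow>\<^sub>M (\<Pi>\<^sub>M _\<in>I. count_space UNIV)"
  shows "Measurable.pred M (\<lambda>y. f y = g y)"
proof -
  have "Measurable.pred M (\<lambda>y. f y j = g y j)" if "j \<in> I" for j
  proof -
    have [measurable]: "(\<lambda>y. f y j) \<in> M \<rightarrow>\<^sub>M count_space UNIV" "(\<lambda>y. g y j) \<in> M \<rightarrow>\<^sub>M count_space UNIV"
      using measurable_compose[OF f measurable_component_singleton[OF that]]
        measurable_compose[OF g measurable_component_singleton[OF that]] by simp_all
    have "(\<lambda>y. (f y j, g y j)) \<in> M \<rightarrow>\<^sub>M count_space UNIV \<Otimes>\<^sub>M count_space UNIV"
      by measurable
    then have "(\<lambda>y. (f y j, g y j)) \<in> M \<rightarrow>\<^sub>M count_space UNIV"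
      by (simp add: pair_measure_countable)
    from measurable_compose[OF this, of "\<lambda>v. fst v = snd v" "count_space UNIV"] show ?thesis
      by simp
  qed
  then have "Measurable.pred M (\<lambda>y. \<forall>j\<in>I. f y j = g y j)"
    by (intro pred_intros_finite(3) I)
  moreover have "(\<forall>j\<in>I. f y j = g y j) \<longleftrightarrow> f y = g y" if "y \<in> space M" for y
  proof
    assume eq: "\<forall>j\<in>I. f y j = g y j"
    show "f y = g y"
      by (rule PiE_ext[of _ I "\<lambda>_. UNIV"])
         (use measurable_space[OF f that] measurable_space[OF g that] eq in \<open>auto simp: space_PiM\<close>)
  qed auto
  ultimately show ?thesis
    by (subst measurable_cong) auto
qed

context
  fixes k n i :: nat and \<pi> :: protocol
  assumes i: "i < k" and trans: "measurable_transcripts k n \<pi>"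
begin

private abbreviation "others \<equiv> {..<k} - {i}"
private abbreviation "pm \<equiv> mu_pow k n"
private abbreviation "TS \<equiv> transcript_space k i"

private definition "transcript_of w \<rho> = run.transcript k \<pi> (input_of k n w) (fst \<rho>) (snd \<rho>) i"
private definition "other_inputs w = restrict (input_of k n w) others"
private definition "observed w \<rho> = ((transcript_of w \<rho>, restrict (fst \<rho>) others), (input_of k n w i, fst \<rho> i, snd \<rho>))"
private definition "own_part w \<rho> = (input_of k n w i, fst \<rho> i, snd \<rho>)"

text \<open>Conditional information is a difference of two mutual informations about the other
  inputs. For fixed randomness the transcript is a function of the inputs, so the other inputs
  together with either observation amount to the whole input. These joint entropies cancel, and the
  entropy of the transcript given the own input remains.\<close>

lemma player_information:
  shows "prob_space.conditional_mutual_information (measure_pmf pm \<Otimes>\<^sub>M randomness k) 2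
       (\<Pi>\<^sub>M _\<in>others. count_space UNIV)
       (TS \<Otimes>\<^sub>M (\<Pi>\<^sub>M _\<in>others. coins))
       (count_space UNIV \<Otimes>\<^sub>M coins \<Otimes>\<^sub>M coins)
       (\<lambda>(w, r, p). restrict (input_of k n w) others)
       (\<lambda>(w, r, p). (run.transcript k \<pi> (input_of k n w) r p i, restrict r others))
       (\<lambda>(w, r, p). (input_of k n w i, r i, p))
    = (\<integral>(r, p). (pmf_ent (samples k n) pm (\<lambda>w. (run.transcript k \<pi> (input_of k n w) r p i, input_of k n w i))
        - pmf_ent (samples k n) pm (\<lambda>w. input_of k n w i)) / ln 2 \<partial>randomness k)" (is ?value)
    and "integrable (randomness k) (\<lambda>(r, p).
        (pmf_ent (samples k n) pm (\<lambda>w. (run.transcript k \<pi> (input_of k n w) r p i, input_of k n w i))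
        - pmf_ent (samples k n) pm (\<lambda>w. input_of k n w i)) / ln 2)" (is ?integrable)
proof -
  let ?M = "measure_pmf pm \<Otimes>\<^sub>M randomness k" and ?S = "samples k n"
  let ?MX = "\<Pi>\<^sub>M _\<in>others. count_space UNIV :: bits measure"
  let ?MZ = "count_space UNIV \<Otimes>\<^sub>M coins \<Otimes>\<^sub>M coins :: (bits \<times> (nat \<Rightarrow> bool) \<times> (nat \<Rightarrow> bool)) measure"
  let ?MY = "(TS \<Otimes>\<^sub>M (\<Pi>\<^sub>M _\<in>others. coins)) \<Otimes>\<^sub>M ?MZ"
  interpret W: finite_weight ?S "pmf pm" by unfold_locales auto
  interpret \<Omega>: prob_space "randomness k" by (rule prob_space_randomness)
  interpret M: pair_prob_space "measure_pmf pm" "randomness k" ..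
  have support: "set_pmf pm \<subseteq> ?S" using i by (intro set_pmf_mu_pow) simp
  have X: "finite (range other_inputs)" "{other_inputs w} \<in> sets ?MX" for w
  proof -
    have "range other_inputs \<subseteq> (\<lambda>x. restrict x others) ` inputs k n"
      using input_of_in_inputs by (auto simp: other_inputs_def)
    then show "finite (range other_inputs)" by (rule finite_subset) auto
    have "{other_inputs w} = (\<Pi>\<^sub>E j\<in>others. {other_inputs w j})"
      by (rule PiE_singleton[symmetric]) (simp add: other_inputs_def)
    also have "\<dots> \<in> sets ?MX"
      by (rule sets_PiM_I_finite) auto
    finally show "{other_inputs w} \<in> sets ?MX" .
  qed
  have sec: "(\<lambda>\<rho>. run.transcript k \<pi> x (fst \<rho>) (snd \<rho>) i) \<in> randomness k \<rightarrow>\<^sub>M TS" if "x \<in> inputs k n" for x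
    using trans i that by (auto simp: measurable_transcripts_def case_prod_beta')
  have trans_meas: "(\<lambda>(w, \<rho>). transcript_of w \<rho>) \<in> ?M \<rightarrow>\<^sub>M TS"
  proof -
    have "input_of k n \<in> measure_pmf pm \<rightarrow>\<^sub>M count_space (inputs k n)"
      using input_of_in_inputs by auto
    from measurable_compose[OF measurable_fst this]
    have 1: "(\<lambda>\<omega>. (input_of k n (fst \<omega>), snd \<omega>)) \<in> ?M \<rightarrow>\<^sub>M count_space (inputs k n) \<Otimes>\<^sub>M randomness k"
      by (intro measurable_Pair) auto
    have 2: "(\<lambda>v. run.transcript k \<pi> (fst v) (fst (snd v)) (snd (snd v)) i) \<in> count_space (inputs k n) \<Otimes>\<^sub>M randomness k \<rightarrow>\<^sub>M TS"
      by (rule measurable_pair_measure_countable1) (use sec in \<open>auto intro: countable_finite\<close>)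
    show ?thesis
      using measurable_compose[OF 1 2] by (simp add: transcript_of_def case_prod_beta')
  qed
  have r_meas: "(\<lambda>\<omega>. fst (snd \<omega>)) \<in> ?M \<rightarrow>\<^sub>M (\<Pi>\<^sub>M _\<in>{..<k}. coins)"
    and p_meas: "(\<lambda>\<omega>. snd (snd \<omega>)) \<in> ?M \<rightarrow>\<^sub>M coins"
    unfolding randomness_def
    by (rule measurable_compose[OF measurable_snd measurable_fst] measurable_compose[OF measurable_snd measurable_snd])+
  have Z_meas: "(\<lambda>(w, \<rho>). own_part w \<rho>) \<in> ?M \<rightarrow>\<^sub>M ?MZ"
  proof -
    have "(\<lambda>\<omega>. input_of k n (fst \<omega>) i) \<in> ?M \<rightarrow>\<^sub>M count_space UNIV"
      by (rule measurable_compose[OF measurable_fst]) simp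
    moreover have "(\<lambda>\<omega>. fst (snd \<omega>) i) \<in> ?M \<rightarrow>\<^sub>M coins"
      by (rule measurable_compose[OF r_meas measurable_component_singleton]) (use i in simp)
    ultimately show ?thesis
      using p_meas by (simp add: own_part_def case_prod_beta')
  qed
  have Y_meas: "(\<lambda>(w, \<rho>). observed w \<rho>) \<in> ?M \<rightarrow>\<^sub>M ?MY"
  proof -
    have "(\<lambda>\<omega>. restrict (fst (snd \<omega>)) others) \<in> ?M \<rightarrow>\<^sub>M (\<Pi>\<^sub>M _\<in>others. coins)"
      by (rule measurable_compose[OF r_meas measurable_restrict_subset]) auto
    then show ?thesis
      using trans_meas Z_meas by (simp add: observed_def own_part_def case_prod_beta')
  qed
  \<comment> \<open>The strings of the others, the own string and the public string make up all of
    the randomness, so it can be reassembled from the observation; this is what makes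
    \<open>E\<close> below computable.\<close>
  define joint where "joint y = ((\<lambda>j\<in>{..<k}. if j = i then fst (snd (snd y)) else snd (fst y) j), snd (snd (snd y)))"
    for y :: "((nat \<Rightarrow> bits list \<times> bits list) \<times> (nat \<Rightarrow> nat \<Rightarrow> bool)) \<times> bits \<times> (nat \<Rightarrow> bool) \<times> (nat \<Rightarrow> bool)"
  have joint: "joint (observed w \<rho>) = \<rho>" if "\<rho> \<in> space (randomness k)" for w \<rho>
  proof -
    have "fst \<rho> j = undefined" if "\<not> j < k" for j
      using that \<open>\<rho> \<in> _\<close> by (auto simp: space_randomness PiE_def extensional_def)
    then show ?thesis
      by (auto simp: joint_def observed_def prod_eq_iff fun_eq_iff restrict_def)
  qed
  have joint_meas: "joint \<in> ?MY \<rightarrow>\<^sub>M randomness k"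
  proof -
    have "(\<lambda>y. if j = i then fst (snd (snd y)) else snd (fst y) j) \<in> ?MY \<rightarrow>\<^sub>M coins" if "j < k" for j
    proof (cases "j = i")
      case True
      then show ?thesis by simp
    next
      case False
      have "(\<lambda>y. snd (fst y)) \<in> ?MY \<rightarrow>\<^sub>M (\<Pi>\<^sub>M _\<in>others. coins)" by measurable
      from measurable_compose[OF this measurable_component_singleton[of j]] show ?thesis
        using False that by simp
    qed
    then have "(\<lambda>y. \<lambda>j\<in>{..<k}. if j = i then fst (snd (snd y)) else snd (fst y) j) \<in> ?MY \<rightarrow>\<^sub>M (\<Pi>\<^sub>M _\<in>{..<k}. coins)"
      by (intro measurable_restrict) auto
    then show ?thesis
      unfolding joint_def randomness_def by (intro measurable_Pair) simp_all
  qed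
  define E where "E w y \<longleftrightarrow> transcript_of w (joint y) = fst (fst y) \<and> input_of k n w i = fst (snd y)" for w y
  have E: "E w (observed w' \<rho>) \<longleftrightarrow> observed w \<rho> = observed w' \<rho>" if "\<rho> \<in> space (randomness k)" for w w' \<rho>
    unfolding E_def joint[OF that] by (auto simp: observed_def)
  have E_meas: "Measurable.pred ?MY (E w)" for w
  proof -
    have "(\<lambda>y. transcript_of w (joint y)) \<in> ?MY \<rightarrow>\<^sub>M TS"
      unfolding transcript_of_def by (rule measurable_compose[OF joint_meas sec]) (rule input_of_in_inputs)
    then have [measurable]: "Measurable.pred ?MY (\<lambda>y. transcript_of w (joint y) = fst (fst y))"
      unfolding transcript_space_def by (intro pred_eq_count_space_PiM) auto
    have "(\<lambda>y. fst (snd y)) \<in> ?MY \<rightarrow>\<^sub>M count_space UNIV" by measurable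
    from measurable_compose[OF this, of "\<lambda>x. input_of k n w i = x" "count_space UNIV"]
    have [measurable]: "Measurable.pred ?MY (\<lambda>y. input_of k n w i = fst (snd y))" by simp
    show ?thesis unfolding E_def by measurable
  qed
  define E' where "E' w z \<longleftrightarrow> input_of k n w i = fst z" for w and z :: "bits \<times> (nat \<Rightarrow> bool) \<times> (nat \<Rightarrow> bool)"
  have E': "E' w (own_part w' \<rho>) \<longleftrightarrow> own_part w \<rho> = own_part w' \<rho>" for w w' \<rho>
    by (auto simp: E'_def own_part_def)
  have E'_meas: "Measurable.pred ?MZ (E' w)" for w
  proof -
    have "fst \<in> ?MZ \<rightarrow>\<^sub>M count_space UNIV" by measurable
    from measurable_compose[OF this, of "\<lambda>x. input_of k n w i = x" "count_space UNIV"] show ?thesis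
      by (simp add: E'_def[abs_def])
  qed
  note Y_info = mutual_information_pmf_pair[where b = 2 and S = ?S and E = E,
    OF _ finite_samples support prob_space_randomness X Y_meas E E_meas, simplified]
  note Z_info = mutual_information_pmf_pair[where b = 2 and S = ?S and E = E',
    OF _ finite_samples support prob_space_randomness X Z_meas E' E'_meas, simplified]
  have determined: "observed v \<rho> = observed w \<rho> \<and> other_inputs v = other_inputs w \<longleftrightarrow> input_of k n v = input_of k n w"
    "own_part v \<rho> = own_part w \<rho> \<and> other_inputs v = other_inputs w \<longleftrightarrow> input_of k n v = input_of k n w" for v w \<rho>
  proof -
    have "input_of k n v = input_of k n w" if "input_of k n v i = input_of k n w i" "other_inputs v = other_inputs w"
    proof
      fix j show "input_of k n v j = input_of k n w j"
      proof (cases "j < k")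
        case True
        then show ?thesis
          using that(1) fun_cong[OF that(2), of j] by (cases "j = i") (simp_all add: other_inputs_def)
      qed (simp add: input_of_def)
    qed
    then show "observed v \<rho> = observed w \<rho> \<and> other_inputs v = other_inputs w \<longleftrightarrow> input_of k n v = input_of k n w"
      "own_part v \<rho> = own_part w \<rho> \<and> other_inputs v = other_inputs w \<longleftrightarrow> input_of k n v = input_of k n w"
      by (auto simp: observed_def own_part_def transcript_of_def other_inputs_def)
  qed
  have ents: "W.ent (\<lambda>w. observed w \<rho>) = W.ent (\<lambda>w. (transcript_of w \<rho>, input_of k n w i))"
    "W.ent (\<lambda>w. (other_inputs w, observed w \<rho>)) = W.ent (input_of k n)"
    "W.ent (\<lambda>w. own_part w \<rho>) = W.ent (\<lambda>w. input_of k n w i)"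
    "W.ent (\<lambda>w. (other_inputs w, own_part w \<rho>)) = W.ent (input_of k n)" for \<rho>
    by (rule W.ent_cong; use determined[of _ \<rho>] in \<open>auto simp: observed_def own_part_def\<close>)+
  let ?f = "\<lambda>\<rho>. (W.ent (\<lambda>w. (transcript_of w \<rho>, input_of k n w i)) + W.ent other_inputs - W.ent (input_of k n)) / ln 2"
  let ?g = "\<lambda>\<rho> :: (nat \<Rightarrow> nat \<Rightarrow> bool) \<times> (nat \<Rightarrow> bool). (W.ent (\<lambda>w. input_of k n w i) + W.ent other_inputs - W.ent (input_of k n)) / ln 2"
  have f: "M.mutual_information 2 ?MX ?MY (\<lambda>(w, \<rho>). other_inputs w) (\<lambda>(w, \<rho>). observed w \<rho>) = (\<integral>\<rho>. ?f \<rho> \<partial>randomness k)"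
    "integrable (randomness k) ?f"
    using Y_info unfolding ents by auto
  have g: "M.mutual_information 2 ?MX ?MZ (\<lambda>(w, \<rho>). other_inputs w) (\<lambda>(w, \<rho>). own_part w \<rho>) = (\<integral>\<rho>. ?g \<rho> \<partial>randomness k)"
    "integrable (randomness k) ?g"
    using Z_info unfolding ents by auto
  have diff: "?f \<rho> - ?g \<rho> = (W.ent (\<lambda>w. (transcript_of w \<rho>, input_of k n w i)) - W.ent (\<lambda>w. input_of k n w i)) / ln 2" for \<rho>
    by (simp add: diff_divide_distrib add_divide_distrib)
  have vars: "(\<lambda>(w, r, p). restrict (input_of k n w) others) = (\<lambda>(w, \<rho>). other_inputs w)"
    "(\<lambda>\<omega>. ((\<lambda>(w, r, p). (run.transcript k \<pi> (input_of k n w) r p i, restrict r others)) \<omega>,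
        (\<lambda>(w, r, p). (input_of k n w i, r i, p)) \<omega>)) = (\<lambda>(w, \<rho>). observed w \<rho>)"
    "(\<lambda>(w, r, p). (input_of k n w i, r i, p)) = (\<lambda>(w, \<rho>). own_part w \<rho>)"
    by (auto simp: fun_eq_iff other_inputs_def observed_def own_part_def transcript_of_def)
  show ?integrable
    using Bochner_Integration.integrable_diff[OF f(2) g(2)] unfolding diff
    by (simp add: transcript_of_def case_prod_beta')
  show ?value
    unfolding M.conditional_mutual_information_def vars(2) unfolding vars f(1) g(1)
    unfolding Bochner_Integration.integral_diff[OF f(2) g(2), symmetric] diff
    by (simp add: transcript_of_def case_prod_beta')
qed

end

subsection \<open>Asynchronous runs of proper synchronous protocols\<close>

lemma length_recv: "i < k \<Longrightarrow> j < k \<Longrightarrow> i \<noteq> j \<Longrightarrow> length (recv k m x t i j) = t"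
  by (induction t) auto

lemma recv_nth:
  assumes "i < k" "j < k" "i \<noteq> j" "s < t"
  shows "recv k m x t i j ! s = m j (Suc s) (x j) (recv k m x s j) i"
  using assms(4)
proof (induction t)
  case (Suc t)
  then show ?case
    using assms(1-3) by (cases "s = t") (auto simp: nth_append length_recv)
qed simp

text \<open>A player computes its messages from its input and its reads, so given the input the
  outgoing half of a history adds nothing.\<close>

lemma recv_sent_determined:
  assumes "x i = y i" "recv k m x t i = recv k m y t i"
  shows "recv k m x t j i = recv k m y t j i"
  using assms(2)
proof (induction t arbitrary: j)
  case (Suc t)
  from recv_Suc_rowD[OF Suc.prems] have "recv k m x t i = recv k m y t i" .
  with Suc.IH assms(1) show ?case by simp
qed simp

text \<open>\<open>the\<close> is harmless where it matters: before its stopping round a player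
  addresses everybody else.\<close>

definition message :: "protocol \<Rightarrow> (nat \<Rightarrow> nat \<Rightarrow> bool) \<Rightarrow> (nat \<Rightarrow> bool) \<Rightarrow>
    nat \<Rightarrow> nat \<Rightarrow> bits \<Rightarrow> (nat \<Rightarrow> bits list) \<Rightarrow> nat \<Rightarrow> bits" where
  "message \<pi> r p i l xi R j = the (msgs \<pi> i l (xi, r i, p, R) j)"

locale proper_run = run k \<pi> x r p for k \<pi> x r p +
  fixes tf :: nat
  assumes proper: "reachable c \<Longrightarrow> i < k \<Longrightarrow>
       (rnd (c i) < tf \<and> result c i = None \<and>
          recipients c i = {..<k} - {i} \<and> waits_for c i = {..<k} - {i}) \<or>
       (rnd (c i) = tf \<and> result c i \<noteq> None)"
begin

abbreviation "round_recv \<equiv> recv k (message \<pi> r p) x"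

text \<open>The messages of the current round are kept as an optional last entry, because in the
  stopping round a player may write to any set of players.\<close>

definition sent_in_round :: "nat \<Rightarrow> nat \<Rightarrow> nat \<Rightarrow> bits list" where
  "sent_in_round l i j = round_recv (l - 1) j i @
     (case msgs \<pi> i l (x i, r i, p, round_recv (l - 1) i) j of None \<Rightarrow> [] | Some b \<Rightarrow> [b])"

text \<open>Although the order of the steps is arbitrary, the local state of a player is a function of
  its local round.\<close>

definition round_state :: "config \<Rightarrow> nat \<Rightarrow> bool" where
  "round_state c i \<longleftrightarrow> 1 \<le> rnd (c i) \<and> rcvd (c i) = round_recv (rnd (c i) - 1) i \<and>
     sent (c i) = sent_in_round (rnd (c i)) i"

lemma sent_in_round_full:
  assumes "1 \<le> l" "i < k" "dom (msgs \<pi> i l (x i, r i, p, round_recv (l - 1) i)) = {..<k} - {i}"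
  shows "sent_in_round l i j = round_recv l j i"
proof -
  obtain t where t: "l = Suc t" using assms(1) by (cases l) auto
  show ?thesis
  proof (cases "j < k \<and> j \<noteq> i")
    case True
    then have "j \<in> dom (msgs \<pi> i l (x i, r i, p, round_recv (l - 1) i))" using assms(3) by auto
    then show ?thesis
      using True assms(2) by (auto simp: sent_in_round_def t message_def)
  next
    case False
    then have "j \<notin> dom (msgs \<pi> i l (x i, r i, p, round_recv (l - 1) i))" using assms(3) by auto
    then have "msgs \<pi> i l (x i, r i, p, round_recv (l - 1) i) j = None" by (simp add: domIff)
    then show ?thesis
      using False by (auto simp: sent_in_round_def recv_outside)
  qed
qed

lemma round_state_start: "round_state start i"
  by (auto simp: round_state_def start_def enter_def sent_in_round_def fun_eq_iff split: option.split)

lemma round_state_sent: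
  assumes "reachable c" "i < k" "round_state c i" "rnd (c i) < tf"
  shows "sent (c i) = (\<lambda>j. round_recv (rnd (c i)) j i)"
proof -
  have "recipients c i = {..<k} - {i}" using proper[OF assms(1,2)] assms(4) by auto
  then show ?thesis
    using assms by (auto simp: round_state_def recipients_def view_of_def sent_in_round_full)
qed

lemma round_state_step:
  assumes c: "reachable c" "\<And>i. i < k \<Longrightarrow> round_state c i" and step: "step c c'" and a: "a < k"
  shows "round_state c' a"
  using step
proof cases
  case (1 i)
  define l where "l = rnd (c i)"
  let ?R = "\<lambda>j. if j \<in> waits_for c i then rcvd (c i) j @ [next_msg c i j] else rcvd (c i) j"
  show ?thesis
  proof (cases "a = i")
    case False
    then show ?thesis using c(2)[OF a] 1 by (simp add: round_state_def)
  next
    case True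
    have l: "l < tf" "waits_for c i = {..<k} - {i}" "1 \<le> l"
      using proper[OF c(1) 1(2)] 1(3) c(2)[OF 1(2)] by (auto simp: l_def round_state_def)
    obtain t where t: "l = Suc t" using l(3) by (cases l) auto
    have rcvd: "rcvd (c i) = round_recv t i"
      using c(2)[OF 1(2)] by (simp add: round_state_def l_def[symmetric] t)
    have sent: "sent (c i) = (\<lambda>j. round_recv l j i)"
      using round_state_sent[OF c(1) 1(2) c(2)[OF 1(2)]] l by (simp add: l_def)
    have "?R = round_recv l i"
    proof
      fix j
      show "?R j = round_recv l i j"
      proof (cases "j \<in> waits_for c i")
        case False
        then have "\<not> (i < k \<and> j < k \<and> i \<noteq> j)" using l(2) by auto
        then show ?thesis using False by (simp add: rcvd recv_outside)
      next
        case True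
        then have j: "j < k" "i \<noteq> j" using l(2) by auto
        have avail: "t < length (sent (c j) i)"
          using 1(4) True by (auto simp: available_def rcvd length_recv[OF 1(2) j])
        have "sent (c j) i ! t = message \<pi> r p j (Suc t) (x j) (round_recv t j) i"
        \<comment> \<open>Player j may already have moved on, but by FIFO the entry at index t is
          its message of round t + 1.\<close>
        proof (cases "rnd (c j) < tf")
          case True
          have "sent (c j) i = round_recv (rnd (c j)) i j"
            using round_state_sent[OF c(1) j(1) c(2)[OF j(1)] True] by simp
          then show ?thesis
            using avail by (simp add: length_recv[OF 1(2) j] recv_nth[OF 1(2) j])
        next
          case False
          \<comment> \<open>A reading round precedes tf, so the entry lies before the optional
            messages of the stopping round.\<close>
          then have "t < rnd (c j) - 1" using proper[OF c(1) j(1)] l(1) t by auto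
          then show ?thesis
            using c(2)[OF j(1)]
            by (simp add: round_state_def sent_in_round_def nth_append length_recv[OF 1(2) j] recv_nth[OF 1(2) j])
        qed
        then have "next_msg c i j = message \<pi> r p j (Suc t) (x j) (round_recv t j) i"
          by (simp add: next_msg_def rcvd length_recv[OF 1(2) j])
        then show ?thesis
          using True 1(2) j by (simp add: rcvd t)
      qed
    qed
    then have "c' i = enter i (Suc l) (round_recv l i) (\<lambda>j. round_recv l j i)"
      using 1(1) by (simp add: l_def sent)
    then show ?thesis
      unfolding True
      by (auto simp: round_state_def enter_def sent_in_round_def fun_eq_iff split: option.split)
  qed
qed

lemma round_state_reachable:
  assumes "reachable c" "i < k"
  shows "round_state c i"
proof -
  have "reachable c \<and> (\<forall>i<k. round_state c i)"
    using assms(1) unfolding reachable_def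
  proof (induction rule: rtranclp_induct)
    case base
    then show ?case by (simp add: round_state_start)
  next
    case (step c c')
    then show ?case
      using round_state_step[of c c'] by (auto simp: reachable_def intro: rtranclp.rtrancl_into_rtrancl)
  qed
  then show ?thesis using assms(2) by blast
qed

lemma stopped_state:
  assumes "reachable c" "all_stopped c" "i < k"
  shows "sent (c i) = sent_in_round tf i" "rcvd (c i) = round_recv (tf - 1) i"
    "result c i = outp \<pi> i tf (x i, r i, p, round_recv (tf - 1) i)"
proof -
  have "rnd (c i) = tf" using proper[OF assms(1,3)] assms(2,3) by (auto simp: all_stopped_def)
  with round_state_reachable[OF assms(1,3)]
  show "sent (c i) = sent_in_round tf i" "rcvd (c i) = round_recv (tf - 1) i"
    "result c i = outp \<pi> i tf (x i, r i, p, round_recv (tf - 1) i)"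
    by (simp_all add: round_state_def result_def view_of_def)
qed

text \<open>Otherwise every reachable configuration would have a successor, and choosing successors
  forever would produce an infinite run.\<close>

lemma ex_stopped:
  assumes halts
  shows "\<exists>c. reachable c \<and> all_stopped c"
proof (rule ccontr)
  assume none: "\<not> ?thesis"
  have "\<exists>f. \<forall>t. (reachable (f t) \<and> (t = 0 \<longrightarrow> f t = start)) \<and> step (f t) (f (Suc t))"
  proof (rule dependent_nat_choice)
    show "\<exists>c. reachable c \<and> (0 = (0::nat) \<longrightarrow> c = start)"
      by (auto simp: reachable_def)
  next
    fix c and t :: nat assume "reachable c \<and> (t = 0 \<longrightarrow> c = start)"
    then have c: "reachable c" by simp
    then obtain c' where "step c c'"
      using assms none unfolding halts_def by blast
    then show "\<exists>c'. (reachable c' \<and> (Suc t = 0 \<longrightarrow> c' = start)) \<and> step c c'"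
      using c by (auto simp: reachable_def intro: rtranclp.rtrancl_into_rtrancl)
  qed
  then show False using assms unfolding halts_def by blast
qed

lemma transcript_eq:
  assumes halts "i < k"
  shows "transcript i = (\<lambda>j\<in>{..<k} - {i}. (sent_in_round tf i j, round_recv (tf - 1) i j))"
proof -
  obtain c where "reachable c" "all_stopped c" using ex_stopped[OF assms(1)] by blast
  then show ?thesis
    unfolding transcript_def using assms(2)
    by (intro the_equality) (auto simp: stopped_state)
qed

end

section \<open>From round histories to transcripts and the final bound\<close>

lemma ent_weight_cong:
  assumes "finite_weight S p" "\<And>w. w \<in> S \<Longrightarrow> p w = q w"
  shows "finite_weight.ent S p A = finite_weight.ent S q A"
proof -
  interpret p: finite_weight S p by fact
  interpret q: finite_weight S q
    by unfold_locales (use p.weight_nonneg assms(2) in \<open>metis p.finite_S\<close>)+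
  have "p.marg A a = q.marg A a" for a
    unfolding p.marg_def q.marg_def by (rule sum.cong) (use assms(2) in auto)
  then show ?thesis
    unfolding p.ent_def q.ent_def using assms(2) by (intro arg_cong[where f = uminus] sum.cong) auto
qed

lemma transcript_information_ge:
  fixes k n :: nat and r :: "nat \<Rightarrow> nat \<Rightarrow> bool" and p :: "nat \<Rightarrow> bool"
  assumes k: "1 < k" and proper: "proper_synchronous k n \<pi>" and computes: "computes_disj k n \<pi>"
  shows "real n * (real k - 1) / 48 \<le>
    (\<Sum>i<k. pmf_ent (samples k n) (mu_pow k n) (\<lambda>w. (run.transcript k \<pi> (input_of k n w) r p i, input_of k n w i))
        - pmf_ent (samples k n) (mu_pow k n) (\<lambda>w. input_of k n w i))"
proof -
  obtain tf where tf: "\<And>x r p c i. x \<in> inputs k n \<Longrightarrow> i < k \<Longrightarrow> run.reachable k \<pi> x r p c \<Longrightarrow>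
       (rnd (c i) < tf \<and> run.result \<pi> x r p c i = None \<and>
          run.recipients \<pi> x r p c i = {..<k} - {i} \<and>
          run.waits_for \<pi> x r p c i = {..<k} - {i}) \<or>
       (rnd (c i) = tf \<and> run.result \<pi> x r p c i \<noteq> None)"
    using proper unfolding proper_synchronous_def by metis
  have proper_run: "proper_run k \<pi> x r p tf" if "x \<in> inputs k n" for x
    using tf[OF that] unfolding proper_run_def by blast
  have halts: "run.halts k \<pi> x r p" if "x \<in> inputs k n" for x
    using computes that by (simp add: computes_disj_def)
  let ?m = "message \<pi> r p"
  let ?out = "\<lambda>i xi R. outp \<pi> i tf (xi, r i, p, R) = Some [True]"
  \<comment> \<open>A player that stops in local round tf has read in the tf - 1 rounds before
    it.\<close>
  interpret disj_protocol k n ?m "tf - 1" ?out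
  proof
    show "1 < k" by (rule k)
  next
    fix x i assume x: "x \<in> inputs k n" and i: "i < k"
    interpret R: proper_run k \<pi> x r p tf by (rule proper_run[OF x])
    obtain c where c: "R.reachable c" "R.all_stopped c" using R.ex_stopped[OF halts[OF x]] by blast
    then obtain y where "R.result c i = Some y" using i by (auto simp: R.all_stopped_def)
    moreover from this have "y = [disj k n x]"
      using computes x c(1) i unfolding computes_disj_def by blast
    ultimately show "?out i (x i) (recv k ?m x (tf - 1) i) = disj k n x"
      using R.stopped_state(3)[OF c i] by simp
  qed
  interpret W: finite_weight "samples k n" "pmf (mu_pow k n)" by unfold_locales auto
  have weight: "pmf_ent (samples k n) (mu_pow k n) A = ent A" for A :: "(nat \<Rightarrow> cell) \<Rightarrow> 'z"
    by (rule ent_weight_cong) (use k in \<open>auto simp: pmf_mu_pow W.finite_weight_axioms\<close>)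
  have "joint_ent (player_history (tf - 1) i) (inputs_of i) - obs_ent (inputs_of i)
      = pmf_ent (samples k n) (mu_pow k n) (\<lambda>w. (run.transcript k \<pi> (input_of k n w) r p i, input_of k n w i))
        - pmf_ent (samples k n) (mu_pow k n) (\<lambda>w. input_of k n w i)" if i: "i < k" for i
  proof -
    \<comment> \<open>Transcripts may contain extra messages of the stopping round, but these are
      functions of the own input and the reads. For equal own inputs, history and transcript thus
      determine each other.\<close>
    have "history k ?m x (tf - 1) i = history k ?m y (tf - 1) i
        \<longleftrightarrow> run.transcript k \<pi> x r p i = run.transcript k \<pi> y r p i"
      if x: "x \<in> inputs k n" and y: "y \<in> inputs k n" and eq: "x i = y i" for x y
    proof -
      interpret X: proper_run k \<pi> x r p tf by (rule proper_run[OF x])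
      interpret Y: proper_run k \<pi> y r p tf by (rule proper_run[OF y])
      have X: "X.transcript i = (\<lambda>j\<in>{..<k} - {i}. (X.sent_in_round tf i j, X.round_recv (tf - 1) i j))"
        by (rule X.transcript_eq[OF halts[OF x] i])
      have Y: "Y.transcript i = (\<lambda>j\<in>{..<k} - {i}. (Y.sent_in_round tf i j, Y.round_recv (tf - 1) i j))"
        by (rule Y.transcript_eq[OF halts[OF y] i])
      show ?thesis
      proof
        assume h: "history k ?m x (tf - 1) i = history k ?m y (tf - 1) i"
        then have "X.round_recv (tf - 1) i = Y.round_recv (tf - 1) i"
          "\<And>j. X.round_recv (tf - 1) j i = Y.round_recv (tf - 1) j i"
          unfolding history_def by (metis prod.inject)+
        then show "X.transcript i = Y.transcript i"
          unfolding X Y by (simp add: X.sent_in_round_def Y.sent_in_round_def eq)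
      next
        assume t: "X.transcript i = Y.transcript i"
        have own: "X.round_recv (tf - 1) i = Y.round_recv (tf - 1) i"
        proof
          fix j
          show "X.round_recv (tf - 1) i j = Y.round_recv (tf - 1) i j"
          proof (cases "i < k \<and> j < k \<and> i \<noteq> j")
            case True
            then show ?thesis using fun_cong[OF t[unfolded X Y], of j] by auto
          qed (simp add: recv_outside)
        qed
        show "history k ?m x (tf - 1) i = history k ?m y (tf - 1) i"
          unfolding history_def using own recv_sent_determined[of x i y, OF eq own] by simp
      qed
    qed
    from this[OF input_of_in_inputs input_of_in_inputs] have
      "joint_ent (player_history (tf - 1) i) (inputs_of i)
        = ent (\<lambda>w. (run.transcript k \<pi> (input_of k n w) r p i, input_of k n w i))"
      unfolding joint_ent_def by (intro ent_cong) (auto simp: observe_inputs_of_iff[OF i])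
    moreover have "obs_ent (inputs_of i) = ent (\<lambda>w. input_of k n w i)"
      unfolding obs_ent_def by (rule ent_cong) (simp add: observe_inputs_of_iff[OF i])
    ultimately show ?thesis by (simp add: weight)
  qed
  then show ?thesis
    using history_information_ge by simp
qed

theorem theorem7p20:
  shows "\<exists>C>0. \<forall>k>3. \<forall>n \<pi>.
    is_protocol k \<pi> \<and> self_delimiting k n \<pi> \<and> measurable_transcripts k n \<pi> \<and>
    proper_synchronous k n \<pi> \<and> computes_disj k n \<pi>
    \<longrightarrow> PIC k n \<pi> \<ge> C * real k * real n"
proof (intro exI[of _ "1/96"] conjI allI impI)
  fix k n :: nat and \<pi> :: protocol
  assume k: "3 < k" and \<pi>: "is_protocol k \<pi> \<and> self_delimiting k n \<pi> \<and> measurable_transcripts k n \<pi> \<and>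
    proper_synchronous k n \<pi> \<and> computes_disj k n \<pi>"
  interpret \<Omega>: prob_space "randomness k" by (rule prob_space_randomness)
  define h where "h i = (\<lambda>(r, p). (pmf_ent (samples k n) (mu_pow k n) (\<lambda>w. (run.transcript k \<pi> (input_of k n w) r p i, input_of k n w i))
        - pmf_ent (samples k n) (mu_pow k n) (\<lambda>w. input_of k n w i)) / ln 2)" for i
  have int: "integrable (randomness k) (h i)" if "i < k" for i
    unfolding h_def using player_information(2)[OF that] \<pi> by simp
  have "PIC k n \<pi> = (\<Sum>i<k. \<integral>\<rho>. h i \<rho> \<partial>randomness k)"
    unfolding PIC_def h_def using \<pi> by (intro sum.cong refl player_information(1)) auto
  also have "\<dots> = (\<integral>\<rho>. (\<Sum>i<k. h i \<rho>) \<partial>randomness k)"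
    by (rule Bochner_Integration.integral_sum[symmetric]) (use int in auto)
  finally have PIC: "PIC k n \<pi> = (\<integral>\<rho>. (\<Sum>i<k. h i \<rho>) \<partial>randomness k)" .
  have "real n * (real k - 1) / 48 / ln 2 \<le> (\<integral>\<rho>. (\<Sum>i<k. h i \<rho>) \<partial>randomness k)"
  proof (rule \<Omega>.integral_ge_const)
    show "integrable (randomness k) (\<lambda>\<rho>. \<Sum>i<k. h i \<rho>)" using int by auto
    have "real n * (real k - 1) / 48 / ln 2 \<le> (\<Sum>i<k. h i (r, p))" for r p
      unfolding h_def prod.case sum_divide_distrib[symmetric]
      by (intro divide_right_mono transcript_information_ge) (use k \<pi> in auto)
    then show "AE \<rho> in randomness k. real n * (real k - 1) / 48 / ln 2 \<le> (\<Sum>i<k. h i \<rho>)"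
      by auto
  qed
  \<comment> \<open>k <= 2 (k - 1) turns 1/48 into 1/96, and the division by ln 2 < 1 only enlarges
    the bound.\<close>
  moreover have "1/96 * real k * real n \<le> real n * (real k - 1) / 48 / ln 2"
  proof -
    have "1/96 * real k * real n \<le> real n * (real k - 1) / 48"
      using k mult_left_mono[of "real k" "2 * (real k - 1)" "real n"] by (simp add: algebra_simps)
    also have "\<dots> \<le> real n * (real k - 1) / 48 / ln 2"
      using k ln_2_less_1 by (subst pos_le_divide_eq) (auto intro!: mult_left_le)
    finally show ?thesis .
  qed
  ultimately show "PIC k n \<pi> \<ge> 1/96 * real k * real n"
    unfolding PIC by (rule order_trans[rotated])
qed simp
end
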